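(* $$a_n \sim \sqrt{\frac{24}{\pi}}\;2^n\, n^{-3/2}\qquad\text{as } n\to\infty.$$ In particular, $\displaystyle\lim_{n\to\infty}\frac{a_{n+1}}{a_n}=2$.
   Context: For $n\ge 1$ and $\theta\in\mathbb{R}$, $\mathscr{A}_{n,\theta}=\mathcal{C}(\mathbb{T}^n)\rtimes_\sigma\mathbb{Z}$ is the crossed product by the Anzai transformation $\sigma$ on $\mathbb{T}^n$, given by $\sigma^{-1}(\zeta_1,\dots,\zeta_n)=(e^{2\pi i\theta}\zeta_1,\zeta_1\zeta_2,\dots,\zeta_{n-1}\zeta_n)$, acting on $\mathcal{C}(\mathbb{T}^n)$ by $f\mapsto f\circ\sigma^{-1}$. $a_n$ denotes the common rank of $K_0(\mathscr{A}_{n,\theta})$ and $K_1(\mathscr{A}_{n,\theta})$ (independent of $\theta$); equivalently, $a_n=\sum_{r=0}^n\mathrm{rank}\ker(\wedge^r\mathsf{S}_n-\mathsf{I})$, where $\mathsf{S}_n$ is the $n\times n$ Jordan block with $1$'s on the diagonal and superdiagonal and $\wedge^r\mathsf{S}_n$ is its $r$-th exterior power. $x_n\sim y_n$ means $x_n/y_n\to1$. *)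

theory Defs
  imports
    "HOL-Algebra.Free_Abelian_Groups"
    "HOL-Algebra.Generated_Groups"
    "HOL-Library.Landau_Symbols"
    "HOL-Analysis.Analysis"
    "Jordan_Normal_Form.Jordan_Normal_Form"
begin

section \<open>Rank of an abelian group\<close>

definition int_independent :: "('a, 'b) monoid_scheme \<Rightarrow> 'a set \<Rightarrow> bool" where
  "int_independent G B \<longleftrightarrow> finite B \<and> B \<subseteq> carrier G \<and>
     (\<forall>c :: 'a \<Rightarrow> int. finprod G (\<lambda>b. b [^]\<^bsub>G\<^esub> c b) B = \<one>\<^bsub>G\<^esub> \<longrightarrow> (\<forall>b\<in>B. c b = 0))"

text \<open>Only meaningful if the cardinalities below are bounded, i.e. if \<open>G\<close> has finite rank
  (in particular if \<open>G\<close> is finitely generated).\<close>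

definition abelian_rank :: "('a, 'b) monoid_scheme \<Rightarrow> nat" where
  "abelian_rank G = Sup {card B | B. int_independent G B}"


section \<open>Exterior powers of the free module of integer vectors\<close>

text \<open>The \<open>r\<close>-th exterior power of \<open>\<int>\<^sup>n\<close> is presented as the free abelian group on all \<open>r\<close>-tuples
  of vectors, where the tuple \<open>[v\<^sub>1, \<dots>, v\<^sub>r]\<close> stands for \<open>v\<^sub>1 \<and> \<dots> \<and> v\<^sub>r\<close>, modulo the relations that
  make this expression multilinear and alternating.  Over the integers, additivity in each
  argument already implies homogeneity.\<close>

definition ext_gens :: "nat \<Rightarrow> nat \<Rightarrow> int vec list set" where
  "ext_gens n r = {vs. length vs = r \<and> set vs \<subseteq> carrier_vec n}"

definition ext_rels :: "nat \<Rightarrow> nat \<Rightarrow> (int vec list \<Rightarrow>\<^sub>0 int) set" where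
  "ext_rels n r =
     {frag_of (vs[i := u + v]) - (frag_of (vs[i := u]) + frag_of (vs[i := v])) | vs i u v.
        vs \<in> ext_gens n r \<and> i < r \<and> u \<in> carrier_vec n \<and> v \<in> carrier_vec n} \<union>
     {frag_of vs | vs. vs \<in> ext_gens n r \<and> (\<exists>i<r. \<exists>j<r. i \<noteq> j \<and> vs ! i = vs ! j)}"

definition ext_tuples :: "nat \<Rightarrow> nat \<Rightarrow> (int vec list \<Rightarrow>\<^sub>0 int) monoid" where
  "ext_tuples n r = free_Abelian_group (ext_gens n r)"

definition ext_null :: "nat \<Rightarrow> nat \<Rightarrow> (int vec list \<Rightarrow>\<^sub>0 int) set" where
  "ext_null n r = generate (ext_tuples n r) (ext_rels n r)"

definition ext_power :: "nat \<Rightarrow> nat \<Rightarrow> (int vec list \<Rightarrow>\<^sub>0 int) set monoid" where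
  "ext_power n r = ext_tuples n r Mod ext_null n r"

definition tuple_map :: "int mat \<Rightarrow> (int vec list \<Rightarrow>\<^sub>0 int) \<Rightarrow> (int vec list \<Rightarrow>\<^sub>0 int)" where
  "tuple_map A = frag_extend (\<lambda>vs. frag_of (map (\<lambda>v. A *\<^sub>v v) vs))"

text \<open>The induced endomorphism \<open>v\<^sub>1 \<and> \<dots> \<and> v\<^sub>r \<mapsto> A v\<^sub>1 \<and> \<dots> \<and> A v\<^sub>r\<close>.  All members of the
  union are the same coset, as is shown in \<open>ext_map_coset\<close> below.\<close>

definition ext_map :: "nat \<Rightarrow> nat \<Rightarrow> int mat \<Rightarrow> (int vec list \<Rightarrow>\<^sub>0 int) set \<Rightarrow> (int vec list \<Rightarrow>\<^sub>0 int) set" where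
  "ext_map n r A X = (\<Union>x\<in>X. ext_null n r #>\<^bsub>ext_tuples n r\<^esub> tuple_map A x)"

definition ext_map_minus_id :: "nat \<Rightarrow> nat \<Rightarrow> int mat \<Rightarrow> (int vec list \<Rightarrow>\<^sub>0 int) set \<Rightarrow> (int vec list \<Rightarrow>\<^sub>0 int) set" where
  "ext_map_minus_id n r A X = ext_map n r A X \<otimes>\<^bsub>ext_power n r\<^esub> inv\<^bsub>ext_power n r\<^esub> X"


section \<open>The ranks of the K-groups\<close>

text \<open>By the Pimsner--Voiculescu sequence, both K-groups of the crossed product of
  \<open>C(\<T>\<^sup>n)\<close> by the Anzai transformation have rank \<open>\<Sum>\<^sub>r rank ker (\<And>\<^sup>r S\<^sub>n - I)\<close>, where \<open>S\<^sub>n\<close> is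
  the \<open>n \<times> n\<close> Jordan block with eigenvalue 1, for every rotation parameter \<open>\<theta>\<close>.  K-theory of
  \<open>C\<^sup>*\<close>-algebras is not available, and the sum serves as the definition.\<close>

definition anzai_rank :: "nat \<Rightarrow> nat" where
  "anzai_rank n = (\<Sum>r=0..n. abelian_rank ((ext_power n r)
      \<lparr>carrier := kernel (ext_power n r) (ext_power n r) (ext_map_minus_id n r (jordan_block n 1))\<rparr>))"


section \<open>Well-definedness\<close>

lemma comm_group_ext_tuples: "comm_group (ext_tuples n r)"
  by (simp add: ext_tuples_def abelian_free_Abelian_group)

lemma ext_gens_update:
  assumes "vs \<in> ext_gens n r" "u \<in> carrier_vec n"
  shows "vs[i := u] \<in> ext_gens n r"
  using assms set_update_subset_insert[of vs i u] by (auto simp: ext_gens_def)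

lemma ext_rels_subset: "ext_rels n r \<subseteq> carrier (ext_tuples n r)"
proof -
  have *: "frag_of vs \<in> carrier (ext_tuples n r)" if "vs \<in> ext_gens n r" for vs
    using that by (simp add: ext_tuples_def)
  have **: "x - (y + z) \<in> carrier (ext_tuples n r)"
    if "x \<in> carrier (ext_tuples n r)" "y \<in> carrier (ext_tuples n r)" "z \<in> carrier (ext_tuples n r)" for x y z
  proof -
    have "Poly_Mapping.keys (x - (y + z)) \<subseteq> Poly_Mapping.keys x \<union> (Poly_Mapping.keys y \<union> Poly_Mapping.keys z)"
      using keys_diff[of x "y + z"] Poly_Mapping.keys_add[of y z] by blast
    with that show ?thesis by (auto simp: ext_tuples_def)
  qed
  show ?thesis
    by (auto simp: ext_rels_def intro!: * ** ext_gens_update)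
qed

lemma subgroup_ext_null: "subgroup (ext_null n r) (ext_tuples n r)"
proof -
  interpret comm_group "ext_tuples n r" by (rule comm_group_ext_tuples)
  show ?thesis unfolding ext_null_def by (rule generate_is_subgroup[OF ext_rels_subset])
qed

lemma comm_group_ext_power: "comm_group (ext_power n r)"
proof -
  interpret comm_group "ext_tuples n r" by (rule comm_group_ext_tuples)
  show ?thesis unfolding ext_power_def by (rule abelian_FactGroup[OF subgroup_ext_null])
qed

lemma map_ext_gens:
  assumes "A \<in> carrier_mat n n" "vs \<in> ext_gens n r"
  shows "map (\<lambda>v. A *\<^sub>v v) vs \<in> ext_gens n r"
  using assms by (auto simp: ext_gens_def)

lemma tuple_map_hom:
  assumes "A \<in> carrier_mat n n"
  shows "tuple_map A \<in> hom (ext_tuples n r) (ext_tuples n r)"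
proof (rule homI)
  fix x assume "x \<in> carrier (ext_tuples n r)"
  then have "Poly_Mapping.keys x \<subseteq> ext_gens n r" by (simp add: ext_tuples_def)
  then show "tuple_map A x \<in> carrier (ext_tuples n r)"
    using keys_frag_extend[of "\<lambda>vs. frag_of (map (\<lambda>v. A *\<^sub>v v) vs)" x] map_ext_gens[OF assms]
    by (fastforce simp: ext_tuples_def tuple_map_def)
qed (simp add: ext_tuples_def tuple_map_def frag_extend_add)

lemma tuple_map_rels:
  assumes A: "A \<in> carrier_mat n n" and x: "x \<in> ext_rels n r"
  shows "tuple_map A x \<in> ext_rels n r"
proof -
  let ?f = "map (\<lambda>v. A *\<^sub>v v)"
  have t: "tuple_map A (frag_of vs) = frag_of (?f vs)" for vs
    by (simp add: tuple_map_def)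
  consider (1) vs i u v where "x = frag_of (vs[i := u + v]) - (frag_of (vs[i := u]) + frag_of (vs[i := v]))"
      "vs \<in> ext_gens n r" "i < r" "u \<in> carrier_vec n" "v \<in> carrier_vec n"
    | (2) vs i j where "x = frag_of vs" "vs \<in> ext_gens n r" "i < r" "j < r" "i \<noteq> j" "vs ! i = vs ! j"
    using x unfolding ext_rels_def by blast
  then show ?thesis
  proof cases
    case 1
    have "tuple_map A x = frag_of ((?f vs)[i := A *\<^sub>v u + A *\<^sub>v v]) -
        (frag_of ((?f vs)[i := A *\<^sub>v u]) + frag_of ((?f vs)[i := A *\<^sub>v v]))"
      using 1 A mult_add_distrib_mat_vec[OF A, of u v]
      by (simp add: tuple_map_def frag_extend_diff frag_extend_add map_update)
    moreover have "A *\<^sub>v u \<in> carrier_vec n" "A *\<^sub>v v \<in> carrier_vec n"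
      using 1 A by auto
    ultimately show ?thesis
      using map_ext_gens[OF A 1(2)] 1(3) unfolding ext_rels_def by blast
  next
    case 2
    have "?f vs ! i = ?f vs ! j" using 2 by (auto simp: ext_gens_def)
    then show ?thesis
      using map_ext_gens[OF A 2(2)] 2 unfolding ext_rels_def t 2(1) by blast
  qed
qed

lemma tuple_map_null:
  assumes A: "A \<in> carrier_mat n n" and x: "x \<in> ext_null n r"
  shows "tuple_map A x \<in> ext_null n r"
proof -
  interpret comm_group "ext_tuples n r" by (rule comm_group_ext_tuples)
  interpret h: group_hom "ext_tuples n r" "ext_tuples n r" "tuple_map A"
    using tuple_map_hom[OF A] by (simp add: group_hom_def group_hom_axioms_def is_group)
  have "tuple_map A ` ext_null n r = generate (ext_tuples n r) (tuple_map A ` ext_rels n r)"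
    unfolding ext_null_def by (rule h.generate_img[OF ext_rels_subset, symmetric])
  also have "\<dots> \<subseteq> ext_null n r"
    unfolding ext_null_def using tuple_map_rels[OF A] by (intro mono_generate) auto
  finally show ?thesis using x by blast
qed

lemma ext_map_coset:
  assumes A: "A \<in> carrier_mat n n" and x: "x \<in> carrier (ext_tuples n r)"
  shows "ext_map n r A (ext_null n r #>\<^bsub>ext_tuples n r\<^esub> x) = ext_null n r #>\<^bsub>ext_tuples n r\<^esub> tuple_map A x"
proof -
  interpret comm_group "ext_tuples n r" by (rule comm_group_ext_tuples)
  interpret h: group_hom "ext_tuples n r" "ext_tuples n r" "tuple_map A"
    using tuple_map_hom[OF A] by (simp add: group_hom_def group_hom_axioms_def is_group)
  note N = subgroup_ext_null[of n r]
  have "ext_null n r #>\<^bsub>ext_tuples n r\<^esub> tuple_map A y = ext_null n r #>\<^bsub>ext_tuples n r\<^esub> tuple_map A x"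
    if y: "y \<in> ext_null n r #>\<^bsub>ext_tuples n r\<^esub> x" for y
  proof -
    obtain h where h: "h \<in> ext_null n r" "y = h \<otimes>\<^bsub>ext_tuples n r\<^esub> x"
      using y by (auto simp: r_coset_def)
    then have "tuple_map A y = tuple_map A h \<otimes>\<^bsub>ext_tuples n r\<^esub> tuple_map A x"
      using subgroup.mem_carrier[OF N] x by simp
    then have "tuple_map A y \<in> ext_null n r #>\<^bsub>ext_tuples n r\<^esub> tuple_map A x"
      using tuple_map_null[OF A h(1)] by (auto simp: r_coset_def)
    then show ?thesis
      using repr_independence[OF _ _ N] h.hom_closed[OF x] by metis
  qed
  moreover have "x \<in> ext_null n r #>\<^bsub>ext_tuples n r\<^esub> x"
    by (rule rcos_self[OF x N])
  ultimately show ?thesis unfolding ext_map_def by blast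
qed

lemma ext_map_hom:
  assumes A: "A \<in> carrier_mat n n"
  shows "ext_map n r A \<in> hom (ext_power n r) (ext_power n r)"
proof -
  interpret comm_group "ext_tuples n r" by (rule comm_group_ext_tuples)
  interpret h: group_hom "ext_tuples n r" "ext_tuples n r" "tuple_map A"
    using tuple_map_hom[OF A] by (simp add: group_hom_def group_hom_axioms_def is_group)
  interpret N: normal "ext_null n r" "ext_tuples n r"
    by (simp add: normal_iff_subgroup subgroup_ext_null)
  show ?thesis
    by (rule homI) (auto simp: ext_power_def carrier_FactGroup N.rcos_sum ext_map_coset[OF A])
qed

end

theory Submission
  imports
    Defs
    "HOL-Library.Function_Algebras"
    "HOL-Probability.Distributions"
    "HOL-Real_Asymp.Real_Asymp"
begin

text \<open>Up to torsion, the \<open>r\<close>-th exterior power of \<open>\<int>\<^sup>n\<close> is the group of alternating functions on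
  \<open>r\<close>-tuples of indices, and there the map induced by the Jordan block sends \<open>f\<close> to
  \<open>x \<mapsto> \<Sum>\<^sub>D f (x + 1\<^sub>D)\<close>, where \<open>D\<close> runs through the sets of positions.  Minus the identity, its
  leading part for the grading by \<open>\<Sum>\<^sub>k x\<^sub>k\<close> is the lowering operator of an \<open>sl\<^sub>2\<close>-action.  That operator
  is injective above the middle weight and surjective below it, so the kernel has the dimension of
  the middle weight space.  Hence \<open>a\<^sub>n\<close> is the number of subsets \<open>I\<close> of \<open>{0, \<dots>, n - 1}\<close> with sum
  \<open>\<lfloor>card I (n - 1) / 2\<rfloor>\<close>.

  By Fourier inversion this number is \<open>2\<^sup>n\<close> times an integral of the product of the
  \<open>cos (t (2 j - n + 1) / 2)\<close>.  For \<open>\<bar>t\<bar> \<ge> \<pi> / n\<close> the product is exponentially small, and the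
  substitution \<open>t = u / n\<^bsup>3/2\<^esup>\<close> turns the rest into an integral that converges by dominated
  convergence to the one of \<open>exp (- u\<^sup>2 / 24)\<close>.\<close>

subsection \<open>The action of sl(2) on functions of index tuples\<close>

text \<open>The shift minus the identity is not homogeneous, so the sl(2)-argument applies only to
  top weights. Two consequences suffice: a fixed function has no weight above the middle weight
  \<open>m\<close>, and the operator maps the functions of weight at most \<open>m\<close> onto
  those of weight below \<open>m\<close>. Rank-nullity between these two steps of the filtration
  leaves the number of sets of weight exactly \<open>m\<close>. The floor in the count makes the
  parity of \<open>n\<close> matter. Both normalisations lead to 1/\<pi> times the same main
  integral. The sum of (2 j - n + 1)^2 / 4 is n (n^2 - 1) / 12. Hence the product of cosines is
  close to exp (- t^2 n^3 / 24) near 0, the rescaled integral tends to sqrt (24 \<pi>), and division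
  by \<pi> gives sqrt (24 / \<pi>).\<close>

lemma sum_fun_apply: "sum f A x = (\<Sum>a\<in>A. f a x)" for f :: "'a \<Rightarrow> 'b \<Rightarrow> 'c::comm_monoid_add"
  by (induction A rule: infinite_finite_induct) auto

definition fscale :: "rat \<Rightarrow> ('i \<Rightarrow> rat) \<Rightarrow> 'i \<Rightarrow> rat" where
  "fscale c f = (\<lambda>x. c * f x)"

lemma fscale_apply [simp]: "fscale c f x = c * f x"
  by (simp add: fscale_def)

interpretation fs: vector_space fscale
  by unfold_locales (auto simp: fun_eq_iff algebra_simps)

definition grid :: "nat \<Rightarrow> nat \<Rightarrow> (nat \<Rightarrow> nat) set" where
  "grid n r = ({..<r} \<rightarrow>\<^sub>E {..<n})"

lemma finite_grid [simp]: "finite (grid n r)"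
  by (simp add: grid_def finite_PiE)

lemma grid_upd: "x(k := i) \<in> grid n r \<Longrightarrow> k < r \<Longrightarrow> x k < n \<Longrightarrow> x \<in> grid n r"
  by (auto simp: grid_def PiE_iff extensional_def split: if_splits)

lemma grid_comp:
  assumes "\<tau> permutes {..<r}"
  shows "x \<circ> \<tau> \<in> grid n r \<longleftrightarrow> x \<in> grid n r"
proof -
  have *: "x \<circ> \<tau> \<in> grid n r" if "x \<in> grid n r" "\<tau> permutes {..<r}" for x \<tau>
    using that permutes_in_image[OF that(2)] permutes_not_in[OF that(2)]
    by (auto simp: grid_def PiE_iff extensional_def)
  show ?thesis
    using *[of x \<tau>] *[of "x \<circ> \<tau>" "inv_into UNIV \<tau>"] assms permutes_inv[OF assms] permutes_inv_o(1)[OF assms]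
    by (auto simp: comp_assoc)
qed

definition weight :: "nat \<Rightarrow> (nat \<Rightarrow> nat) \<Rightarrow> int" where
  "weight r x = (\<Sum>k<r. int (x k))"

lemma weight_nonneg: "0 \<le> weight r x"
  by (simp add: weight_def sum_nonneg)

text \<open>By this convention the zero function is homogeneous of every weight, so operators shift
  weights without a case distinction.\<close>

definition homog :: "nat \<Rightarrow> int \<Rightarrow> ((nat \<Rightarrow> nat) \<Rightarrow> rat) \<Rightarrow> bool" where
  "homog r s f \<longleftrightarrow> (\<forall>x. f x \<noteq> 0 \<longrightarrow> weight r x = s)"

definition grid_supported :: "nat \<Rightarrow> nat \<Rightarrow> ((nat \<Rightarrow> nat) \<Rightarrow> rat) \<Rightarrow> bool" where
  "grid_supported n r f \<longleftrightarrow> (\<forall>x. f x \<noteq> 0 \<longrightarrow> x \<in> grid n r)"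

text \<open>The tuple \<open>x\<close> stands for the tensor of basis vectors with indices \<open>x 0, \<dots>, x (r - 1)\<close>, counted
  from 0.  The coefficients of \<open>raise\<close> are those that make the commutator with \<open>lower\<close> a scalar on
  each weight space; they vanish for \<open>x k = 0\<close>, where \<open>x k - 1\<close> is truncated.\<close>

definition lower :: "nat \<Rightarrow> ((nat \<Rightarrow> nat) \<Rightarrow> rat) \<Rightarrow> (nat \<Rightarrow> nat) \<Rightarrow> rat" where
  "lower r f x = (\<Sum>k<r. f (x(k := Suc (x k))))"

definition raise :: "nat \<Rightarrow> nat \<Rightarrow> ((nat \<Rightarrow> nat) \<Rightarrow> rat) \<Rightarrow> (nat \<Rightarrow> nat) \<Rightarrow> rat" where
  "raise n r f x = (\<Sum>k<r. of_nat (x k) * (of_nat n - of_nat (x k)) * f (x(k := x k - 1)))"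

lemma lower_linear: "lower r (f + g) = lower r f + lower r g"
    "lower r (f - g) = lower r f - lower r g"
    "lower r (fscale c f) = fscale c (lower r f)" "lower r 0 = 0"
  by (auto simp: fun_eq_iff lower_def sum.distrib sum_subtractf sum_distrib_left)

lemma raise_linear: "raise n r (f + g) = raise n r f + raise n r g"
    "raise n r (fscale c f) = fscale c (raise n r f)" "raise n r 0 = 0"
  by (auto simp: fun_eq_iff raise_def sum.distrib sum_distrib_left algebra_simps simp flip: sum.distrib sum_subtractf intro!: sum.cong)

text \<open>Operations in different slots commute, so only \<open>k = l\<close> contributes to the
  commutator. In one slot it is the scalar (x + 1)(n - 1 - x) - x(n - x) = n - 1 - 2x, and these
  scalars add up over the slots.\<close>

lemma lower_raise:
  "lower r (raise n r f) x = raise n r (lower r f) x +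
     (of_nat r * (of_nat n - 1) - 2 * of_int (weight r x)) * f x"
proof -
  define a where "a k l = of_nat ((x(k := Suc (x k))) l) * (of_nat n - of_nat ((x(k := Suc (x k))) l)) *
      f ((x(k := Suc (x k)))(l := (x(k := Suc (x k))) l - 1))" for k l
  define b where "b k l = of_nat (x l) * (of_nat n - of_nat (x l)) *
      f ((x(l := x l - 1))(k := Suc ((x(l := x l - 1)) k)))" for k l
  have ab: "a k l = b k l + (if l = k then (of_nat n - 1 - 2 * of_nat (x k)) * f x else 0)" for k l
  proof (cases "l = k")
    case True
    then show ?thesis
      by (cases "x k") (auto simp: a_def b_def algebra_simps fun_upd_idem)
  next
    case False
    then show ?thesis by (auto simp: a_def b_def fun_upd_twist)
  qed
  have "lower r (raise n r f) x = (\<Sum>k<r. \<Sum>l<r. a k l)"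
    by (simp add: lower_def raise_def a_def)
  also have "\<dots> = (\<Sum>k<r. (\<Sum>l<r. b k l) + (of_nat n - 1 - 2 * of_nat (x k)) * f x)"
    by (simp add: ab sum.distrib)
  also have "\<dots> = (\<Sum>k<r. \<Sum>l<r. b k l) + (\<Sum>k<r. of_nat n - 1 - 2 * of_nat (x k)) * f x"
    by (simp add: sum.distrib sum_distrib_right)
  also have "(\<Sum>k<r. \<Sum>l<r. b k l) = raise n r (lower r f) x"
    by (subst sum.swap) (simp add: lower_def raise_def b_def sum_distrib_left)
  also have "(\<Sum>k<r. of_nat n - 1 - 2 * of_nat (x k)) = (of_nat r * (of_nat n - 1) - 2 * of_int (weight r x) :: rat)"
    by (simp add: weight_def sum_subtractf sum_distrib_left)
  finally show ?thesis .
qed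

lemma weight_upd: "k < r \<Longrightarrow> weight r (x(k := i)) = weight r x - int (x k) + int i"
proof -
  assume k: "k < r"
  have "(\<Sum>j\<in>{..<r} - {k}. int ((x(k := i)) j)) = (\<Sum>j\<in>{..<r} - {k}. int (x j))"
    by (intro sum.cong) auto
  then show ?thesis
    using k sum.remove[of "{..<r}" k "\<lambda>j. int (x j)"] sum.remove[of "{..<r}" k "\<lambda>j. int ((x(k := i)) j)"]
    unfolding weight_def by simp
qed

lemma lower_term:
  assumes "lower r f x \<noteq> 0"
  obtains k where "k < r" "f (x(k := Suc (x k))) \<noteq> 0"
  using assms sum.not_neutral_contains_not_neutral[of _ "{..<r}"] unfolding lower_def by blast

lemma lower_homog: "homog r s f \<Longrightarrow> homog r (s - 1) (lower r f)"
proof -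
  assume f: "homog r s f"
  have "weight r x = s - 1" if nz: "lower r f x \<noteq> 0" for x
  proof -
    obtain k where "k < r" "f (x(k := Suc (x k))) \<noteq> 0"
      by (rule lower_term[OF nz])
    then show ?thesis using f by (auto simp: homog_def weight_upd)
  qed
  then show ?thesis by (simp add: homog_def)
qed

lemma raise_term:
  assumes "raise n r f x \<noteq> 0"
  obtains k where "k < r" "0 < x k" "x k \<noteq> n" "f (x(k := x k - 1)) \<noteq> 0"
proof -
  obtain k where "k < r" "of_nat (x k) * (of_nat n - of_nat (x k)) * f (x(k := x k - 1)) \<noteq> 0"
    using assms sum.not_neutral_contains_not_neutral[of _ "{..<r}"] unfolding raise_def by blast
  then show ?thesis using that[of k] by auto
qed

lemma raise_homog: "homog r s f \<Longrightarrow> homog r (s + 1) (raise n r f)"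
  unfolding homog_def[of r "s + 1"] by (auto elim!: raise_term simp: homog_def weight_upd)

text \<open>The factor \<open>of_nat n - of_nat (x k)\<close> vanishes at \<open>x k = n\<close>,
  the only place where raising could leave the grid.\<close>

lemma raise_supported: "grid_supported n r f \<Longrightarrow> grid_supported n r (raise n r f)"
proof -
  assume f: "grid_supported n r f"
  have "x \<in> grid n r" if nz: "raise n r f x \<noteq> 0" for x
  proof -
    obtain k where k: "k < r" "0 < x k" "x k \<noteq> n" "f (x(k := x k - 1)) \<noteq> 0"
      by (rule raise_term[OF nz])
    then have b: "x(k := x k - 1) \<in> grid n r" using f by (simp add: grid_supported_def)
    then have "x k - 1 < n" using k by (force simp: grid_def PiE_iff)
    then show ?thesis using grid_upd[OF b k(1)] k by linarith
  qed
  then show ?thesis by (simp add: grid_supported_def)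
qed

lemma lower_supported: "grid_supported n r f \<Longrightarrow> grid_supported n r (lower r f)"
proof -
  assume f: "grid_supported n r f"
  have "x \<in> grid n r" if nz: "lower r f x \<noteq> 0" for x
  proof -
    obtain k where k: "k < r" "f (x(k := Suc (x k))) \<noteq> 0"
      by (rule lower_term[OF nz])
    then have b: "x(k := Suc (x k)) \<in> grid n r" using f by (simp add: grid_supported_def)
    then have "Suc (x k) < n" using k by (force simp: grid_def PiE_iff)
    then show ?thesis using grid_upd[OF b k(1)] k by linarith
  qed
  then show ?thesis by (simp add: grid_supported_def)
qed

lemma homog_neg:
  assumes "homog r s f" "s < 0"
  shows "f = 0"
proof
  fix x
  have "weight r x \<ge> 0" by (simp add: weight_def sum_nonneg)
  then show "f x = 0 x" using assms by (auto simp: homog_def)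
qed

lemma homog_large:
  assumes "homog r s f" "grid_supported n r f" "int (r * n) < s"
  shows "f = 0"
proof (rule ccontr)
  assume "f \<noteq> 0"
  then obtain x where x: "f x \<noteq> 0" by (auto simp: fun_eq_iff)
  then have "x \<in> grid n r" "weight r x = s" using assms by (auto simp: homog_def grid_supported_def)
  moreover have "weight r x \<le> (\<Sum>k<r. int n)"
    unfolding weight_def using \<open>x \<in> grid n r\<close> by (intro sum_mono) (fastforce simp: grid_def PiE_iff less_imp_le)
  ultimately show False using assms by simp
qed

lemma lower_raise_homog:
  assumes "homog r s f"
  shows "lower r (raise n r f) = raise n r (lower r f) + fscale (of_int (int r * (int n - 1) - 2 * s)) f"
proof
  fix x
  show "lower r (raise n r f) x = (raise n r (lower r f) + fscale (of_int (int r * (int n - 1) - 2 * s)) f) x"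
    using assms by (cases "f x = 0") (auto simp: lower_raise homog_def)
qed

text \<open>If \<open>lower r f = 0\<close>, then \<open>lower\<close> maps the \<open>(k + 1)\<close>-st \<open>raise\<close>-iterate of \<open>f\<close> to a
  nonzero multiple of the \<open>k\<close>-th one; as the iterates vanish eventually, they all vanish.\<close>

lemma lower_injective:
  assumes f: "homog r s f" "grid_supported n r f" "int r * (int n - 1) < 2 * s" "lower r f = 0"
  shows "f = 0"
proof -
  \<comment> \<open>\<open>h\<close> is the sl(2)-weight of \<open>f\<close>; in a
    finite-dimensional representation no nonzero vector of positive weight is killed by
    lowering.\<close>
  define h :: int where "h = 2 * s - int r * (int n - 1)"
  let ?f = "\<lambda>k. (raise n r ^^ k) f"
  have hom: "homog r (s + int k) (?f k)" for k
    by (induction k) (use f raise_homog in \<open>force simp: algebra_simps\<close>)+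
  have grid: "grid_supported n r (?f k)" for k
    by (induction k) (use f raise_supported in auto)
  \<comment> \<open>The coefficient is the sum of the commutator scalars - (h + 2 i) over i \<le> k.
    As \<open>h\<close> is positive, it is never zero.\<close>
  have step: "lower r (?f (Suc k)) = fscale (of_int (- (int (Suc k) * (h + int k)))) (?f k)" for k
  proof (induction k)
    case 0
    show ?case using lower_raise_homog[OF f(1), of n] f(4) by (simp add: raise_linear h_def)
  next
    case (Suc k)
    have "lower r (?f (Suc (Suc k))) = raise n r (lower r (?f (Suc k))) +
        fscale (of_int (int r * (int n - 1) - 2 * (s + int (Suc k)))) (?f (Suc k))"
      using lower_raise_homog[OF hom, of n "Suc k"] by simp
    also have "\<dots> = fscale (of_int (- (int (Suc k) * (h + int k)))) (?f (Suc k)) +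
        fscale (of_int (int r * (int n - 1) - 2 * (s + int (Suc k)))) (?f (Suc k))"
      unfolding Suc.IH raise_linear by simp
    also have "\<dots> = fscale (of_int (- (int (Suc (Suc k)) * (h + int (Suc k))))) (?f (Suc k))"
      unfolding fs.scale_left_distrib[symmetric] of_int_add[symmetric]
      by (intro arg_cong2[of _ _ _ _ fscale] arg_cong[of _ _ of_int]) (auto simp: h_def algebra_simps)
    finally show ?case .
  qed
  have "?f k = 0" if "?f (Suc k) = 0" for k
  proof -
    have "fscale (of_int (- (int (Suc k) * (h + int k)))) (?f k) = 0"
      using step[of k] that lower_linear(4) by metis
    moreover have "- (int (Suc k) * (h + int k)) \<noteq> 0"
      using f(3) by (auto simp: h_def)
    ultimately show ?thesis by (metis fs.scale_eq_0_iff of_int_eq_0_iff)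
  qed
  then have "?f k = 0 \<Longrightarrow> f = 0" for k
    by (induction k) auto
  moreover have "?f (nat (int (r * n) + 1 - s)) = 0"
    by (rule homog_large[OF hom grid])  simp
  ultimately show ?thesis by blast
qed

text \<open>Induction on the order \<open>k\<close> of nilpotency of \<open>g\<close> under \<open>lower\<close>: subtracting a suitable multiple
  of \<open>g\<close> from \<open>lower r (raise n r g)\<close> leaves an element of smaller order.\<close>

lemma lower_surjective:
  assumes closed: "\<And>f g. f \<in> A \<Longrightarrow> g \<in> A \<Longrightarrow> f + g \<in> A" "\<And>c f. f \<in> A \<Longrightarrow> fscale c f \<in> A"
    "\<And>f. f \<in> A \<Longrightarrow> lower r f \<in> A" "\<And>f. f \<in> A \<Longrightarrow> raise n r f \<in> A"
  assumes g: "homog r t g" "g \<in> A" "2 * t < int r * (int n - 1)"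
  obtains f where "f \<in> A" "homog r (t + 1) f" "lower r f = g"
proof -
  define w :: int where "w = int r * (int n - 1) - 2 * t"
  have hom: "homog r (t - int k) ((lower r ^^ k) f)" if "homog r t f" for k f
    by (induction k) (use that lower_homog in \<open>force simp: algebra_simps\<close>)+
  \<comment> \<open>At weight t - i the commutator scalar is w + 2 i; summing over i \<le> k gives
    the coefficient, which is positive.\<close>
  have step: "(lower r ^^ Suc k) (raise n r f) = raise n r ((lower r ^^ Suc k) f) +
      fscale (of_int (int (Suc k) * (w + int k))) ((lower r ^^ k) f)" if f: "homog r t f" for k f
  proof (induction k)
    case 0
    show ?case using lower_raise_homog[OF f, of n] by (simp add: w_def)
  next
    case (Suc k)
    have "(lower r ^^ Suc (Suc k)) (raise n r f) = lower r (raise n r ((lower r ^^ Suc k) f)) +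
        fscale (of_int (int (Suc k) * (w + int k))) ((lower r ^^ Suc k) f)"
      by (subst funpow.simps(2), subst comp_apply, subst Suc.IH)
        (simp only: lower_linear funpow.simps(2) comp_apply)
    also have "\<dots> = raise n r ((lower r ^^ Suc (Suc k)) f) +
        (fscale (of_int (int r * (int n - 1) - 2 * (t - int (Suc k)))) ((lower r ^^ Suc k) f) +
        fscale (of_int (int (Suc k) * (w + int k))) ((lower r ^^ Suc k) f))"
      using lower_raise_homog[OF hom[OF f], of n "Suc k"] by simp
    also have "fscale (of_int (int r * (int n - 1) - 2 * (t - int (Suc k)))) ((lower r ^^ Suc k) f) +
        fscale (of_int (int (Suc k) * (w + int k))) ((lower r ^^ Suc k) f) =
        fscale (of_int (int (Suc (Suc k)) * (w + int (Suc k)))) ((lower r ^^ Suc k) f)"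
      unfolding fs.scale_left_distrib[symmetric] of_int_add[symmetric]
      by (intro arg_cong2[of _ _ _ _ fscale] arg_cong[of _ _ of_int]) (auto simp: w_def algebra_simps)
    finally show ?case .
  qed
  have lin: "(lower r ^^ k) (f - g) = (lower r ^^ k) f - (lower r ^^ k) g"
    "(lower r ^^ k) (fscale c f) = fscale c ((lower r ^^ k) f)" "(lower r ^^ k) 0 = 0" for k f g c
    by (induction k) (auto simp: lower_linear)
  have main: "\<exists>f\<in>A. homog r (t + 1) f \<and> lower r f = g" if "(lower r ^^ k) g = 0" "homog r t g" "g \<in> A" for k g
    using that
  proof (induction k arbitrary: g)
    case 0
    have "0 \<in> A" using closed(2)[OF g(2), of 0] by (simp add: fscale_def zero_fun_def)
    then show ?case using 0 by (auto intro!: bexI[of _ 0] simp: lower_linear homog_def)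
  next
    case (Suc k)
    define c :: rat where "c = of_int (int (Suc k) * (w + int k))"
    have "int (Suc k) * (w + int k) \<noteq> 0" using g(3) by (auto simp: w_def)
    then have c: "c \<noteq> 0" unfolding c_def of_int_eq_0_iff .
    \<comment> \<open>The multiple of \<open>g\<close> is chosen to cancel the last term of
      \<open>step\<close>; what remains contains the (k + 1)-st lowering of \<open>g\<close>, which
      is zero.\<close>
    define g' where "g' = lower r (raise n r g) - fscale c g"
    have "(lower r ^^ k) g' = (lower r ^^ Suc k) (raise n r g) - fscale c ((lower r ^^ k) g)"
      by (simp only: g'_def lin funpow_Suc_right comp_apply)
    also have "\<dots> = 0"
      by (simp only: step[OF Suc.prems(2), of k] Suc.prems(1) c_def raise_linear add_0_left diff_self)
    finally have "(lower r ^^ k) g' = 0" .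
    moreover have "homog r t g'"
      using Suc.prems(2) lower_homog[OF raise_homog[OF Suc.prems(2), of n]]
      by (force simp: g'_def homog_def)
    moreover have "g' = lower r (raise n r g) + fscale (- c) g"
      by (auto simp: g'_def fun_eq_iff)
    then have "g' \<in> A" by (simp only: closed Suc.prems)
    ultimately obtain f where f: "f \<in> A" "homog r (t + 1) f" "lower r f = g'"
      using Suc.IH by blast
    define f' where "f' = fscale (1 / c) (raise n r g + fscale (-1) f)"
    have "f' \<in> A" by (simp only: f'_def closed f Suc.prems)
    moreover have "homog r (t + 1) f'"
      using f(2) raise_homog[OF Suc.prems(2), of n] by (force simp: f'_def homog_def)
    moreover have "lower r f' = g"
      using c by (auto simp: f'_def lower_linear f(3) g'_def fun_eq_iff)
    ultimately show ?case by blast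
  qed
  \<comment> \<open>Weights are nonnegative, so t + 1 lowerings leave nothing; this starts the
    induction on nilpotency.\<close>
  have "(lower r ^^ nat (t + 1)) g = 0"
  proof (cases "t < 0")
    case True
    then show ?thesis using homog_neg[OF g(1)] lin by simp
  next
    case False
    then show ?thesis using homog_neg[OF hom[OF g(1), of "nat (t + 1)"]] by simp
  qed
  then show ?thesis using main[OF _ g(1,2)] that by blast
qed


subsection \<open>Alternating functions and the shift operator\<close>

lemma fs_independent_image:
  fixes h :: "'a \<Rightarrow> 'i \<Rightarrow> rat"
  assumes fin: "finite A"
    and key: "\<And>u. (\<Sum>a\<in>A. fscale (u a) (h a)) = 0 \<Longrightarrow> \<forall>a\<in>A. u a = 0"
  shows "inj_on h A" "fs.independent (h ` A)"
proof -
  show inj: "inj_on h A"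
  proof (rule inj_onI, rule ccontr)
    fix a b assume ab: "a \<in> A" "b \<in> A" "h a = h b" "a \<noteq> b"
    \<comment> \<open>Independence is a property of sets, so a family must also be injective; a
      coincidence of two values is itself a relation, with coefficients 1 and -1.\<close>
    define u :: "'a \<Rightarrow> rat" where "u v = (if v = a then 1 else if v = b then -1 else 0)" for v
    have "(\<Sum>v\<in>A. fscale (u v) (h v)) = (\<Sum>v\<in>{a, b}. fscale (u v) (h v))"
      using ab fin by (intro sum.mono_neutral_right) (auto simp: u_def)
    also have "\<dots> = 0" using ab by (auto simp: u_def fun_eq_iff)
    finally show False using key ab(1) by (fastforce simp: u_def)
  qed
  show "fs.independent (h ` A)"
  proof (rule fs.independent_if_scalars_zero)
    show "finite (h ` A)" using fin by simp
    fix f x assume *: "(\<Sum>x\<in>h ` A. fscale (f x) x) = 0" "x \<in> h ` A"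
    then have "(\<Sum>v\<in>A. fscale (f (h v)) (h v)) = 0"
      using inj by (simp add: sum.reindex)
    then show "f x = 0" using key[of "f \<circ> h"] *(2) by auto
  qed
qed

text \<open>The ambient space of functions may be infinite-dimensional, so finiteness enters through
  the spanning set \<open>C\<close>. A basis \<open>B0\<close> of the kernel is extended to a basis
  \<open>B\<close> of \<open>V\<close>, and \<open>T\<close> maps \<open>B - B0\<close> bijectively
  to a basis of the image.\<close>

lemma fs_rank_nullity:
  assumes V: "fs.subspace V" "V \<subseteq> fs.span C" "finite C"
  assumes T: "\<And>f g. T (f + g) = T f + T g" "\<And>c f. T (fscale c f) = fscale c (T f)"
  shows "fs.dim V = fs.dim {v \<in> V. T v = 0} + fs.dim (T ` V)"
proof -
  interpret T: module_hom fscale fscale T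
    by unfold_locales (use T in auto)
  define K where "K = {v \<in> V. T v = 0}"
  have K: "fs.subspace K"
    using V(1) by (auto simp: K_def fs.subspace_def T.add T.scale)
  obtain B0 where B0: "B0 \<subseteq> K" "fs.independent B0" "K \<subseteq> fs.span B0"
    using fs.maximal_independent_subset[of K] by blast
  obtain B where B: "B0 \<subseteq> B" "B \<subseteq> V" "fs.independent B" "V \<subseteq> fs.span B"
    using fs.maximal_independent_subset_extend[of B0 V] B0 by (auto simp: K_def)
  have finB: "finite B"
    using fs.independent_span_bound[OF V(3) B(3)] B(2) V(2) by blast
  then have fin: "finite B0" "finite (B - B0)" using B(1) finite_subset by blast+
  have key: "\<forall>v\<in>B - B0. u v = 0" if u: "(\<Sum>v\<in>B - B0. fscale (u v) (T v)) = 0" for u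
  proof -
    define y where "y = (\<Sum>v\<in>B - B0. fscale (u v) v)"
    have "T y = 0" using u by (simp add: y_def T.sum T.scale)
    moreover have "y \<in> V" unfolding y_def
      using B(2) V(1) by (intro fs.subspace_sum fs.subspace_scale) auto
    ultimately have "y \<in> fs.span B0" using B0(3) by (auto simp: K_def)
    then obtain w where w: "y = (\<Sum>v\<in>B0. fscale (w v) v)"
      using fs.span_finite[OF fin(1)] by auto
    \<comment> \<open>Writing the kernel element \<open>y\<close> in terms of \<open>B0\<close> and
      subtracting turns the relation between images into one on the whole basis
      \<open>B\<close>.\<close>
    define q where "q v = (if v \<in> B0 then - w v else u v)" for v
    have "(\<Sum>v\<in>B. fscale (q v) v) = (\<Sum>v\<in>B - B0. fscale (q v) v) + (\<Sum>v\<in>B0. fscale (q v) v)"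
      using B(1) finB by (simp add: sum.subset_diff)
    also have "(\<Sum>v\<in>B - B0. fscale (q v) v) = y"
      unfolding y_def by (intro sum.cong) (auto simp: q_def)
    also have "(\<Sum>v\<in>B0. fscale (q v) v) = - y"
      unfolding w sum_negf[symmetric] by (intro sum.cong) (auto simp: q_def)
    also have "y + - y = 0" by (rule right_minus)
    finally have "(\<Sum>v\<in>B. fscale (q v) v) = 0" .
    then have "\<forall>v\<in>B. q v = 0"
      using B(3) finB fs.independent_explicit_finite_subsets by blast
    then show ?thesis by (auto simp: q_def)
  qed
  note inj = fs_independent_image(1)[OF fin(2) key] and ind = fs_independent_image(2)[OF fin(2) key]
  have "T ` V \<subseteq> fs.span (T ` (B - B0))"
  proof -
    have "T ` V \<subseteq> T ` fs.span B" using B(4) by blast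
    also have "\<dots> = fs.span (T ` B)" by (simp add: T.span_image)
    also have "T ` B \<subseteq> insert 0 (T ` (B - B0))"
      using B0(1) by (auto simp: K_def)
    then have "fs.span (T ` B) \<subseteq> fs.span (insert 0 (T ` (B - B0)))"
      by (rule fs.span_mono)
    finally show ?thesis by simp
  qed
  then have "fs.dim (T ` V) = card (T ` (B - B0))"
    using ind B(2) by (intro fs.basis_card_eq_dim[symmetric]) auto
  also have "\<dots> = card (B - B0)" using inj by (rule card_image)
  finally have "fs.dim (T ` V) = card B - card B0"
    using B(1) fin by (simp add: card_Diff_subset)
  moreover have "fs.dim V = card B" "fs.dim K = card B0"
    using B B0 fs.basis_card_eq_dim by metis+
  moreover have "card B0 \<le> card B" using B(1) finB by (rule card_mono[rotated])
  ultimately show ?thesis by (simp add: K_def)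
qed

section \<open>Antisymmetric functions, stable under raising and lowering\<close>

definition alt_space :: "nat \<Rightarrow> nat \<Rightarrow> ((nat \<Rightarrow> nat) \<Rightarrow> rat) set" where
  "alt_space n r = {f. grid_supported n r f \<and>
     (\<forall>\<tau> x. \<tau> permutes {..<r} \<longrightarrow> f (x \<circ> \<tau>) = of_int (sign \<tau>) * f x)}"

lemma alt_spaceD:
  assumes "f \<in> alt_space n r"
  shows "f x \<noteq> 0 \<Longrightarrow> x \<in> grid n r" "\<tau> permutes {..<r} \<Longrightarrow> f (x \<circ> \<tau>) = of_int (sign \<tau>) * f x"
  using assms by (auto simp: alt_space_def grid_supported_def)

lemma subspace_alt_space: "fs.subspace (alt_space n r)"
  unfolding fs.subspace_def
  by (auto simp: alt_space_def grid_supported_def algebra_simps) (metis add_0)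

lemma comp_upd_permutes:
  assumes "\<tau> permutes {..<r}"
  shows "(x \<circ> \<tau>)(k := i) = (x(\<tau> k := i)) \<circ> \<tau>"
  using permutes_inj[OF assms] by (auto simp: fun_eq_iff inj_eq)

lemma lower_alt: "f \<in> alt_space n r \<Longrightarrow> lower r f \<in> alt_space n r"
proof -
  assume f: "f \<in> alt_space n r"
  have "lower r f (x \<circ> \<tau>) = of_int (sign \<tau>) * lower r f x" if \<tau>: "\<tau> permutes {..<r}" for x \<tau>
  proof -
    have "lower r f (x \<circ> \<tau>) = (\<Sum>k<r. of_int (sign \<tau>) * f (x(\<tau> k := Suc (x (\<tau> k)))))"
      unfolding lower_def comp_upd_permutes[OF \<tau>] alt_spaceD(2)[OF f \<tau>] by simp
    also have "\<dots> = (\<Sum>k<r. of_int (sign \<tau>) * f (x(k := Suc (x k))))"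
      using sum.permute[OF \<tau>, of "\<lambda>k. of_int (sign \<tau>) * f (x(k := Suc (x k)))"] by (simp add: comp_def)
    finally show ?thesis by (simp add: lower_def sum_distrib_left)
  qed
  then show ?thesis using f lower_supported by (auto simp: alt_space_def)
qed

lemma raise_alt: "f \<in> alt_space n r \<Longrightarrow> raise n r f \<in> alt_space n r"
proof -
  assume f: "f \<in> alt_space n r"
  have "raise n r f (x \<circ> \<tau>) = of_int (sign \<tau>) * raise n r f x" if \<tau>: "\<tau> permutes {..<r}" for x \<tau>
  proof -
    let ?t = "\<lambda>k. of_int (sign \<tau>) * (of_nat (x k) * (of_nat n - of_nat (x k)) * f (x(k := x k - 1)))"
    have "raise n r f (x \<circ> \<tau>) = (\<Sum>k<r. ?t (\<tau> k))"
      unfolding raise_def comp_upd_permutes[OF \<tau>] alt_spaceD(2)[OF f \<tau>] by (simp add: mult_ac)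
    also have "\<dots> = (\<Sum>k<r. ?t k)"
      using sum.permute[OF \<tau>, of ?t] by (simp add: comp_def)
    finally show ?thesis by (simp add: raise_def sum_distrib_left)
  qed
  then show ?thesis using f raise_supported by (auto simp: alt_space_def)
qed

section \<open>The tensor power of the Jordan block and its leading part\<close>

definition bump :: "nat set \<Rightarrow> (nat \<Rightarrow> nat) \<Rightarrow> nat \<Rightarrow> nat" where
  "bump D x = (\<lambda>k. if k \<in> D then Suc (x k) else x k)"

definition shift :: "nat \<Rightarrow> ((nat \<Rightarrow> nat) \<Rightarrow> rat) \<Rightarrow> (nat \<Rightarrow> nat) \<Rightarrow> rat" where
  "shift r f x = (\<Sum>D\<in>Pow {..<r}. f (bump D x))"

lemma bump_grid:
  assumes "bump D x \<in> grid n r" "D \<subseteq> {..<r}"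
  shows "x \<in> grid n r"
proof -
  have "x k < n" if "k < r" for k
  proof -
    have "bump D x k < n" using assms(1) that by (force simp: grid_def PiE_iff)
    then show ?thesis by (simp add: bump_def split: if_splits)
  qed
  moreover have "x k = undefined" if "\<not> k < r" for k
  proof -
    have "bump D x k = undefined" using assms(1) that by (auto simp: grid_def PiE_iff extensional_def)
    moreover have "k \<notin> D" using assms(2) that by blast
    ultimately show ?thesis by (simp add: bump_def)
  qed
  ultimately show ?thesis by (simp add: grid_def PiE_iff extensional_def)
qed

lemma shift_linear: "shift r (f + g) = shift r f + shift r g" "shift r (fscale c f) = fscale c (shift r f)"
  by (rule ext, simp only: shift_def sum.distrib sum_distrib_left plus_fun_apply fscale_apply)+

lemma shift_alt: "f \<in> alt_space n r \<Longrightarrow> shift r f \<in> alt_space n r"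
proof -
  assume f: "f \<in> alt_space n r"
  have "shift r f (x \<circ> \<tau>) = of_int (sign \<tau>) * shift r f x" if \<tau>: "\<tau> permutes {..<r}" for x \<tau>
  proof -
    have b: "bump D (x \<circ> \<tau>) = bump (\<tau> ` D) x \<circ> \<tau>" for D
      using permutes_inj[OF \<tau>] by (auto simp: fun_eq_iff bump_def inj_image_mem_iff)
    have "shift r f (x \<circ> \<tau>) = (\<Sum>D\<in>Pow {..<r}. of_int (sign \<tau>) * f (bump (\<tau> ` D) x))"
      unfolding shift_def b alt_spaceD(2)[OF f \<tau>] by simp
    also have "\<dots> = (\<Sum>D\<in>(\<lambda>D. \<tau> ` D) ` Pow {..<r}. of_int (sign \<tau>) * f (bump D x))"
      using permutes_inj_on[OF \<tau>] by (subst sum.reindex) (auto intro!: inj_on_image_Pow)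
    also have "(\<lambda>D. \<tau> ` D) ` Pow {..<r} = Pow {..<r}"
      by (subst image_Pow_surj[OF permutes_image[OF \<tau>]]) simp
    finally show ?thesis by (simp only: shift_def sum_distrib_left)
  qed
  moreover have "x \<in> grid n r" if nz: "shift r f x \<noteq> 0" for x
  proof -
    obtain D where "D \<in> Pow {..<r}" "f (bump D x) \<noteq> 0"
      using nz unfolding shift_def by (rule sum.not_neutral_contains_not_neutral)
    then show ?thesis using bump_grid alt_spaceD(1)[OF f] by blast
  qed
  ultimately show ?thesis by (auto simp: alt_space_def grid_supported_def)
qed

lemma weight_bump: "D \<subseteq> {..<r} \<Longrightarrow> weight r (bump D x) = weight r x + int (card D)"
proof -
  assume D: "D \<subseteq> {..<r}"
  have "weight r (bump D x) = (\<Sum>k<r. int (x k) + (if k \<in> D then 1 else 0))"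
    unfolding weight_def bump_def by (intro sum.cong) auto
  also have "\<dots> = weight r x + int (card ({..<r} \<inter> D))"
    by (simp add: sum.distrib weight_def flip: sum.inter_restrict)
  finally show ?thesis using D by (simp add: Int_absorb1)
qed

text \<open>\<open>bump D\<close> increases the weight by \<open>card D\<close>. At weight
  \<open>s\<close> or more only the empty set can reach the support of \<open>f\<close>; at weight
  \<open>s - 1\<close> the singletons join in, and they add up to \<open>lower\<close>.\<close>

lemma shift_leading:
  assumes f: "\<And>x. f x \<noteq> 0 \<Longrightarrow> weight r x \<le> s"
  shows "weight r x \<ge> s \<Longrightarrow> shift r f x = f x"
    and "weight r x = s - 1 \<Longrightarrow> shift r f x = f x + lower r f x"
proof -
  have z: "f (bump D x) = 0" if "D \<subseteq> {..<r}" "s < weight r x + int (card D)" for D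
    using f[of "bump D x"] weight_bump[OF that(1)] that(2) by fastforce
  have b: "bump {} x = x" "bump {k} x = x(k := Suc (x k))" for k
    by (auto simp: bump_def fun_eq_iff)
  have card0: "card D = 0 \<longleftrightarrow> D = {}" if "D \<subseteq> {..<r}" for D
    using finite_subset[OF that] by auto
  show "shift r f x = f x" if w: "weight r x \<ge> s"
  proof -
    have "shift r f x = (\<Sum>D\<in>{{}}. f (bump D x))"
      unfolding shift_def
    proof (intro sum.mono_neutral_right ballI)
      fix D assume "D \<in> Pow {..<r} - {{}}"
      then show "f (bump D x) = 0" using w card0[of D] by (intro z) auto
    qed auto
    then show ?thesis by (simp add: b)
  qed
  show "shift r f x = f x + lower r f x" if w: "weight r x = s - 1"
  proof -
    have "shift r f x = (\<Sum>D\<in>insert {} ((\<lambda>k. {k}) ` {..<r}). f (bump D x))"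
      unfolding shift_def
    proof (intro sum.mono_neutral_right ballI)
      fix D assume D: "D \<in> Pow {..<r} - insert {} ((\<lambda>k. {k}) ` {..<r})"
      then have "card D \<noteq> 0" "card D \<noteq> 1" using card0[of D] by (auto simp: card_1_singleton_iff)
      then show "f (bump D x) = 0" using w D by (intro z) auto
    qed auto
    also have "\<dots> = f x + lower r f x"
      by (subst sum.insert) (auto simp: b sum.reindex lower_def)
    finally show ?thesis .
  qed
qed

definition component :: "nat \<Rightarrow> int \<Rightarrow> ((nat \<Rightarrow> nat) \<Rightarrow> rat) \<Rightarrow> (nat \<Rightarrow> nat) \<Rightarrow> rat" where
  "component r s f x = (if weight r x = s then f x else 0)"

lemma weight_comp: "\<tau> permutes {..<r} \<Longrightarrow> weight r (x \<circ> \<tau>) = weight r x"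
  using sum.permute[of \<tau> "{..<r}" "\<lambda>k. int (x k)"] by (simp add: weight_def comp_def)

lemma component_alt: "f \<in> alt_space n r \<Longrightarrow> component r s f \<in> alt_space n r"
  by (auto simp: alt_space_def grid_supported_def component_def weight_comp)

lemma component_homog: "homog r s (component r s f)"
  by (simp add: homog_def component_def)

text \<open>Let \<open>s\<close> be the top weight of \<open>f\<close>. At weight
  \<open>s - 1\<close> the equation \<open>shift r f = f\<close> says that \<open>lower r f\<close>
  vanishes, and \<open>lower\<close> sees only the component of weight \<open>s\<close> there.
  Injectivity above the middle then bounds \<open>s\<close>.\<close>

lemma shift_fixed_weight_le:
  assumes f: "f \<in> alt_space n r" "shift r f = f" "f x \<noteq> 0"
  shows "2 * weight r x \<le> int r * (int n - 1)"
proof -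
  define s where "s = Max (weight r ` {x. f x \<noteq> 0})"
  have "finite {x. f x \<noteq> 0}"
    by (rule finite_subset[OF _ finite_grid[of n r]]) (use alt_spaceD(1)[OF f(1)] in auto)
  then have s: "s \<in> weight r ` {x. f x \<noteq> 0}" "\<And>x. f x \<noteq> 0 \<Longrightarrow> weight r x \<le> s"
    using f(3) unfolding s_def by (auto intro!: Max_in)
  have "lower r (component r s f) y = 0 y" for y
  proof (cases "weight r y = s - 1")
    case True
    then have "lower r (component r s f) y = lower r f y"
      by (auto simp: lower_def component_def weight_upd)
    then show ?thesis using shift_leading(2)[of f r s y, OF s(2) True] f(2) by simp
  next
    case False
    then show ?thesis by (simp add: lower_def component_def weight_upd)
  qed
  then have "lower r (component r s f) = 0" by blast
  moreover have "component r s f \<noteq> 0"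
    using s(1) by (auto simp: component_def fun_eq_iff)
  ultimately have "2 * s \<le> int r * (int n - 1)"
    using lower_injective[OF component_homog, of n r s f] component_alt[OF f(1), of s]
    by (fastforce simp: alt_space_def)
  then show ?thesis using s(2)[OF f(3)] by linarith
qed

text \<open>Induction on the weight bound. The component of \<open>g\<close> of weight
  \<open>m\<close> is \<open>lower r h\<close> for some \<open>h\<close> of weight
  \<open>m + 1\<close>; then \<open>shift r h - h\<close> agrees with \<open>g\<close> at weight
  \<open>m\<close> and vanishes above, so subtracting it reduces the bound. The hypothesis on
  \<open>m\<close> keeps every component to be lifted strictly below the middle weight.\<close>

lemma shift_surjective:
  assumes "g \<in> alt_space n r" "\<And>x. g x \<noteq> 0 \<Longrightarrow> weight r x < int m" "2 * (int m - 1) < int r * (int n - 1)"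
  shows "\<exists>f\<in>alt_space n r. (\<forall>x. f x \<noteq> 0 \<longrightarrow> weight r x \<le> int m) \<and> shift r f - f = g"
  using assms
proof (induction m arbitrary: g)
  case 0
  \<comment> \<open>No weight is negative, so \<open>g\<close> is zero and is its own
    preimage.\<close>
  have "g x = 0" for x
    using "0.prems"(2) weight_nonneg[of r x] by fastforce
  then have "shift r g - g = g" "\<forall>x. g x \<noteq> 0 \<longrightarrow> weight r x \<le> int 0"
    by (auto simp: fun_eq_iff shift_def)
  then show ?case using 0(1) by blast
next
  case (Suc m)
  note sub = subspace_alt_space[of n r]
  obtain h where h: "h \<in> alt_space n r" "homog r (int m + 1) h" "lower r h = component r (int m) g"
  proof (rule lower_surjective[where A = "alt_space n r" and n = n and r = r])
    show "homog r (int m) (component r (int m) g)" "component r (int m) g \<in> alt_space n r"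
      using Suc.prems component_alt component_homog by auto
    show "2 * int m < int r * (int n - 1)" using Suc.prems(3) by simp
  qed (use sub fs.subspace_add fs.subspace_scale lower_alt raise_alt in auto)
  define g' where "g' = g - (shift r h - h)"
  have hw: "\<And>x. h x \<noteq> 0 \<Longrightarrow> weight r x \<le> int m + 1" using h(2) by (auto simp: homog_def)
  have "g' \<in> alt_space n r"
    unfolding g'_def using sub Suc.prems(1) h(1) shift_alt by (intro fs.subspace_diff) auto
  moreover have "weight r x < int m" if "g' x \<noteq> 0" for x
  proof (rule ccontr)
    assume "\<not> weight r x < int m"
    then consider "weight r x = int m" | "weight r x \<ge> int m + 1" by linarith
    then show False
    proof cases
      case 1
      then show ?thesis using shift_leading(2)[of h r "int m + 1" x, OF hw] h(3) \<open>g' x \<noteq> 0\<close>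
        by (simp add: g'_def component_def)
    next
      case 2
      then show ?thesis using shift_leading(1)[of h r "int m + 1" x, OF hw] Suc.prems(2)[of x] \<open>g' x \<noteq> 0\<close>
        by (auto simp: g'_def)
    qed
  qed
  ultimately obtain f where f: "f \<in> alt_space n r" "\<forall>x. f x \<noteq> 0 \<longrightarrow> weight r x \<le> int m" "shift r f - f = g'"
    using Suc.IH[of g'] Suc.prems(3) by (smt (verit) of_nat_Suc)
  have "shift r (f + h) - (f + h) = (shift r f - f) + (shift r h - h)"
    by (simp only: shift_linear) simp
  also have "\<dots> = g" unfolding f(3) g'_def by simp
  finally have "shift r (f + h) - (f + h) = g" .
  moreover have "f + h \<in> alt_space n r" using sub f(1) h(1) by (rule fs.subspace_add)
  moreover have "\<forall>x. (f + h) x \<noteq> 0 \<longrightarrow> weight r x \<le> int (Suc m)"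
  proof (intro allI impI)
    fix x assume "(f + h) x \<noteq> 0"
    then have "f x \<noteq> 0 \<or> h x \<noteq> 0" by auto
    then show "weight r x \<le> int (Suc m)" using f(2) hw by fastforce
  qed
  ultimately show ?case by blast
qed

section \<open>The basis of antisymmetrized indicator functions, indexed by subsets\<close>

definition alt_unit :: "nat \<Rightarrow> (nat \<Rightarrow> nat) \<Rightarrow> (nat \<Rightarrow> nat) \<Rightarrow> rat" where
  "alt_unit r x y = (\<Sum>\<sigma> | \<sigma> permutes {..<r}. of_int (sign \<sigma>) * (if x \<circ> \<sigma> = y then 1 else 0))"

lemma sign_comp_permutes:
  fixes r :: nat
  assumes "\<sigma> permutes {..<r}" "\<tau> permutes {..<r}"
  shows "sign (\<sigma> \<circ> \<tau>) = sign \<sigma> * sign \<tau>"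
  using permutes_imp_permutation[OF _ assms(1)] permutes_imp_permutation[OF _ assms(2)]
  by (intro sign_compose) simp_all

lemma alt_unit_nonzero:
  assumes "alt_unit r x y \<noteq> 0"
  obtains \<sigma> where "\<sigma> permutes {..<r}" "x \<circ> \<sigma> = y"
proof -
  obtain \<sigma> where "\<sigma> permutes {..<r}" "of_int (sign \<sigma>) * (if x \<circ> \<sigma> = y then 1 else 0) \<noteq> (0::rat)"
    using sum.not_neutral_contains_not_neutral[OF assms[unfolded alt_unit_def]] by blast
  then show ?thesis using that[of \<sigma>] by (cases "x \<circ> \<sigma> = y") simp_all
qed

lemma alt_unit_alt:
  assumes "x \<in> grid n r"
  shows "alt_unit r x \<in> alt_space n r"
proof -
  have "y \<in> grid n r" if nz: "alt_unit r x y \<noteq> 0" for y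
    by (rule alt_unit_nonzero[OF nz]) (use grid_comp assms in blast)
  moreover have "alt_unit r x (y \<circ> \<tau>) = of_int (sign \<tau>) * alt_unit r x y" if \<tau>: "\<tau> permutes {..<r}" for y \<tau>
  proof -
    have eq: "x \<circ> (\<sigma> \<circ> \<tau>) = y \<circ> \<tau> \<longleftrightarrow> x \<circ> \<sigma> = y" for \<sigma>
      using permutes_surj[OF \<tau>] by (auto simp: fun_eq_iff surj_def) metis
    have "alt_unit r x (y \<circ> \<tau>) = (\<Sum>\<sigma> | \<sigma> permutes {..<r}. of_int (sign (\<sigma> \<circ> \<tau>)) * (if x \<circ> (\<sigma> \<circ> \<tau>) = y \<circ> \<tau> then 1 else 0))"
      unfolding alt_unit_def by (rule sum_permutations_compose_right[OF \<tau>])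
    also have "\<dots> = (\<Sum>\<sigma> | \<sigma> permutes {..<r}. of_int (sign \<tau>) * (of_int (sign \<sigma>) * (if x \<circ> \<sigma> = y then 1 else 0)))"
      unfolding eq by (intro sum.cong) (auto simp: sign_comp_permutes[OF _ \<tau>])
    finally show ?thesis by (simp only: alt_unit_def sum_distrib_left)
  qed
  ultimately show ?thesis by (auto simp: alt_space_def grid_supported_def)
qed

text \<open>Any bijection serves; the basis below depends on its choice only up to signs.\<close>

definition enumeration :: "nat \<Rightarrow> nat \<Rightarrow> nat set \<Rightarrow> nat \<Rightarrow> nat" where
  "enumeration n r I = (SOME x. x \<in> grid n r \<and> bij_betw x {..<r} I)"

lemma enumeration:
  assumes "I \<subseteq> {..<n}" "card I = r"
  shows "enumeration n r I \<in> grid n r" "bij_betw (enumeration n r I) {..<r} I"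
proof -
  obtain h where h: "bij_betw h {..<r} I"
    using assms ex_bij_betw_nat_finite[of I] finite_subset[OF assms(1)] by (auto simp: atLeast0LessThan)
  then have "bij_betw (restrict h {..<r}) {..<r} I" by (simp add: bij_betw_restrict_eq)
  moreover have "restrict h {..<r} \<in> grid n r"
    using h assms(1) by (auto simp: grid_def bij_betw_def)
  ultimately have "\<exists>x. x \<in> grid n r \<and> bij_betw x {..<r} I" by blast
  from someI_ex[OF this] show "enumeration n r I \<in> grid n r" "bij_betw (enumeration n r I) {..<r} I"
    by (auto simp: enumeration_def)
qed

lemma weight_enumeration:
  assumes "I \<subseteq> {..<n}" "card I = r"
  shows "weight r (enumeration n r I) = (\<Sum>i\<in>I. int i)"
  using sum.reindex_bij_betw[OF enumeration(2)[OF assms], of int] by (simp add: weight_def)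

text \<open>On a tuple with a repeated entry, swapping the two positions gives
  \<open>f x = - f x\<close>. Every other tuple on the grid is a rearrangement of the enumeration of
  its set of entries.\<close>

lemma alt_space_eqI:
  assumes f: "f \<in> alt_space n r" and z: "\<And>I. I \<subseteq> {..<n} \<Longrightarrow> card I = r \<Longrightarrow> f (enumeration n r I) = 0"
  shows "f x = 0"
proof (rule ccontr)
  assume nz: "f x \<noteq> 0"
  have x: "x \<in> grid n r" using alt_spaceD(1)[OF f nz] .
  have inj: "inj_on x {..<r}"
  proof (rule inj_onI, rule ccontr)
    fix i j assume ij: "i \<in> {..<r}" "j \<in> {..<r}" "x i = x j" "i \<noteq> j"
    have "x \<circ> Transposition.transpose i j = x"
      using ij(3) by (auto simp: fun_eq_iff Transposition.transpose_def)
    moreover have "Transposition.transpose i j permutes {..<r}" using ij by (intro permutes_swap_id) auto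
    ultimately have "f x = - f x"
      using alt_spaceD(2)[OF f, of "Transposition.transpose i j" x] ij(4) by (simp add: sign_swap_id)
    then show False using nz by simp
  qed
  define I where "I = x ` {..<r}"
  have I: "I \<subseteq> {..<n}" "card I = r"
    using x card_image[OF inj] by (auto simp: I_def grid_def PiE_iff)
  define e where "e = enumeration n r I"
  have e: "e \<in> grid n r" "bij_betw e {..<r} I" using enumeration[OF I] by (auto simp: e_def)
  \<comment> \<open>The rearrangement that carries the chosen enumeration to \<open>x\<close>,
    continued by the identity to become a permutation.\<close>
  define \<tau> where "\<tau> k = (if k \<in> {..<r} then the_inv_into {..<r} e (x k) else k)" for k
  have bx: "bij_betw x {..<r} I" using inj by (simp add: I_def bij_betw_def)
  have "bij_betw (the_inv_into {..<r} e \<circ> x) {..<r} {..<r}"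
    by (rule bij_betw_trans[OF bx bij_betw_the_inv_into[OF e(2)]])
  then have "bij_betw \<tau> {..<r} {..<r}"
    by (rule bij_betw_cong[THEN iffD1, rotated]) (auto simp: \<tau>_def)
  then have \<tau>: "\<tau> permutes {..<r}"
    by (rule bij_imp_permutes) (auto simp: \<tau>_def)
  have "(e \<circ> \<tau>) k = x k" for k
  proof (cases "k < r")
    case True
    then have "x k \<in> e ` {..<r}" using e(2) by (simp add: I_def bij_betw_def)
    then show ?thesis using True e(2) by (simp add: \<tau>_def f_the_inv_into_f bij_betw_def)
  next
    case False
    then show ?thesis using x e(1) by (auto simp: \<tau>_def grid_def PiE_iff extensional_def)
  qed
  then have "e \<circ> \<tau> = x" by blast
  then show False using alt_spaceD(2)[OF f \<tau>, of e] z[OF I] nz by (simp add: e_def)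
qed

text \<open>Rearranging an enumeration does not change its set of entries, and an injective tuple is
  fixed by the identity alone. Evaluation at the enumerations is thus dual to the antisymmetrized
  indicators.\<close>

lemma alt_unit_enumeration:
  assumes I: "I \<subseteq> {..<n}" "card I = r" and J: "J \<subseteq> {..<n}" "card J = r"
  shows "alt_unit r (enumeration n r I) (enumeration n r J) = (if I = J then 1 else 0)"
proof (cases "I = J")
  case False
  have "enumeration n r I \<circ> \<sigma> \<noteq> enumeration n r J" if \<sigma>: "\<sigma> permutes {..<r}" for \<sigma>
  proof
    assume eq: "enumeration n r I \<circ> \<sigma> = enumeration n r J"
    have "J = (enumeration n r I \<circ> \<sigma>) ` {..<r}"
      using enumeration(2)[OF J] by (simp add: eq bij_betw_def)
    also have "\<dots> = enumeration n r I ` (\<sigma> ` {..<r})" by (rule image_comp[symmetric])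
    also have "\<dots> = I" using enumeration(2)[OF I] permutes_image[OF \<sigma>] by (simp add: bij_betw_def)
    finally show False using False by simp
  qed
  then show ?thesis using False by (simp add: alt_unit_def)
next
  case True
  have "enumeration n r I \<circ> \<sigma> = enumeration n r I \<longleftrightarrow> \<sigma> = id" if \<sigma>: "\<sigma> permutes {..<r}" for \<sigma>
  proof
    assume eq: "enumeration n r I \<circ> \<sigma> = enumeration n r I"
    have "\<sigma> k = k" for k
    proof (cases "k < r")
      case True
      then have "\<sigma> k \<in> {..<r}" using permutes_in_image[OF \<sigma>, of k] by simp
      then show ?thesis using True enumeration(2)[OF I] fun_cong[OF eq, of k]
        by (auto simp: bij_betw_def dest: inj_onD)
    qed (simp add: permutes_not_in[OF \<sigma>])
    then show "\<sigma> = id" by auto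
  qed auto
  then have "alt_unit r (enumeration n r I) (enumeration n r I) =
      (\<Sum>\<sigma> | \<sigma> permutes {..<r}. if \<sigma> = id then of_int (sign \<sigma>) else 0)"
    unfolding alt_unit_def by (intro sum.cong) auto
  also have "\<dots> = 1" by (simp add: finite_permutations permutes_id sign_id)
  finally show ?thesis using True by simp
qed

text \<open>Duality with the evaluations at enumerations gives independence, and
  \<open>alt_space_eqI\<close> gives spanning. The predicate \<open>P\<close> covers both the steps
  of the weight filtration and the whole space.\<close>

lemma dim_alt_space:
  fixes n r :: nat and P :: "int \<Rightarrow> bool"
  defines "S \<equiv> {I. I \<subseteq> {..<n} \<and> card I = r \<and> P (\<Sum>i\<in>I. int i)}"
    and "V \<equiv> {f \<in> alt_space n r. \<forall>x. f x \<noteq> 0 \<longrightarrow> P (weight r x)}"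
  shows "fs.subspace V" "\<exists>C. finite C \<and> V \<subseteq> fs.span C" "fs.dim V = card S"
proof -
  show sub: "fs.subspace V"
    using subspace_alt_space[of n r] unfolding fs.subspace_def V_def
    by (auto simp del: zero_fun_apply) (auto, metis add_0)
  let ?b = "\<lambda>I. alt_unit r (enumeration n r I)"
  have S: "I \<subseteq> {..<n}" "card I = r" if "I \<in> S" for I using that by (auto simp: S_def)
  have finS: "finite S" by (rule finite_subset[of _ "Pow {..<n}"]) (auto simp: S_def)
  have dual: "?b I (enumeration n r J) = (if I = J then 1 else 0)" if "I \<in> S" "J \<subseteq> {..<n}" "card J = r" for I J
    using alt_unit_enumeration S that by blast
  have key: "\<forall>J\<in>S. u J = 0" if u: "(\<Sum>I\<in>S. fscale (u I) (?b I)) = 0" for u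
  proof
    fix J assume J: "J \<in> S"
    have "0 = (\<Sum>I\<in>S. fscale (u I) (?b I)) (enumeration n r J)"
      by (simp only: u zero_fun_apply)
    also have "\<dots> = (\<Sum>I\<in>S. if I = J then u I else 0)"
      unfolding sum_fun_apply fscale_apply by (intro sum.cong refl) (simp add: dual[OF _ S[OF J]])
    also have "\<dots> = u J" using J finS by simp
    finally show "u J = 0" by simp
  qed
  note inj = fs_independent_image(1)[OF finS key] and ind = fs_independent_image(2)[OF finS key]
  have bV: "?b I \<in> V" if "I \<in> S" for I
  proof -
    have "P (weight r y)" if nz: "?b I y \<noteq> 0" for y
    proof -
      obtain \<sigma> where "\<sigma> permutes {..<r}" "enumeration n r I \<circ> \<sigma> = y"
        by (rule alt_unit_nonzero[OF nz])
      then have "weight r y = (\<Sum>i\<in>I. int i)"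
        using weight_comp weight_enumeration[OF S[OF \<open>I \<in> S\<close>]] by metis
      then show ?thesis using \<open>I \<in> S\<close> by (simp add: S_def)
    qed
    then show ?thesis using alt_unit_alt[OF enumeration(1)[OF S[OF that]]] by (simp add: V_def)
  qed
  have span: "V \<subseteq> fs.span (?b ` S)"
  proof
    fix f assume f: "f \<in> V"
    define g where "g = (\<Sum>I\<in>S. fscale (f (enumeration n r I)) (?b I))"
    have gs: "g \<in> fs.span (?b ` S)"
      unfolding g_def by (intro fs.span_sum fs.span_scale fs.span_base) auto
    have "g \<in> V" unfolding g_def using sub bV by (intro fs.subspace_sum fs.subspace_scale) auto
    then have d: "f - g \<in> alt_space n r"
      using f subspace_alt_space[of n r] fs.subspace_diff by (auto simp: V_def)
    have "(f - g) (enumeration n r J) = 0" if J: "J \<subseteq> {..<n}" "card J = r" for J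
    proof -
      have "g (enumeration n r J) = (\<Sum>I\<in>S. if I = J then f (enumeration n r I) else 0)"
        unfolding g_def sum_fun_apply fscale_apply by (intro sum.cong refl) (simp add: dual[OF _ J])
      also have "\<dots> = (if J \<in> S then f (enumeration n r J) else 0)"
        using finS by simp
      \<comment> \<open>If \<open>J\<close> is not in \<open>S\<close>, its weight violates
        \<open>P\<close>, so \<open>f\<close> vanishes at its enumeration.\<close>
      also have "\<dots> = f (enumeration n r J)"
        using f J weight_enumeration[OF J] by (auto simp: S_def V_def)
      finally show ?thesis by simp
    qed
    then have "(f - g) x = 0" for x using alt_space_eqI[OF d] by blast
    then have "f = g" by (auto simp: fun_eq_iff)
    then show "f \<in> fs.span (?b ` S)" using gs by simp
  qed
  then show "\<exists>C. finite C \<and> V \<subseteq> fs.span C" using finS by blast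
  show "fs.dim V = card S"
    using fs.basis_card_eq_dim[OF _ span ind] bV card_image[OF inj] by fastforce
qed

text \<open>\<open>T\<close> maps the functions of weight at most \<open>m\<close> onto those of
  weight below \<open>m\<close>, and its kernel there consists of all fixed functions. The
  difference of the two dimensions counts the subsets with sum exactly \<open>m\<close>.\<close>

lemma dim_shift_fixed:
  assumes "n \<ge> 1"
  shows "fs.dim {f \<in> alt_space n r. shift r f = f} =
    card {I. I \<subseteq> {..<n} \<and> card I = r \<and> \<Sum>I = r * (n - 1) div 2}"
proof -
  define m where "m = r * (n - 1) div 2"
  define V where "V s = {f \<in> alt_space n r. \<forall>x. f x \<noteq> 0 \<longrightarrow> weight r x < s}" for s :: int
  define S where "S s = {I. I \<subseteq> {..<n} \<and> card I = r \<and> (\<Sum>i\<in>I. int i) < s}" for s :: int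
  note dim = dim_alt_space[where P = "\<lambda>w. w < s" and n = n and r = r for s, folded V_def S_def]
  have m: "int r * (int n - 1) = int (r * (n - 1))" using assms by (simp add: of_nat_diff)
  define T where "T f = shift r f - f" for f
  have T: "T (f + g) = T f + T g" "T (fscale c f) = fscale c (T f)" for f g c
    unfolding T_def shift_linear by (auto simp: fun_eq_iff algebra_simps)
  obtain C where C: "finite C" "V (int m + 1) \<subseteq> fs.span C" using dim(2) by blast
  have "fs.dim (V (int m + 1)) = fs.dim {v \<in> V (int m + 1). T v = 0} + fs.dim (T ` V (int m + 1))"
    by (rule fs_rank_nullity[OF dim(1) C(2,1) T])
  also have "{v \<in> V (int m + 1). T v = 0} = {f \<in> alt_space n r. shift r f = f}"
  proof (intro equalityI subsetI)
    fix f assume f: "f \<in> {f \<in> alt_space n r. shift r f = f}"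
    have "weight r x < int m + 1" if "f x \<noteq> 0" for x
    proof -
      have "2 * weight r x \<le> int (r * (n - 1))"
        using shift_fixed_weight_le[of f n r x] f that unfolding m by blast
      moreover have "r * (n - 1) < 2 * (m + 1)" unfolding m_def by auto
      then have "int (r * (n - 1)) < int (2 * (m + 1))" by (rule of_nat_less_iff[THEN iffD2])
      ultimately have "2 * weight r x < int (2 * (m + 1))" by (rule le_less_trans)
      then show ?thesis by simp
    qed
    then show "f \<in> {v \<in> V (int m + 1). T v = 0}"
      using f by (simp add: V_def T_def)
  qed (auto simp: V_def T_def)
  \<comment> \<open>The weight drops because \<open>shift\<close> acts as the identity at the top
    weight; the converse inclusion is \<open>shift_surjective\<close>, applicable since
    \<open>2 * m\<close> does not exceed \<open>r * (n - 1)\<close>.\<close>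
  also have "T ` V (int m + 1) = V (int m)"
  proof (intro equalityI subsetI)
    fix g assume "g \<in> T ` V (int m + 1)"
    then obtain f where f: "f \<in> V (int m + 1)" "g = T f" by blast
    then have le: "\<And>x. f x \<noteq> 0 \<Longrightarrow> weight r x \<le> int m" by (force simp: V_def)
    have "weight r x < int m" if "g x \<noteq> 0" for x
      using shift_leading(1)[of f r "int m" x, OF le] that by (force simp: f(2) T_def)
    moreover have "g \<in> alt_space n r"
      unfolding f(2) T_def using f(1) subspace_alt_space[of n r] shift_alt
      by (intro fs.subspace_diff) (auto simp: V_def)
    ultimately show "g \<in> V (int m)" by (simp add: V_def)
  next
    fix g assume g: "g \<in> V (int m)"
    show "g \<in> T ` V (int m + 1)"
    proof (cases "m = 0")
      case True
      have "g x = 0" for x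
      proof (rule ccontr)
        assume "g x \<noteq> 0"
        then show False using g True weight_nonneg[of r x] by (auto simp: V_def)
      qed
      then have "g = 0" by (auto simp: fun_eq_iff)
      moreover have "T 0 = 0" using T(2)[of 0 0] by (simp only: fs.scale_zero_left)
      moreover have "0 \<in> V (int m + 1)" using dim(1) fs.subspace_0 by blast
      ultimately show ?thesis by (metis image_eqI)
    next
      case False
      have "\<exists>f\<in>alt_space n r. (\<forall>x. f x \<noteq> 0 \<longrightarrow> weight r x \<le> int m) \<and> shift r f - f = g"
      proof (rule shift_surjective)
        have "2 * m \<le> r * (n - 1)" by (simp add: m_def)
        then have "int (2 * m) \<le> int (r * (n - 1))" by (rule of_nat_le_iff[THEN iffD2])
        then show "2 * (int m - 1) < int r * (int n - 1)" unfolding m by simp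
      qed (use g in \<open>auto simp: V_def\<close>)
      then obtain f where "f \<in> alt_space n r" "\<forall>x. f x \<noteq> 0 \<longrightarrow> weight r x \<le> int m" "T f = g"
        by (auto simp: T_def)
      then show ?thesis by (intro image_eqI[of _ _ f]) (auto simp: V_def)
    qed
  qed
  also have "fs.dim (V (int m)) = card (S (int m))" by (rule dim(3))
  also have "fs.dim (V (int m + 1)) = card (S (int m + 1))" by (rule dim(3))
  also have "S (int m + 1) = S (int m) \<union> {I. I \<subseteq> {..<n} \<and> card I = r \<and> \<Sum>I = m}"
  proof -
    have "(\<Sum>i\<in>I. int i) < int m + 1 \<longleftrightarrow> (\<Sum>i\<in>I. int i) < int m \<or> \<Sum>I = m" for I
      using of_nat_sum[of "\<lambda>i. i" I, where 'a = int] by linarith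
    then show ?thesis unfolding S_def by blast
  qed
  also have "card \<dots> = card (S (int m)) + card {I. I \<subseteq> {..<n} \<and> card I = r \<and> \<Sum>I = m}"
  proof (rule card_Un_disjoint)
    have "(\<Sum>i\<in>I. int i) = int (\<Sum>I)" for I by simp
    then show "S (int m) \<inter> {I. I \<subseteq> {..<n} \<and> card I = r \<and> \<Sum>I = m} = {}"
      unfolding S_def by auto
  qed (rule finite_subset[of _ "Pow {..<n}"]; auto simp: S_def)+
  finally show ?thesis unfolding m_def by linarith
qed


subsection \<open>Rank and rational dimension\<close>

lemma common_denominator:
  fixes q :: "'a \<Rightarrow> rat"
  assumes "finite A"
  shows "\<exists>N c. N \<noteq> 0 \<and> (\<forall>a\<in>A. of_int N * q a = of_int (c a))"
  using assms
proof (induction rule: finite_induct)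
  case empty
  then show ?case by (auto intro: exI[of _ 1])
next
  case (insert b A)
  then obtain N c where N: "N \<noteq> 0" "\<forall>a\<in>A. of_int N * q a = of_int (c a)" by blast
  obtain p d where pd: "q b = of_int p / of_int d" "d > 0"
    by (metis quotient_of_div quotient_of_denom_pos surj_pair)
  show ?case
    using N pd insert.hyps(2)
    by (intro exI[of _ "d * N"] exI[of _ "\<lambda>a. if a = b then N * p else d * c a"])
       (auto simp: mult.assoc)
qed

text \<open>\<open>\<phi>\<close> plays the part of the map to the rationalization of
  \<open>G\<close>: its kernel is torsion, and every vector of \<open>U\<close> is hit up to a
  nonzero integer multiple. Independent sets of \<open>G\<close> go to independent vectors, because
  clearing denominators makes a rational relation integral; conversely a basis of \<open>U\<close>
  lifts to an independent set. This form tolerates torsion in \<open>G\<close> and an inverse that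
  is exact only up to factors.\<close>

lemma abelian_rank_eq_dim:
  fixes G :: "('a, 'b) monoid_scheme" (structure) and \<phi> :: "'a \<Rightarrow> 'i \<Rightarrow> rat"
  assumes G: "comm_group G"
    and add: "\<And>x y. x \<in> carrier G \<Longrightarrow> y \<in> carrier G \<Longrightarrow> \<phi> (x \<otimes> y) = \<phi> x + \<phi> y"
    and tors: "\<And>x. x \<in> carrier G \<Longrightarrow> \<phi> x = 0 \<Longrightarrow> \<exists>N::int. N \<noteq> 0 \<and> x [^] N = \<one>"
    and U: "fs.subspace U" "U \<subseteq> fs.span C" "finite C" "\<And>x. x \<in> carrier G \<Longrightarrow> \<phi> x \<in> U"
    and onto: "\<And>u. u \<in> U \<Longrightarrow> \<exists>x\<in>carrier G. \<exists>N::int. N \<noteq> 0 \<and> \<phi> x = fscale (of_int N) u"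
  shows "abelian_rank G = fs.dim U"
proof -
  interpret comm_group G by (rule G)
  have one: "\<phi> \<one> = 0"
    using add[of \<one> \<one>] by (simp only: one_closed l_one) (metis add_cancel_left_left)
  have inv: "\<phi> (inv x) = fscale (-1) (\<phi> x)" if "x \<in> carrier G" for x
  proof -
    have "\<phi> x + \<phi> (inv x) = 0" using add[of x "inv x"] that one by simp
    then have "\<phi> (inv x) = - \<phi> x" by (rule minus_unique[symmetric])
    then show ?thesis by (auto simp: fun_eq_iff)
  qed
  have npow: "\<phi> (x [^] (k::nat)) = fscale (of_nat k) (\<phi> x)" if "x \<in> carrier G" for x k
  proof (induction k)
    case 0
    show ?case by (simp only: nat_pow_0 one of_nat_0 fs.scale_zero_left)
  next
    case (Suc k)
    then show ?case using that
      by (auto simp: add fun_eq_iff algebra_simps)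
  qed
  have pow: "\<phi> (x [^] (k::int)) = fscale (of_int k) (\<phi> x)" if x: "x \<in> carrier G" for x k
  proof (cases "k < 0")
    case True
    then have "\<phi> (x [^] k) = \<phi> (inv (x [^] nat (- k)))" by (simp only: int_pow_def2 if_True)
    also have "\<dots> = fscale (-1) (fscale (of_nat (nat (- k))) (\<phi> x))"
      using x by (simp only: inv npow nat_pow_closed)
    also have "\<dots> = fscale (of_int k) (\<phi> x)"
      using True by (simp add: fun_eq_iff)
    finally show ?thesis .
  next
    case False
    then have "x [^] k = x [^] nat k" by (simp only: int_pow_def2 if_False)
    moreover have "(of_nat (nat k) :: rat) = of_int k" using False by simp
    ultimately show ?thesis using npow[OF x, of "nat k"] by (simp only:)
  qed
  have fin_phi: "\<phi> (finprod G (\<lambda>b. b [^] c b) B) = (\<Sum>b\<in>B. fscale (of_int (c b)) (\<phi> b))"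
    if "finite B" "B \<subseteq> carrier G" for B and c :: "'a \<Rightarrow> int"
    using that
  proof (induction rule: finite_induct)
    case empty
    show ?case by (simp only: finprod_empty one sum.empty)
  next
    case (insert b B)
    have "finprod G (\<lambda>b. b [^] c b) (insert b B) = b [^] c b \<otimes> finprod G (\<lambda>b. b [^] c b) B"
      using insert.hyps insert.prems by (intro finprod_insert) auto
    moreover have "finprod G (\<lambda>b. b [^] c b) B \<in> carrier G"
      using insert.prems by (intro finprod_closed) auto
    ultimately have "\<phi> (finprod G (\<lambda>b. b [^] c b) (insert b B)) =
        fscale (of_int (c b)) (\<phi> b) + (\<Sum>b\<in>B. fscale (of_int (c b)) (\<phi> b))"
      using insert.prems by (simp only: add int_pow_closed insert_subset pow insert.IH)
    then show ?case by (simp only: sum.insert[OF insert.hyps])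
  qed
  have fin_pow: "finprod G (\<lambda>b. b [^] c b) B [^] (k::int) = finprod G (\<lambda>b. b [^] (c b * k)) B"
    if "finite B" "B \<subseteq> carrier G" for B and c :: "'a \<Rightarrow> int" and k
    using that
  proof (induction rule: finite_induct)
    case (insert b B)
    have "finprod G (\<lambda>b. b [^] d b) (insert b B) = b [^] d b \<otimes> finprod G (\<lambda>b. b [^] d b) B" for d :: "'a \<Rightarrow> int"
      using insert.hyps insert.prems by (intro finprod_insert) auto
    moreover have "finprod G (\<lambda>b. b [^] c b) B \<in> carrier G"
      using insert.prems by (intro finprod_closed) auto
    ultimately show ?case
      using insert by (simp add: int_pow_distrib int_pow_pow)
  qed auto
  obtain D where D: "D \<subseteq> U" "fs.independent D" "U \<subseteq> fs.span D"
    using fs.maximal_independent_subset[of U] by blast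
  have finD: "finite D"
    using fs.independent_span_bound[OF U(3) D(2)] D(1) U(2) by blast
  have dim: "card D = fs.dim U" using D fs.basis_card_eq_dim by metis
  have upper: "card B \<le> card D" if B: "int_independent G B" for B
  proof -
    have fin: "finite B" and sub: "B \<subseteq> carrier G" using B by (auto simp: int_independent_def)
    have key: "\<forall>b\<in>B. u b = 0" if u: "(\<Sum>b\<in>B. fscale (u b) (\<phi> b)) = 0" for u
    proof -
      obtain N c where N: "N \<noteq> 0" "\<forall>b\<in>B. of_int N * u b = of_int (c b)"
        using common_denominator[OF fin] by blast
      have "\<phi> (finprod G (\<lambda>b. b [^] c b) B) = (\<Sum>b\<in>B. fscale (of_int N) (fscale (u b) (\<phi> b)))"
        unfolding fin_phi[OF fin sub] using N(2)
        by (intro sum.cong) (auto simp: fun_eq_iff mult.assoc[symmetric])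
      also have "\<dots> = fscale (of_int N) (\<Sum>b\<in>B. fscale (u b) (\<phi> b))"
        by (rule fs.scale_sum_right[symmetric])
      also have "\<dots> = 0" unfolding u by (rule fs.scale_zero_right)
      \<comment> \<open>The integral combination is only torsion in \<open>G\<close>; the further
        multiple \<open>M\<close> turns it into a relation to which independence applies.\<close>
      finally obtain M where M: "M \<noteq> 0" "finprod G (\<lambda>b. b [^] c b) B [^] (M::int) = \<one>"
        using tors[of "finprod G (\<lambda>b. b [^] c b) B"] sub by (force intro: finprod_closed)
      then have "\<forall>b\<in>B. c b * M = 0"
        using B unfolding fin_pow[OF fin sub] int_independent_def by fast
      then have "\<forall>b\<in>B. c b = 0" using M(1) by simp
      then show ?thesis using N by auto
    qed
    have "card B = card (\<phi> ` B)"
      using fs_independent_image(1)[OF fin key] by (rule card_image[symmetric])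
    also have "\<dots> \<le> card D"
      using fs.independent_span_bound[OF finD fs_independent_image(2)[OF fin key]] U(4) sub D(3) by blast
    finally show ?thesis .
  qed
  \<comment> \<open>Preimages of the basis vectors up to nonzero multiples, which do not affect
    independence.\<close>
  obtain x where x: "\<And>d. d \<in> D \<Longrightarrow> x d \<in> carrier G" "\<And>d. d \<in> D \<Longrightarrow> \<exists>N::int. N \<noteq> 0 \<and> \<phi> (x d) = fscale (of_int N) d"
    using onto D(1) by (metis subsetD)
  then obtain N :: "('i \<Rightarrow> rat) \<Rightarrow> int" where N: "\<And>d. d \<in> D \<Longrightarrow> N d \<noteq> 0" "\<And>d. d \<in> D \<Longrightarrow> \<phi> (x d) = fscale (of_int (N d)) d"
    by metis
  have key: "\<forall>d\<in>D. u d = 0" if u: "(\<Sum>d\<in>D. fscale (u d) (\<phi> (x d))) = 0" for u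
  proof -
    have "(\<Sum>d\<in>D. fscale (u d) (\<phi> (x d))) = (\<Sum>d\<in>D. fscale (u d * of_int (N d)) d)"
      by (intro sum.cong) (auto simp: N(2) fun_eq_iff)
    then have "(\<Sum>d\<in>D. fscale (u d * of_int (N d)) d) = 0" using u by metis
    then have "\<forall>d\<in>D. u d * of_int (N d) = 0"
      using D(2) finD unfolding fs.independent_explicit_finite_subsets
      by (elim allE[of _ D] impE allE[of _ "\<lambda>d. u d * of_int (N d)"]) auto
    then show ?thesis using N(1) by simp
  qed
  have injx: "inj_on x D"
    using fs_independent_image(1)[OF finD key] by (force simp: inj_on_def)
  have "int_independent G (x ` D)"
    unfolding int_independent_def
  proof (intro conjI allI impI)
    show "finite (x ` D)" "x ` D \<subseteq> carrier G" using finD x(1) by auto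
    fix c :: "'a \<Rightarrow> int" assume c: "finprod G (\<lambda>b. b [^] c b) (x ` D) = \<one>"
    have "(\<Sum>d\<in>D. fscale (of_int (c (x d))) (\<phi> (x d))) = (\<Sum>b\<in>x ` D. fscale (of_int (c b)) (\<phi> b))"
      using injx by (simp only: sum.reindex comp_def)
    also have "\<dots> = \<phi> (finprod G (\<lambda>b. b [^] c b) (x ` D))"
      using finD x(1) by (intro fin_phi[symmetric]) auto
    also have "\<dots> = 0" unfolding c by (rule one)
    finally have "\<forall>d\<in>D. (of_int (c (x d)) :: rat) = 0" by (rule key)
    then show "\<forall>b\<in>x ` D. c b = 0" by simp
  qed
  moreover have "card (x ` D) = card D" using injx by (rule card_image)
  \<comment> \<open>The supremum is attained, so its value on unbounded sets of naturals does not
    intervene.\<close>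
  ultimately have "abelian_rank G = card D"
    unfolding abelian_rank_def using upper by (intro cSup_eq_maximum) (force intro!: exI[of _ "x ` D"])+
  then show ?thesis using dim by simp
qed


subsection \<open>Relations in the exterior power\<close>

lemma ext_null_zero: "0 \<in> ext_null n r"
  using subgroup.one_closed[OF subgroup_ext_null] by (simp add: ext_tuples_def)

lemma ext_null_add: "a \<in> ext_null n r \<Longrightarrow> b \<in> ext_null n r \<Longrightarrow> a + b \<in> ext_null n r"
  using subgroup.m_closed[OF subgroup_ext_null, of a n r b] by (simp add: ext_tuples_def)

lemma ext_null_uminus:
  assumes "a \<in> ext_null n r"
  shows "- a \<in> ext_null n r"
proof -
  have "Poly_Mapping.keys a \<subseteq> ext_gens n r"
    using subgroup.mem_carrier[OF subgroup_ext_null assms] by (simp add: ext_tuples_def)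
  then show ?thesis
    using subgroup.m_inv_closed[OF subgroup_ext_null assms] by (simp add: ext_tuples_def)
qed

lemma ext_null_diff: "a \<in> ext_null n r \<Longrightarrow> b \<in> ext_null n r \<Longrightarrow> a - b \<in> ext_null n r"
  using ext_null_add[OF _ ext_null_uminus, of a n r b] by simp

lemma ext_null_cmul: "a \<in> ext_null n r \<Longrightarrow> frag_cmul k a \<in> ext_null n r"
  by (rule frag_closure_minus_cmul[where P = "\<lambda>x. x \<in> ext_null n r"])
    (auto intro: ext_null_zero ext_null_diff)

lemma ext_null_sum: "(\<And>i. i \<in> I \<Longrightarrow> f i \<in> ext_null n r) \<Longrightarrow> (\<Sum>i\<in>I. f i) \<in> ext_null n r"
  by (induction I rule: infinite_finite_induct) (auto intro: ext_null_zero ext_null_add)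

text \<open>Congruence of representatives: calculations run in the free group, and cosets return
  only with the kernel.\<close>

definition ext_equiv :: "nat \<Rightarrow> nat \<Rightarrow> (int vec list \<Rightarrow>\<^sub>0 int) \<Rightarrow> (int vec list \<Rightarrow>\<^sub>0 int) \<Rightarrow> bool" where
  "ext_equiv n r a b \<longleftrightarrow> a - b \<in> ext_null n r"

lemma ext_equiv_refl [simp]: "ext_equiv n r a a"
  by (simp add: ext_equiv_def ext_null_zero)

lemma ext_equiv_sym: "ext_equiv n r a b \<Longrightarrow> ext_equiv n r b a"
  using ext_null_uminus[of "a - b" n r] by (simp add: ext_equiv_def)

lemma ext_equiv_trans [trans]: "ext_equiv n r a b \<Longrightarrow> ext_equiv n r b c \<Longrightarrow> ext_equiv n r a c"
  using ext_null_add[of "a - b" n r "b - c"] by (simp add: ext_equiv_def)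

lemma ext_equiv_add: "ext_equiv n r a b \<Longrightarrow> ext_equiv n r c d \<Longrightarrow> ext_equiv n r (a + c) (b + d)"
  using ext_null_add[of "a - b" n r "c - d"] by (simp add: ext_equiv_def algebra_simps)

lemma ext_equiv_diff: "ext_equiv n r a b \<Longrightarrow> ext_equiv n r c d \<Longrightarrow> ext_equiv n r (a - c) (b - d)"
  using ext_null_diff[of "a - b" n r "c - d"] by (simp add: ext_equiv_def algebra_simps)

lemma frag_cmul_diff_distrib2: "frag_cmul k (a - b) = frag_cmul k a - frag_cmul k b"
  by (metis add_diff_cancel_right' diff_add_cancel frag_cmul_distrib2)

lemma ext_equiv_cmul: "ext_equiv n r a b \<Longrightarrow> ext_equiv n r (frag_cmul k a) (frag_cmul k b)"
  using ext_null_cmul[of "a - b" n r k] by (simp add: ext_equiv_def frag_cmul_diff_distrib2)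

lemma ext_equiv_sum: "(\<And>i. i \<in> I \<Longrightarrow> ext_equiv n r (f i) (g i)) \<Longrightarrow> ext_equiv n r (\<Sum>i\<in>I. f i) (\<Sum>i\<in>I. g i)"
  unfolding ext_equiv_def sum_subtractf[symmetric] by (rule ext_null_sum)

lemma ext_equiv_slot_add:
  assumes "vs \<in> ext_gens n r" "i < r" "u \<in> carrier_vec n" "v \<in> carrier_vec n"
  shows "ext_equiv n r (frag_of (vs[i := u + v])) (frag_of (vs[i := u]) + frag_of (vs[i := v]))"
  unfolding ext_equiv_def ext_null_def
  using assms by (intro generate.incl) (auto simp: ext_rels_def)

lemma ext_equiv_alternating:
  assumes "vs \<in> ext_gens n r" "i < r" "j < r" "i \<noteq> j" "vs ! i = vs ! j"
  shows "ext_equiv n r (frag_of vs) 0"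
proof -
  have "frag_of vs \<in> ext_rels n r" unfolding ext_rels_def using assms by blast
  then show ?thesis by (simp add: ext_equiv_def ext_null_def generate.incl)
qed

lemma ext_equiv_slot_smult:
  assumes vs: "vs \<in> ext_gens n r" "i < r" and u: "u \<in> carrier_vec n"
  shows "ext_equiv n r (frag_of (vs[i := k \<cdot>\<^sub>v u])) (frag_cmul k (frag_of (vs[i := u])))"
proof (induction k rule: int_induct[where k = 0])
  case base
  have z: "0 \<cdot>\<^sub>v u = 0\<^sub>v n" using u by auto
  \<comment> \<open>Since 0 = 0 + 0, a tuple with a zero slot is congruent to twice itself, hence
    null.\<close>
  have "ext_equiv n r (frag_of (vs[i := 0\<^sub>v n + 0\<^sub>v n])) (frag_of (vs[i := 0\<^sub>v n]) + frag_of (vs[i := 0\<^sub>v n]))"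
    by (rule ext_equiv_slot_add[OF vs]) auto
  then have "- frag_of (vs[i := 0\<^sub>v n]) \<in> ext_null n r" by (simp add: ext_equiv_def)
  then show ?case using ext_null_uminus[of "- frag_of (vs[i := 0\<^sub>v n])" n r] by (simp add: z ext_equiv_def)
next
  case (step1 k)
  have "ext_equiv n r (frag_of (vs[i := (k + 1) \<cdot>\<^sub>v u])) (frag_of (vs[i := k \<cdot>\<^sub>v u]) + frag_of (vs[i := u]))"
    using ext_equiv_slot_add[OF vs, of "k \<cdot>\<^sub>v u" u] u by (simp add: add_smult_distrib_vec)
  also have "ext_equiv n r \<dots> (frag_cmul k (frag_of (vs[i := u])) + frag_of (vs[i := u]))"
    by (intro ext_equiv_add step1 ext_equiv_refl)
  finally show ?case by (simp add: frag_cmul_distrib)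
next
  case (step2 k)
  have "(k - 1) \<cdot>\<^sub>v u + u = k \<cdot>\<^sub>v u"
    using add_smult_distrib_vec[of "k - 1" 1 u] by simp
  then have "ext_equiv n r (frag_of (vs[i := k \<cdot>\<^sub>v u])) (frag_of (vs[i := (k - 1) \<cdot>\<^sub>v u]) + frag_of (vs[i := u]))"
    using ext_equiv_slot_add[OF vs, of "(k - 1) \<cdot>\<^sub>v u" u] u by simp
  then have "ext_equiv n r (frag_of (vs[i := k \<cdot>\<^sub>v u]) - frag_of (vs[i := u])) (frag_of (vs[i := (k - 1) \<cdot>\<^sub>v u]))"
    by (simp add: ext_equiv_def algebra_simps)
  then have "ext_equiv n r (frag_of (vs[i := (k - 1) \<cdot>\<^sub>v u])) (frag_of (vs[i := k \<cdot>\<^sub>v u]) - frag_of (vs[i := u]))"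
    by (rule ext_equiv_sym)
  also have "ext_equiv n r \<dots> (frag_cmul k (frag_of (vs[i := u])) - frag_of (vs[i := u]))"
    by (intro ext_equiv_diff step2 ext_equiv_refl)
  finally show ?case by (simp add: frag_cmul_diff_distrib)
qed

lemma ext_equiv_slot_expand:
  assumes vs: "vs \<in> ext_gens n r" "i < r" and w: "w \<in> carrier_vec n"
  shows "ext_equiv n r (frag_of (vs[i := w])) (\<Sum>j<n. frag_cmul (w $ j) (frag_of (vs[i := unit_vec n j])))"
proof -
  \<comment> \<open>The truncation of \<open>w\<close> to its first \<open>m\<close> entries; one
    step adds a single multiple of a unit vector.\<close>
  define p where "p m = vec n (\<lambda>j. if j < m then w $ j else 0)" for m
  have "ext_equiv n r (frag_of (vs[i := p m])) (\<Sum>j<m. frag_cmul (w $ j) (frag_of (vs[i := unit_vec n j])))" if "m \<le> n" for m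
    using that
  proof (induction m)
    case 0
    have "p 0 = 0 \<cdot>\<^sub>v p 0" by (auto simp: p_def)
    then show ?case using ext_equiv_slot_smult[OF vs, of "p 0" 0] by (simp add: p_def)
  next
    case (Suc m)
    have "p (Suc m) = p m + w $ m \<cdot>\<^sub>v unit_vec n m"
      using Suc.prems by (auto simp: p_def less_Suc_eq)
    then have "ext_equiv n r (frag_of (vs[i := p (Suc m)])) (frag_of (vs[i := p m]) + frag_of (vs[i := w $ m \<cdot>\<^sub>v unit_vec n m]))"
      using ext_equiv_slot_add[OF vs, of "p m" "w $ m \<cdot>\<^sub>v unit_vec n m"] by (simp add: p_def)
    also have "ext_equiv n r \<dots> ((\<Sum>j<m. frag_cmul (w $ j) (frag_of (vs[i := unit_vec n j]))) + frag_cmul (w $ m) (frag_of (vs[i := unit_vec n m])))"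
      using Suc by (intro ext_equiv_add ext_equiv_slot_smult[OF vs] Suc.IH) auto
    finally show ?case by simp
  qed
  from this[of n] have "ext_equiv n r (frag_of (vs[i := p n])) (\<Sum>j<n. frag_cmul (w $ j) (frag_of (vs[i := unit_vec n j])))"
    by simp
  moreover have "p n = w" using w by (auto simp: p_def)
  ultimately show ?thesis by simp
qed

section \<open>Expansion into unit vectors, and antisymmetry\<close>

lemma sum_grid_Suc: "sum g (grid n (Suc j)) = (\<Sum>x\<in>grid n j. \<Sum>i<n. g (x(j := i)))"
proof -
  have "sum g (grid n (Suc j)) = sum g ((\<lambda>(i, x). x(j := i)) ` ({..<n} \<times> grid n j))"
    unfolding grid_def lessThan_Suc PiE_insert_eq by simp
  also have "\<dots> = (\<Sum>(i, x)\<in>{..<n} \<times> grid n j. g (x(j := i)))"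
    using inj_combinator[of j "{..<j}" "\<lambda>_. {..<n}"]
    by (subst sum.reindex) (auto simp: grid_def case_prod_unfold comp_def)
  also have "\<dots> = (\<Sum>x\<in>grid n j. \<Sum>i<n. g (x(j := i)))"
    by (simp add: sum.cartesian_product[symmetric] sum.swap[of _ "grid n j"])
  finally show ?thesis .
qed

definition unit_tuple :: "nat \<Rightarrow> nat \<Rightarrow> (nat \<Rightarrow> nat) \<Rightarrow> int vec list" where
  "unit_tuple n r x = map (\<lambda>k. unit_vec n (x k)) [0..<r]"

lemma ext_equiv_expand:
  assumes vs: "vs \<in> ext_gens n r"
  shows "ext_equiv n r (frag_of vs) (\<Sum>x\<in>grid n r. frag_cmul (\<Prod>k<r. vs ! k $ x k) (frag_of (unit_tuple n r x)))"
proof -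
  have len: "length vs = r" and car: "\<And>k. k < r \<Longrightarrow> vs ! k \<in> carrier_vec n"
    using vs by (auto simp: ext_gens_def)
  \<comment> \<open>The first \<open>j\<close> slots already hold unit vectors; each step of the
    induction expands one more slot.\<close>
  define p where "p j x = map (\<lambda>k. if k < j then unit_vec n (x k) else vs ! k) [0..<r]" for j and x :: "nat \<Rightarrow> nat"
  have pg: "p j x \<in> ext_gens n r" for j x
    using car by (auto simp: p_def ext_gens_def)
  have "ext_equiv n r (frag_of vs) (\<Sum>x\<in>grid n j. frag_cmul (\<Prod>k<j. vs ! k $ x k) (frag_of (p j x)))" if "j \<le> r" for j
    using that
  proof (induction j)
    case 0
    have "p 0 x = vs" for x by (rule nth_equalityI) (auto simp: p_def len)
    then show ?case by (simp add: grid_def)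
  next
    case (Suc j)
    then have j: "j < r" by simp
    have "ext_equiv n r (frag_of vs) (\<Sum>x\<in>grid n j. frag_cmul (\<Prod>k<j. vs ! k $ x k) (frag_of (p j x)))"
      using Suc by simp
    also have "ext_equiv n r \<dots> (\<Sum>x\<in>grid n j. frag_cmul (\<Prod>k<j. vs ! k $ x k)
        (\<Sum>i<n. frag_cmul (vs ! j $ i) (frag_of ((p j x)[j := unit_vec n i]))))"
    proof (intro ext_equiv_sum ext_equiv_cmul)
      fix x
      have "(p j x)[j := vs ! j] = p j x"
        using j by (intro nth_equalityI) (auto simp: p_def nth_list_update)
      then show "ext_equiv n r (frag_of (p j x)) (\<Sum>i<n. frag_cmul (vs ! j $ i) (frag_of ((p j x)[j := unit_vec n i])))"
        using ext_equiv_slot_expand[OF pg j car[OF j], of j x] by simp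
    qed
    also have "\<dots> = (\<Sum>x\<in>grid n j. \<Sum>i<n. frag_cmul (\<Prod>k<Suc j. vs ! k $ (x(j := i)) k) (frag_of (p (Suc j) (x(j := i)))))"
    proof (intro sum.cong refl)
      fix x
      have "(p j x)[j := unit_vec n i] = p (Suc j) (x(j := i))" for i
        using j by (intro nth_equalityI) (auto simp: p_def nth_list_update less_Suc_eq)
      then show "frag_cmul (\<Prod>k<j. vs ! k $ x k) (\<Sum>i<n. frag_cmul (vs ! j $ i) (frag_of ((p j x)[j := unit_vec n i]))) =
          (\<Sum>i<n. frag_cmul (\<Prod>k<Suc j. vs ! k $ (x(j := i)) k) (frag_of (p (Suc j) (x(j := i)))))"
        by (simp add: frag_cmul_sum)
    qed
    finally show ?case by (simp only: sum_grid_Suc)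
  qed
  from this[of r] have "ext_equiv n r (frag_of vs) (\<Sum>x\<in>grid n r. frag_cmul (\<Prod>k<r. vs ! k $ x k) (frag_of (p r x)))"
    by simp
  moreover have "p r x = unit_tuple n r x" for x by (auto simp: p_def unit_tuple_def)
  ultimately show ?thesis by simp
qed

text \<open>Polarization: the tuple with \<open>?a + ?b\<close> in both slots is null, and so are
  the two diagonal terms of its expansion; the mixed terms must cancel.\<close>

lemma ext_equiv_swap:
  assumes vs: "vs \<in> ext_gens n r" and ij: "i < r" "j < r" "i \<noteq> j"
  shows "ext_equiv n r (frag_of (vs[i := vs ! j, j := vs ! i])) (- frag_of vs)"
proof -
  define q where "q u v = frag_of (vs[i := u, j := v])" for u v
  have len: "length vs = r" and car: "\<And>k. k < r \<Longrightarrow> vs ! k \<in> carrier_vec n"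
    using vs by (auto simp: ext_gens_def)
  let ?a = "vs ! i" and ?b = "vs ! j"
  have ab: "?a \<in> carrier_vec n" "?b \<in> carrier_vec n" using car ij by auto
  have g: "vs[i := u, j := v] \<in> ext_gens n r" if "u \<in> carrier_vec n" "v \<in> carrier_vec n" for u v
    using that vs by (intro ext_gens_update)
  have diag: "ext_equiv n r (q u u) 0" if "u \<in> carrier_vec n" for u
    unfolding q_def using ij len
    by (intro ext_equiv_alternating[OF g[OF that that] ij]) (auto simp: nth_list_update)
  have add1: "ext_equiv n r (q (u + u') v) (q u v + q u' v)"
    if "u \<in> carrier_vec n" "u' \<in> carrier_vec n" "v \<in> carrier_vec n" for u u' v
    using ext_equiv_slot_add[OF ext_gens_update[OF vs that(3), of j] ij(1) that(1,2)] ij(3)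
    by (simp add: q_def list_update_swap)
  have add2: "ext_equiv n r (q u (v + v')) (q u v + q u v')"
    if "u \<in> carrier_vec n" "v \<in> carrier_vec n" "v' \<in> carrier_vec n" for u v v'
    using ext_equiv_slot_add[OF ext_gens_update[OF vs that(1), of i] ij(2) that(2,3)]
    by (simp add: q_def)
  have "ext_equiv n r (q ?a ?a + q ?a ?b + (q ?b ?a + q ?b ?b)) (q ?a (?a + ?b) + q ?b (?a + ?b))"
    using ab by (intro ext_equiv_add ext_equiv_sym[OF add2]) auto
  also have "ext_equiv n r \<dots> (q (?a + ?b) (?a + ?b))"
    using ab by (intro ext_equiv_sym[OF add1]) auto
  also have "ext_equiv n r \<dots> 0" using ab by (intro diag) auto
  finally have "ext_equiv n r (q ?a ?a + q ?a ?b + (q ?b ?a + q ?b ?b) - (q ?a ?a + q ?b ?b)) (0 - (0 + 0))"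
    using ab by (intro ext_equiv_diff ext_equiv_add diag)
  then have "ext_equiv n r (q ?b ?a) (- q ?a ?b)"
    by (simp add: ext_equiv_def algebra_simps)
  moreover have "q ?a ?b = frag_of vs" by (simp add: q_def)
  ultimately show ?thesis by (simp add: q_def)
qed

lemma ext_equiv_permute:
  assumes vs: "vs \<in> ext_gens n r" and \<sigma>: "\<sigma> permutes {..<r}"
  shows "ext_equiv n r (frag_of (map (\<lambda>k. vs ! \<sigma> k) [0..<r])) (frag_cmul (sign \<sigma>) (frag_of vs))"
  using \<sigma> finite_lessThan vs
proof (induction arbitrary: vs rule: permutes_induct)
  case id
  have "map (\<lambda>k. vs ! id k) [0..<r] = vs"
    using id by (intro nth_equalityI) (auto simp: ext_gens_def)
  then show ?case by (simp add: sign_id)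
next
  case (swap a b \<sigma>)
  let ?ws = "vs[a := vs ! b, b := vs ! a]"
  have ab: "a < r" "b < r" using swap.hyps by auto
  have len: "length vs = r" and car: "\<And>k. k < r \<Longrightarrow> vs ! k \<in> carrier_vec n"
    using swap.prems by (auto simp: ext_gens_def)
  have ws: "?ws \<in> ext_gens n r"
    using car ab by (intro ext_gens_update swap.prems) auto
  \<comment> \<open>The transposition is applied last to the index, so it can be absorbed into the
    tuple and the induction hypothesis used for \<open>?ws\<close>.\<close>
  have "map (\<lambda>k. vs ! (Transposition.transpose a b \<circ> \<sigma>) k) [0..<r] = map (\<lambda>k. ?ws ! \<sigma> k) [0..<r]"
    using ab len by (auto simp: nth_list_update Transposition.transpose_def)
  also have "ext_equiv n r (frag_of \<dots>) (frag_cmul (sign \<sigma>) (frag_of ?ws))"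
    by (rule swap.IH[OF ws])
  also have "ext_equiv n r \<dots> (frag_cmul (sign \<sigma>) (- frag_of vs))"
    using ab swap.hyps by (intro ext_equiv_cmul ext_equiv_swap swap.prems)
  also have "\<dots> = frag_cmul (sign (Transposition.transpose a b \<circ> \<sigma>)) (frag_of vs)"
  proof -
    have "Transposition.transpose a b permutes {..<r}"
      using ab by (intro permutes_swap_id) auto
    then have "sign (Transposition.transpose a b \<circ> \<sigma>) = - sign \<sigma>"
      using swap.hyps by (simp add: sign_comp_permutes sign_swap_id)
    then show ?thesis by (simp flip: frag_cmul_minus_one)
  qed
  finally show ?case .
qed


subsection \<open>Coordinates of the exterior power\<close>

lemma grid_undefined: "x \<in> grid n r \<Longrightarrow> \<not> k < r \<Longrightarrow> x k = undefined"
  by (simp add: grid_def PiE_iff extensional_def)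

text \<open>The Leibniz formula for the minor with entries \<open>vs ! i $ x k\<close>, which is the
  coordinate at \<open>x\<close> of the wedge product of \<open>vs\<close>.\<close>

definition wedge :: "nat \<Rightarrow> nat \<Rightarrow> int vec list \<Rightarrow> (nat \<Rightarrow> nat) \<Rightarrow> int" where
  "wedge n r vs x = (if x \<in> grid n r
     then \<Sum>\<sigma> | \<sigma> permutes {..<r}. sign \<sigma> * (\<Prod>k<r. vs ! \<sigma> k $ x k) else 0)"

text \<open>The linear extension of \<open>wedge\<close>. \<open>frag_extend\<close> takes values in
  a free abelian group; the one on the type \<open>unit\<close> serves as a copy of the
  integers.\<close>

definition coord :: "nat \<Rightarrow> nat \<Rightarrow> (int vec list \<Rightarrow>\<^sub>0 int) \<Rightarrow> (nat \<Rightarrow> nat) \<Rightarrow> int" where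
  "coord n r c x = Poly_Mapping.lookup (frag_extend (\<lambda>vs. frag_cmul (wedge n r vs x) (frag_of ())) c) ()"

lemma coord_simps [simp]:
  "coord n r 0 x = 0"
  "coord n r (frag_of vs) x = wedge n r vs x"
  "coord n r (a + b) x = coord n r a x + coord n r b x"
  "coord n r (a - b) x = coord n r a x - coord n r b x"
  "coord n r (- a) x = - coord n r a x"
  "coord n r (frag_cmul k a) x = k * coord n r a x"
  by (simp_all add: coord_def frag_extend_add frag_extend_diff frag_extend_minus frag_extend_cmul
      lookup_add lookup_minus del: minus_frag_cmul)

lemma coord_sum [simp]: "coord n r (\<Sum>i\<in>I. f i) x = (\<Sum>i\<in>I. coord n r (f i) x)"
  by (induction I rule: infinite_finite_induct) auto

definition coord_rat :: "nat \<Rightarrow> nat \<Rightarrow> (int vec list \<Rightarrow>\<^sub>0 int) \<Rightarrow> (nat \<Rightarrow> nat) \<Rightarrow> rat" where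
  "coord_rat n r c x = of_int (coord n r c x)"

lemma wedge_comp:
  assumes \<tau>: "\<tau> permutes {..<r}"
  shows "wedge n r vs (x \<circ> \<tau>) = sign \<tau> * wedge n r vs x"
proof -
  have p: "(\<Prod>k<r. vs ! (\<sigma> \<circ> \<tau>) k $ (x \<circ> \<tau>) k) = (\<Prod>k<r. vs ! \<sigma> k $ x k)" for \<sigma>
    using prod.permute[OF \<tau>, of "\<lambda>k. vs ! \<sigma> k $ x k"] by (simp add: comp_def)
  have "(\<Sum>\<sigma> | \<sigma> permutes {..<r}. sign \<sigma> * (\<Prod>k<r. vs ! \<sigma> k $ (x \<circ> \<tau>) k)) =
      (\<Sum>\<sigma> | \<sigma> permutes {..<r}. sign (\<sigma> \<circ> \<tau>) * (\<Prod>k<r. vs ! (\<sigma> \<circ> \<tau>) k $ (x \<circ> \<tau>) k))"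
    by (rule sum_permutations_compose_right[OF \<tau>])
  also have "\<dots> = (\<Sum>\<sigma> | \<sigma> permutes {..<r}. sign \<tau> * (sign \<sigma> * (\<Prod>k<r. vs ! \<sigma> k $ x k)))"
    unfolding p by (intro sum.cong) (auto simp: sign_comp_permutes[OF _ \<tau>])
  finally show ?thesis
    by (simp add: wedge_def grid_comp[OF \<tau>] sum_distrib_left)
qed

lemma coord_rat_alt: "coord_rat n r c \<in> alt_space n r"
proof -
  have "c \<in> UNIV \<Longrightarrow> (x \<notin> grid n r \<longrightarrow> coord n r c x = 0) \<and>
      (\<forall>\<tau>. \<tau> permutes {..<r} \<longrightarrow> coord n r c (x \<circ> \<tau>) = sign \<tau> * coord n r c x)" for x
    using subset_UNIV
  proof (induction c rule: frag_induction)
    case (one vs)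
    show ?case
      by (intro conjI allI impI) (simp add: wedge_def, simp only: coord_simps wedge_comp)
  qed (auto simp: algebra_simps)
  then show ?thesis
    by (auto simp: alt_space_def grid_supported_def coord_rat_def)
qed

text \<open>Each Leibniz term has exactly one factor from slot \<open>i\<close>, at the position
  that \<open>\<sigma>\<close> sends to \<open>i\<close>, and is linear in it.\<close>

lemma wedge_slot_add:
  assumes vs: "vs \<in> ext_gens n r" "i < r" and uv: "u \<in> carrier_vec n" "v \<in> carrier_vec n"
  shows "wedge n r (vs[i := u + v]) x = wedge n r (vs[i := u]) x + wedge n r (vs[i := v]) x"
proof (cases "x \<in> grid n r")
  case x: True
  have "(\<Prod>k<r. vs[i := u + v] ! \<sigma> k $ x k) =
      (\<Prod>k<r. vs[i := u] ! \<sigma> k $ x k) + (\<Prod>k<r. vs[i := v] ! \<sigma> k $ x k)" if \<sigma>: "\<sigma> permutes {..<r}" for \<sigma>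
  proof -
    obtain j where j: "j < r" "\<sigma> j = i"
      using permutes_image[OF \<sigma>] vs(2) by (metis imageE lessThan_iff)
    have slot: "(\<Prod>k<r. vs[i := w] ! \<sigma> k $ x k) = w $ x j * (\<Prod>k\<in>{..<r} - {j}. vs ! \<sigma> k $ x k)" for w
    proof -
      have "(\<Prod>k\<in>{..<r} - {j}. vs[i := w] ! \<sigma> k $ x k) = (\<Prod>k\<in>{..<r} - {j}. vs ! \<sigma> k $ x k)"
      proof (intro prod.cong refl)
        fix k assume "k \<in> {..<r} - {j}"
        then have "\<sigma> k \<noteq> i" using j inj_eq[OF permutes_inj[OF \<sigma>], of k j] by auto
        then show "vs[i := w] ! \<sigma> k $ x k = vs ! \<sigma> k $ x k" by simp
      qed
      then show ?thesis
        using j vs by (subst prod.remove[of _ j]) (auto simp: ext_gens_def)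
    qed
    have "x j < n" using x j(1) by (force simp: grid_def PiE_iff)
    then show ?thesis unfolding slot using uv by (simp add: algebra_simps)
  qed
  then show ?thesis
    unfolding wedge_def if_P[OF x] sum.distrib[symmetric] distrib_left[symmetric]
    by (intro sum.cong refl) simp
qed (simp add: wedge_def)

text \<open>Composing with the transposition of the two equal slots leaves every product unchanged
  and flips every sign, so the sum equals its negative.\<close>

lemma wedge_alternating:
  assumes "i < r" "j < r" "i \<noteq> j" "vs ! i = vs ! j"
  shows "wedge n r vs x = 0"
proof (cases "x \<in> grid n r")
  case x: True
  let ?t = "Transposition.transpose i j"
  have t: "?t permutes {..<r}" using assms by (intro permutes_swap_id) auto
  have eq: "vs ! ?t k = vs ! k" for k
    using assms by (simp add: Transposition.transpose_def)
  have "(\<Sum>\<sigma> | \<sigma> permutes {..<r}. sign \<sigma> * (\<Prod>k<r. vs ! \<sigma> k $ x k)) =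
      (\<Sum>\<sigma> | \<sigma> permutes {..<r}. sign (?t \<circ> \<sigma>) * (\<Prod>k<r. vs ! (?t \<circ> \<sigma>) k $ x k))"
    by (rule setum_permutations_compose_left[OF t])
  also have "\<dots> = (\<Sum>\<sigma> | \<sigma> permutes {..<r}. - (sign \<sigma> * (\<Prod>k<r. vs ! \<sigma> k $ x k)))"
    using t assms(3) by (intro sum.cong) (auto simp: sign_comp_permutes sign_swap_id eq)
  finally show ?thesis using x by (simp add: wedge_def sum_negf)
qed (simp add: wedge_def)

text \<open>Minors are multilinear and alternating, so they kill the relations; this makes
  \<open>coord\<close> a function on the exterior power.\<close>

lemma coord_null:
  assumes "c \<in> ext_null n r"
  shows "coord n r c x = 0"
proof -
  have rel: "coord n r c x = 0" if "c \<in> ext_rels n r" for c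
    using that by (auto simp: ext_rels_def wedge_slot_add intro: wedge_alternating)
  show ?thesis
    using assms unfolding ext_null_def
  proof (induction rule: generate.induct)
    case (inv h)
    have "h \<in> carrier (ext_tuples n r)" using inv ext_rels_subset by (rule subsetD[rotated])
    then have "Poly_Mapping.keys h \<subseteq> ext_gens n r" by (simp add: ext_tuples_def)
    then show ?case using rel[OF inv] by (simp add: ext_tuples_def)
  qed (auto simp: rel, auto simp: ext_tuples_def)
qed

section \<open>The action of the Jordan block in coordinates\<close>

lemma jordan_block_mult_vec:
  assumes v: "v \<in> carrier_vec n" and i: "i < n"
  shows "(jordan_block n 1 *\<^sub>v v) $ i = (v $ i + (if Suc i < n then v $ Suc i else 0) :: int)"
proof -
  have "(jordan_block n 1 *\<^sub>v v) $ i = (\<Sum>j<n. jordan_block n 1 $$ (i, j) * v $ j)"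
    using v i by (simp add: scalar_prod_def atLeast0LessThan)
  also have "\<dots> = (\<Sum>j<n. (if j = i then v $ j else 0) + (if j = Suc i then v $ j else 0))"
    using i by (intro sum.cong) auto
  also have "\<dots> = v $ i + (if Suc i < n then v $ Suc i else 0)"
    using i by (simp add: sum.distrib)
  finally show ?thesis .
qed

text \<open>Each factor of a Leibniz term becomes a sum of two entries, at \<open>x k\<close> and at
  \<open>Suc (x k)\<close>. Multiplying out, \<open>D\<close> is the set of positions where the
  second one is taken.\<close>

lemma wedge_jordan_block:
  assumes vs: "vs \<in> ext_gens n r"
  shows "of_int (wedge n r (map (\<lambda>v. jordan_block n 1 *\<^sub>v v) vs) x) = shift r (\<lambda>y. of_int (wedge n r vs y)) x"
proof (cases "x \<in> grid n r")
  case x: True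
  have len: "length vs = r" and car: "\<And>k. k < r \<Longrightarrow> vs ! k \<in> carrier_vec n"
    using vs by (auto simp: ext_gens_def)
  \<comment> \<open>Extension by zero removes the special case of the last row of the Jordan
    block.\<close>
  define e where "e v i = (if i < n then v $ i else 0)" for v :: "int vec" and i
  let ?e = "\<lambda>\<sigma> D. \<Prod>k<r. e (vs ! \<sigma> k) (bump D x k)"
  have xn: "x k < n" if "k < r" for k using x that by (force simp: grid_def PiE_iff)
  have prod: "(\<Prod>k<r. map (\<lambda>v. jordan_block n 1 *\<^sub>v v) vs ! \<sigma> k $ x k) = (\<Sum>D\<in>Pow {..<r}. ?e \<sigma> D)"
    if \<sigma>: "\<sigma> permutes {..<r}" for \<sigma>
  proof -
    have "(\<Prod>k<r. map (\<lambda>v. jordan_block n 1 *\<^sub>v v) vs ! \<sigma> k $ x k) =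
        (\<Prod>k<r. e (vs ! \<sigma> k) (Suc (x k)) + e (vs ! \<sigma> k) (x k))"
    proof (intro prod.cong refl)
      fix k assume k: "k \<in> {..<r}"
      then have "\<sigma> k < r" using permutes_in_image[OF \<sigma>, of k] by simp
      then have "map (\<lambda>v. jordan_block n 1 *\<^sub>v v) vs ! \<sigma> k = jordan_block n 1 *\<^sub>v (vs ! \<sigma> k)"
        using len by (simp only: nth_map)
      then show "map (\<lambda>v. jordan_block n 1 *\<^sub>v v) vs ! \<sigma> k $ x k = e (vs ! \<sigma> k) (Suc (x k)) + e (vs ! \<sigma> k) (x k)"
        using jordan_block_mult_vec[OF car[OF \<open>\<sigma> k < r\<close>] xn[of k]] k xn[of k] by (simp only:) (simp add: e_def)
    qed
    also have "\<dots> = (\<Sum>D\<in>Pow {..<r}. (\<Prod>k\<in>D. e (vs ! \<sigma> k) (Suc (x k))) * (\<Prod>k\<in>{..<r} - D. e (vs ! \<sigma> k) (x k)))"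
      by (rule prod_add) simp
    also have "\<dots> = (\<Sum>D\<in>Pow {..<r}. ?e \<sigma> D)"
    proof (intro sum.cong refl)
      fix D assume D: "D \<in> Pow {..<r}"
      have "?e \<sigma> D = (\<Prod>k\<in>{..<r} - D. e (vs ! \<sigma> k) (bump D x k)) * (\<Prod>k\<in>D. e (vs ! \<sigma> k) (bump D x k))"
        using D by (intro prod.subset_diff) auto
      also have "\<dots> = (\<Prod>k\<in>{..<r} - D. e (vs ! \<sigma> k) (x k)) * (\<Prod>k\<in>D. e (vs ! \<sigma> k) (Suc (x k)))"
        by (intro arg_cong2[of _ _ _ _ "(*)"] prod.cong) (auto simp: bump_def)
      finally show "(\<Prod>k\<in>D. e (vs ! \<sigma> k) (Suc (x k))) * (\<Prod>k\<in>{..<r} - D. e (vs ! \<sigma> k) (x k)) = ?e \<sigma> D"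
        by simp
    qed
    finally show ?thesis .
  qed
  have wed: "wedge n r vs (bump D x) = (\<Sum>\<sigma> | \<sigma> permutes {..<r}. sign \<sigma> * ?e \<sigma> D)" if D: "D \<subseteq> {..<r}" for D
  proof (cases "bump D x \<in> grid n r")
    case True
    then have "bump D x k < n" if "k < r" for k using that by (force simp: grid_def PiE_iff)
    then show ?thesis using True by (simp add: wedge_def e_def)
  next
    case False
    have "bump D x k = undefined" if "\<not> k < r" for k
    proof -
      have "k \<notin> D" using D that by blast
      then show ?thesis using x that by (simp add: bump_def grid_def PiE_iff extensional_def)
    qed
    \<comment> \<open>Off the grid some bumped index has reached \<open>n\<close>; there
      \<open>e\<close> is zero, in agreement with the value 0 of \<open>wedge\<close>.\<close>
    then obtain k where k: "k < r" "\<not> bump D x k < n"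
      using False by (auto simp: grid_def PiE_iff extensional_def)
    then have z: "?e \<sigma> D = 0" for \<sigma> by (intro prod_zero bexI[of _ k]) (auto simp: e_def)
    show ?thesis unfolding wedge_def if_not_P[OF False] z by simp
  qed
  have "wedge n r (map (\<lambda>v. jordan_block n 1 *\<^sub>v v) vs) x =
      (\<Sum>\<sigma> | \<sigma> permutes {..<r}. sign \<sigma> * (\<Sum>D\<in>Pow {..<r}. ?e \<sigma> D))"
    using x prod by (simp add: wedge_def)
  also have "\<dots> = (\<Sum>D\<in>Pow {..<r}. wedge n r vs (bump D x))"
    unfolding sum_distrib_left by (subst sum.swap) (simp add: wed)
  finally show ?thesis by (simp add: shift_def)
next
  case False
  then have "bump D x \<notin> grid n r" if "D \<subseteq> {..<r}" for D
    using bump_grid that by blast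
  then show ?thesis using False by (simp add: wedge_def shift_def)
qed

lemma coord_jordan_block:
  assumes "c \<in> carrier (ext_tuples n r)"
  shows "coord_rat n r (tuple_map (jordan_block n 1) c) = shift r (coord_rat n r c)"
proof -
  have "Poly_Mapping.keys c \<subseteq> ext_gens n r" using assms by (simp add: ext_tuples_def)
  then have "coord_rat n r (tuple_map (jordan_block n 1) c) x = shift r (coord_rat n r c) x" for x
  proof (induction c rule: frag_induction)
    case zero
    show ?case by (simp add: coord_rat_def tuple_map_def shift_def)
  next
    case (one vs)
    then show ?case using wedge_jordan_block by (simp add: coord_rat_def[abs_def] tuple_map_def)
  next
    case (diff a b)
    then show ?case by (simp add: coord_rat_def tuple_map_def frag_extend_diff shift_def sum_subtractf)
  qed
  then show ?thesis by blast
qed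

text \<open>\<open>lift\<close> is inverse to \<open>coord\<close> only up to the factor \<open>r!\<close>, which spares sorting the tuples and
  does not affect ranks.\<close>

definition lift :: "nat \<Rightarrow> nat \<Rightarrow> ((nat \<Rightarrow> nat) \<Rightarrow> int) \<Rightarrow> (int vec list \<Rightarrow>\<^sub>0 int)" where
  "lift n r g = (\<Sum>x\<in>grid n r. frag_cmul (g x) (frag_of (unit_tuple n r x)))"

lemma lift_carrier: "lift n r g \<in> carrier (ext_tuples n r)"
proof -
  have "unit_tuple n r x \<in> ext_gens n r" for x by (auto simp: unit_tuple_def ext_gens_def)
  then show ?thesis
    unfolding lift_def ext_tuples_def by (intro sum_closed_free_Abelian_group) auto
qed

lemma card_permutations_lessThan: "card {\<sigma>. \<sigma> permutes {..<r :: nat}} = fact r"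
  by (intro card_permutations) auto

text \<open>For fixed \<open>\<sigma>\<close> the sum over the grid is the expansion of the permuted
  tuple, which is congruent to \<open>sign \<sigma>\<close> times the original. The two signs
  cancel, and each of the r! permutations contributes one copy.\<close>

lemma lift_coord:
  assumes "c \<in> carrier (ext_tuples n r)"
  shows "ext_equiv n r (lift n r (coord n r c)) (frag_cmul (fact r) c)"
proof -
  have "Poly_Mapping.keys c \<subseteq> ext_gens n r" using assms by (simp add: ext_tuples_def)
  then show ?thesis
  proof (induction c rule: frag_induction)
    case zero
    show ?case by (simp add: lift_def)
  next
    case (one vs)
    let ?P = "{\<sigma>. \<sigma> permutes {..<r}}"
    define w where "w \<sigma> = map (\<lambda>k. vs ! \<sigma> k) [0..<r]" for \<sigma>
    have w: "w \<sigma> \<in> ext_gens n r" if "\<sigma> \<in> ?P" for \<sigma>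
    proof -
      have "vs ! \<sigma> k \<in> carrier_vec n" if "k < r" for k
        using one permutes_in_image[of \<sigma> "{..<r}" k] \<open>\<sigma> \<in> ?P\<close> that by (auto simp: ext_gens_def)
      then show ?thesis by (auto simp: w_def ext_gens_def)
    qed
    have cm: "frag_cmul (\<Sum>i\<in>I. f i) a = (\<Sum>i\<in>I. frag_cmul (f i) a)" for I :: "(nat \<Rightarrow> nat) set" and f and a :: "int vec list \<Rightarrow>\<^sub>0 int"
      by (induction I rule: infinite_finite_induct) (auto simp: frag_cmul_distrib)
    have "lift n r (coord n r (frag_of vs)) =
        (\<Sum>x\<in>grid n r. \<Sum>\<sigma>\<in>?P. frag_cmul (sign \<sigma>) (frag_cmul (\<Prod>k<r. w \<sigma> ! k $ x k) (frag_of (unit_tuple n r x))))"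
      unfolding lift_def by (intro sum.cong refl) (simp add: wedge_def cm w_def)
    also have "\<dots> = (\<Sum>\<sigma>\<in>?P. frag_cmul (sign \<sigma>) (\<Sum>x\<in>grid n r. frag_cmul (\<Prod>k<r. w \<sigma> ! k $ x k) (frag_of (unit_tuple n r x))))"
      by (subst sum.swap) (simp only: frag_cmul_sum)
    also have "ext_equiv n r \<dots> (\<Sum>\<sigma>\<in>?P. frag_cmul (sign \<sigma>) (frag_of (w \<sigma>)))"
      using w by (intro ext_equiv_sum ext_equiv_cmul ext_equiv_sym[OF ext_equiv_expand])
    also have "ext_equiv n r \<dots> (\<Sum>\<sigma>\<in>?P. frag_cmul (sign \<sigma>) (frag_cmul (sign \<sigma>) (frag_of vs)))"
      unfolding w_def using one by (intro ext_equiv_sum ext_equiv_cmul ext_equiv_permute) auto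
    also have "\<dots> = (\<Sum>\<sigma>\<in>?P. frag_cmul 1 (frag_of vs))"
      by (intro sum.cong refl) (simp add: sign_idempotent)
    also have "\<dots> = frag_cmul (\<Sum>\<sigma>\<in>?P. 1) (frag_of vs)" by (rule cm[symmetric])
    also have "\<dots> = frag_cmul (fact r) (frag_of vs)"
      by (simp add: card_permutations_lessThan)
    finally show ?case .
  next
    case (diff a b)
    have "lift n r (coord n r (a - b)) = lift n r (coord n r a) - lift n r (coord n r b)"
      by (simp add: lift_def frag_cmul_diff_distrib sum_subtractf)
    then show ?case using diff by (simp only: frag_cmul_diff_distrib2) (rule ext_equiv_diff)
  qed
qed

text \<open>The minors of unit vectors have entries 0 and 1, and the product for
  \<open>\<sigma>\<close> is 1 only if \<open>x \<circ> \<sigma> = y\<close>. This identifies the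
  basis of \<open>alt_space\<close> with wedge products of unit vectors.\<close>

lemma wedge_unit_tuple:
  assumes x: "x \<in> grid n r"
  shows "of_int (wedge n r (unit_tuple n r x) y) = alt_unit r x y"
proof (cases "y \<in> grid n r")
  case y: True
  have "(\<Prod>k<r. unit_tuple n r x ! \<sigma> k $ y k) = (if x \<circ> \<sigma> = y then 1 else 0)" if \<sigma>: "\<sigma> permutes {..<r}" for \<sigma>
  proof -
    have "(\<Prod>k<r. unit_tuple n r x ! \<sigma> k $ y k) = (\<Prod>k<r. if x (\<sigma> k) = y k then 1 else 0)"
    proof (intro prod.cong refl)
      fix k assume k: "k \<in> {..<r}"
      then have "\<sigma> k < r" using permutes_in_image[OF \<sigma>, of k] by simp
      moreover have "y k < n" using y k by (force simp: grid_def PiE_iff)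
      ultimately show "unit_tuple n r x ! \<sigma> k $ y k = (if x (\<sigma> k) = y k then 1 else 0)"
        by (auto simp: unit_tuple_def unit_vec_def)
    qed
    also have "\<dots> = (if \<forall>k<r. x (\<sigma> k) = y k then 1 else 0)"
      by (auto intro!: prod_zero)
    also have "(\<forall>k<r. x (\<sigma> k) = y k) \<longleftrightarrow> x \<circ> \<sigma> = y"
    proof -
      have xs: "x \<circ> \<sigma> \<in> grid n r" using grid_comp[OF \<sigma>] x by blast
      show ?thesis
      proof
        assume *: "\<forall>k<r. x (\<sigma> k) = y k"
        show "x \<circ> \<sigma> = y"
        proof
          fix k
          show "(x \<circ> \<sigma>) k = y k"
            using * grid_undefined[OF xs, of k] grid_undefined[OF y, of k] by (cases "k < r") simp_all
        qed
      qed auto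
    qed
    finally show ?thesis .
  qed
  then have "wedge n r (unit_tuple n r x) y = (\<Sum>\<sigma> | \<sigma> permutes {..<r}. sign \<sigma> * (if x \<circ> \<sigma> = y then 1 else 0))"
    unfolding wedge_def if_P[OF y] by (intro sum.cong refl) (simp only: mem_Collect_eq)
  then show ?thesis
    unfolding alt_unit_def by (simp only: of_int_sum of_int_mult) (intro sum.cong refl, simp)
next
  case False
  then show ?thesis using alt_spaceD(1)[OF alt_unit_alt[OF x], of y] by (auto simp: wedge_def)
qed

text \<open>For each \<open>\<sigma>\<close> exactly one tuple, \<open>y\<close> composed with the
  inverse of \<open>\<sigma>\<close>, contributes at \<open>y\<close>; as \<open>f\<close> is
  alternating, its contribution is \<open>f y\<close>. There are r! permutations.\<close>

lemma coord_lift: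
  assumes f: "f \<in> alt_space n r" and g: "\<And>x. x \<in> grid n r \<Longrightarrow> of_int (g x) = f x"
  shows "coord_rat n r (lift n r g) = fscale (fact r) f"
proof
  fix y
  let ?P = "{\<sigma>. \<sigma> permutes {..<r}}"
  have "coord_rat n r (lift n r g) y = (\<Sum>x\<in>grid n r. f x * alt_unit r x y)"
    by (simp add: coord_rat_def lift_def g wedge_unit_tuple)
  also have "\<dots> = (\<Sum>x\<in>grid n r. \<Sum>\<sigma>\<in>?P. of_int (sign \<sigma>) * (if x \<circ> \<sigma> = y then f x else 0))"
    unfolding alt_unit_def sum_distrib_left by (intro sum.cong refl) simp
  also have "\<dots> = (\<Sum>\<sigma>\<in>?P. \<Sum>x\<in>grid n r. of_int (sign \<sigma>) * (if x \<circ> \<sigma> = y then f x else 0))"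
    by (rule sum.swap)
  also have "\<dots> = (\<Sum>\<sigma>\<in>?P. f y)"
  proof (intro sum.cong refl)
    fix \<sigma> assume "\<sigma> \<in> ?P"
    then have \<sigma>: "\<sigma> permutes {..<r}" by simp
    let ?z = "y \<circ> inv_into UNIV \<sigma>"
    have iff: "x \<circ> \<sigma> = y \<longleftrightarrow> x = ?z" for x
    proof
      assume "x \<circ> \<sigma> = y"
      moreover have "x = (x \<circ> \<sigma>) \<circ> inv_into UNIV \<sigma>"
        by (simp only: comp_assoc permutes_inv_o[OF \<sigma>] comp_id)
      ultimately show "x = ?z" by (simp only:)
    next
      assume "x = ?z"
      then show "x \<circ> \<sigma> = y" by (simp only: comp_assoc permutes_inv_o[OF \<sigma>] comp_id)
    qed
    have "f y = f (?z \<circ> \<sigma>)" by (simp only: comp_assoc permutes_inv_o[OF \<sigma>] comp_id)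
    also have "\<dots> = of_int (sign \<sigma>) * f ?z" by (rule alt_spaceD(2)[OF f \<sigma>])
    also have "f ?z = (\<Sum>x\<in>grid n r. if x = ?z then f x else 0)"
      using alt_spaceD(1)[OF f, of ?z] by (auto simp: sum.delta)
    finally show "(\<Sum>x\<in>grid n r. of_int (sign \<sigma>) * (if x \<circ> \<sigma> = y then f x else 0)) = f y"
      by (simp only: sum_distrib_left iff)
  qed
  also have "\<dots> = fscale (fact r) f y"
    by (simp add: card_permutations_lessThan)
  finally show "coord_rat n r (lift n r g) y = fscale (fact r) f y" .
qed


subsection \<open>The rank of the kernel\<close>

abbreviation ext_class :: "nat \<Rightarrow> nat \<Rightarrow> (int vec list \<Rightarrow>\<^sub>0 int) \<Rightarrow> (int vec list \<Rightarrow>\<^sub>0 int) set" where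
  "ext_class n r c \<equiv> ext_null n r #>\<^bsub>ext_tuples n r\<^esub> c"

lemma normal_ext_null: "normal (ext_null n r) (ext_tuples n r)"
proof -
  interpret comm_group "ext_tuples n r" by (rule comm_group_ext_tuples)
  show ?thesis by (simp add: normal_iff_subgroup subgroup_ext_null)
qed

lemma ext_power_carrier: "carrier (ext_power n r) = ext_class n r ` carrier (ext_tuples n r)"
  by (simp add: ext_power_def carrier_FactGroup)

lemma ext_power_mult:
  assumes "a \<in> carrier (ext_tuples n r)" "b \<in> carrier (ext_tuples n r)"
  shows "ext_class n r a \<otimes>\<^bsub>ext_power n r\<^esub> ext_class n r b = ext_class n r (a + b)"
proof -
  interpret normal "ext_null n r" "ext_tuples n r" by (rule normal_ext_null)
  show ?thesis using rcos_sum[OF assms] by (simp add: ext_power_def) (simp add: ext_tuples_def)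
qed

lemma ext_power_inv:
  assumes "a \<in> carrier (ext_tuples n r)"
  shows "inv\<^bsub>ext_power n r\<^esub> (ext_class n r a) = ext_class n r (- a)"
proof -
  interpret normal "ext_null n r" "ext_tuples n r" by (rule normal_ext_null)
  have "ext_class n r a \<in> carrier (ext_tuples n r Mod ext_null n r)"
    using assms by (simp add: carrier_FactGroup)
  moreover have "inv\<^bsub>ext_tuples n r\<^esub> a = - a" using assms by (simp add: ext_tuples_def)
  ultimately show ?thesis
    using rcos_inv[OF assms] by (simp add: ext_power_def inv_FactGroup)
qed

lemma ext_power_one: "\<one>\<^bsub>ext_power n r\<^esub> = ext_null n r"
  by (simp add: ext_power_def)

lemma ext_class_eq_null:
  assumes "c \<in> carrier (ext_tuples n r)"
  shows "ext_class n r c = ext_null n r \<longleftrightarrow> c \<in> ext_null n r"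
proof -
  interpret comm_group "ext_tuples n r" by (rule comm_group_ext_tuples)
  show ?thesis
    using coset_join1[OF _ assms subgroup_ext_null] coset_join2[OF assms subgroup_ext_null] by blast
qed

lemma ext_power_pow:
  assumes "c \<in> carrier (ext_tuples n r)"
  shows "ext_class n r c [^]\<^bsub>ext_power n r\<^esub> (k::nat) = ext_class n r (frag_cmul (int k) c)"
proof -
  interpret normal "ext_null n r" "ext_tuples n r" by (rule normal_ext_null)
  show ?thesis using FactGroup_pow[OF assms, of k] by (simp add: ext_power_def) (simp add: ext_tuples_def)
qed

lemma ext_tuples_closed:
  assumes "a \<in> carrier (ext_tuples n r)" "b \<in> carrier (ext_tuples n r)"
  shows "a + b \<in> carrier (ext_tuples n r)" "a - b \<in> carrier (ext_tuples n r)"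
    "- a \<in> carrier (ext_tuples n r)" "frag_cmul k a \<in> carrier (ext_tuples n r)"
  using assms Poly_Mapping.keys_add[of a b] keys_diff[of a b] keys_cmul[of k a]
  by (auto simp: ext_tuples_def)

lemma tuple_map_closed:
  "c \<in> carrier (ext_tuples n r) \<Longrightarrow> A \<in> carrier_mat n n \<Longrightarrow> tuple_map A c \<in> carrier (ext_tuples n r)"
  using tuple_map_hom[of A n r] by (auto simp: hom_def)

lemma ext_map_minus_id_class:
  assumes c: "c \<in> carrier (ext_tuples n r)" and A: "A \<in> carrier_mat n n"
  shows "ext_map_minus_id n r A (ext_class n r c) = ext_class n r (tuple_map A c - c)"
  using ext_power_mult[OF tuple_map_closed[OF c A] ext_tuples_closed(3)[OF c c]]
  by (simp add: ext_map_minus_id_def ext_map_coset[OF A c] ext_power_inv[OF c])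

lemma ext_map_minus_id_hom:
  assumes A: "A \<in> carrier_mat n n"
  shows "ext_map_minus_id n r A \<in> hom (ext_power n r) (ext_power n r)"
proof (rule homI)
  fix X assume "X \<in> carrier (ext_power n r)"
  then obtain a where a: "X = ext_class n r a" "a \<in> carrier (ext_tuples n r)"
    by (auto simp: ext_power_carrier)
  show "ext_map_minus_id n r A X \<in> carrier (ext_power n r)"
    unfolding a(1) ext_map_minus_id_class[OF a(2) A] ext_power_carrier
    using a(2) tuple_map_closed[OF a(2) A] by (intro imageI ext_tuples_closed)
  fix Y assume "Y \<in> carrier (ext_power n r)"
  then obtain b where b: "Y = ext_class n r b" "b \<in> carrier (ext_tuples n r)"
    by (auto simp: ext_power_carrier)
  have "tuple_map A (a + b) - (a + b) = (tuple_map A a - a) + (tuple_map A b - b)"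
    by (simp add: tuple_map_def frag_extend_add)
  then show "ext_map_minus_id n r A (X \<otimes>\<^bsub>ext_power n r\<^esub> Y) =
      ext_map_minus_id n r A X \<otimes>\<^bsub>ext_power n r\<^esub> ext_map_minus_id n r A Y"
    using a(2) b(2) A
    by (simp only: a(1) b(1) ext_power_mult ext_map_minus_id_class ext_tuples_closed tuple_map_closed)
qed

lemma kernel_ext_map_minus_id:
  assumes A: "A \<in> carrier_mat n n"
  shows "kernel (ext_power n r) (ext_power n r) (ext_map_minus_id n r A) =
    ext_class n r ` {c \<in> carrier (ext_tuples n r). tuple_map A c - c \<in> ext_null n r}"
proof -
  have "ext_map_minus_id n r A (ext_class n r c) = \<one>\<^bsub>ext_power n r\<^esub> \<longleftrightarrow> tuple_map A c - c \<in> ext_null n r"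
    if "c \<in> carrier (ext_tuples n r)" for c
    using that A by (simp only: ext_map_minus_id_class ext_power_one ext_class_eq_null ext_tuples_closed tuple_map_closed)
  then show ?thesis by (auto simp: kernel_def ext_power_carrier)
qed

text \<open>\<open>coord\<close> is constant on cosets, so the choice of the representative does not matter.\<close>

lemma coord_ext_class:
  assumes c: "c \<in> carrier (ext_tuples n r)"
  shows "coord_rat n r (SOME d. d \<in> ext_class n r c) = coord_rat n r c"
proof -
  interpret comm_group "ext_tuples n r" by (rule comm_group_ext_tuples)
  have "c \<in> ext_class n r c" by (rule rcos_self[OF c subgroup_ext_null])
  then have "(SOME d. d \<in> ext_class n r c) \<in> ext_class n r c" by (rule someI)
  then obtain h where "h \<in> ext_null n r" "(SOME d. d \<in> ext_class n r c) = h + c"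
    by (auto simp: r_coset_def) (simp add: ext_tuples_def)
  then show ?thesis by (auto simp: coord_rat_def[abs_def] coord_null)
qed

text \<open>The coordinates of a representative serve as the additive map. By
  \<open>lift_coord\<close> its kernel is killed by r!. For the converse a fixed function, cleared
  of denominators, is lifted to the free group.\<close>

lemma abelian_rank_kernel:
  "abelian_rank ((ext_power n r)
      \<lparr>carrier := kernel (ext_power n r) (ext_power n r) (ext_map_minus_id n r (jordan_block n 1))\<rparr>) =
   fs.dim {f \<in> alt_space n r. shift r f = f}"
proof -
  let ?S = "jordan_block n (1::int)"
  let ?K = "kernel (ext_power n r) (ext_power n r) (ext_map_minus_id n r ?S)"
  let ?G = "(ext_power n r)\<lparr>carrier := ?K\<rparr>"
  let ?U = "{f \<in> alt_space n r. shift r f = f}"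
  let ?\<phi> = "\<lambda>X. coord_rat n r (SOME d. d \<in> X)"
  have S: "?S \<in> carrier_mat n n" by simp
  interpret P: comm_group "ext_power n r" by (rule comm_group_ext_power)
  interpret D: group_hom "ext_power n r" "ext_power n r" "ext_map_minus_id n r ?S"
    using ext_map_minus_id_hom[OF S] by (simp add: group_hom_def group_hom_axioms_def)
  have G: "comm_group ?G"
  proof (rule group.group_comm_groupI)
    show "group ?G" by (rule subgroup.subgroup_is_group[OF D.subgroup_kernel P.is_group])
    fix x y assume "x \<in> carrier ?G" "y \<in> carrier ?G"
    then have "x \<in> carrier (ext_power n r)" "y \<in> carrier (ext_power n r)"
      by (auto simp: kernel_def)
    then show "x \<otimes>\<^bsub>?G\<^esub> y = y \<otimes>\<^bsub>?G\<^esub> x" by (simp add: P.m_comm)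
  qed
  have K: "\<exists>c. X = ext_class n r c \<and> c \<in> carrier (ext_tuples n r) \<and> tuple_map ?S c - c \<in> ext_null n r"
    if "X \<in> carrier ?G" for X
    using that unfolding kernel_ext_map_minus_id[OF S] by auto
  have subU: "fs.subspace ?U"
    using subspace_alt_space[of n r] unfolding fs.subspace_def mem_Collect_eq shift_linear
    by (auto simp: fun_eq_iff shift_def)
  obtain C where C: "finite C" "alt_space n r \<subseteq> fs.span C"
    using dim_alt_space(2)[where P = "\<lambda>_. True" and n = n and r = r] by auto
  show ?thesis
  proof (rule abelian_rank_eq_dim[where \<phi> = ?\<phi> and C = C])
    show "comm_group ?G" by (rule G)
    show "fs.subspace ?U" by (rule subU)
    show "?U \<subseteq> fs.span C" "finite C" using C by auto
  next
    fix x y assume "x \<in> carrier ?G" "y \<in> carrier ?G"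
    then obtain a b where ab: "x = ext_class n r a" "y = ext_class n r b"
      "a \<in> carrier (ext_tuples n r)" "b \<in> carrier (ext_tuples n r)"
      using K by blast
    have "x \<otimes>\<^bsub>?G\<^esub> y = ext_class n r (a + b)" using ext_power_mult[OF ab(3,4)] by (simp add: ab)
    then show "?\<phi> (x \<otimes>\<^bsub>?G\<^esub> y) = ?\<phi> x + ?\<phi> y"
      using ab(3,4) by (simp only: ab(1,2) coord_ext_class ext_tuples_closed) (simp add: coord_rat_def fun_eq_iff)
  next
    fix x assume "x \<in> carrier ?G" and z: "?\<phi> x = 0"
    then obtain c where c: "x = ext_class n r c" "c \<in> carrier (ext_tuples n r)"
      using K by blast
    have cz: "coord_rat n r c = 0" using z coord_ext_class[OF c(2)] by (simp only: c(1))
    have "coord n r c y = 0" for y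
      using fun_cong[OF cz, of y] by (simp add: coord_rat_def)
    then have "lift n r (coord n r c) = 0" by (simp add: lift_def)
    then have "ext_equiv n r 0 (frag_cmul (fact r) c)" using lift_coord[OF c(2)] by simp
    then have "frag_cmul (fact r) c \<in> ext_null n r"
      using ext_equiv_sym[of n r 0] by (simp add: ext_equiv_def)
    then have "ext_class n r (frag_cmul (int (fact r)) c) = ext_null n r"
      using ext_class_eq_null[OF ext_tuples_closed(4)[OF c(2) c(2)], of "fact r"] by simp
    then have "x [^]\<^bsub>ext_power n r\<^esub> (fact r :: nat) = \<one>\<^bsub>ext_power n r\<^esub>"
      using ext_power_pow[OF c(2), of "fact r"] by (simp only: c(1) ext_power_one)
    moreover have "x [^]\<^bsub>?G\<^esub> (k::nat) = x [^]\<^bsub>ext_power n r\<^esub> k" for k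
      by (induction k) simp_all
    ultimately have "x [^]\<^bsub>?G\<^esub> int (fact r) = \<one>\<^bsub>?G\<^esub>"
      unfolding int_pow_int by simp
    then show "\<exists>N::int. N \<noteq> 0 \<and> x [^]\<^bsub>?G\<^esub> N = \<one>\<^bsub>?G\<^esub>"
      by (intro exI[of _ "int (fact r)"]) simp
  next
    fix x assume "x \<in> carrier ?G"
    then obtain c where c: "x = ext_class n r c" "c \<in> carrier (ext_tuples n r)" "tuple_map ?S c - c \<in> ext_null n r"
      using K by blast
    have "shift r (coord_rat n r c) = coord_rat n r (tuple_map ?S c)"
      by (rule coord_jordan_block[OF c(2), symmetric])
    also have "\<dots> = coord_rat n r c"
      using coord_null[OF c(3)] by (auto simp: coord_rat_def fun_eq_iff)
    finally show "?\<phi> x \<in> ?U"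
      using coord_rat_alt by (simp only: c(1) coord_ext_class[OF c(2)] mem_Collect_eq)
  next
    fix u assume u: "u \<in> ?U"
    obtain N g where N: "N \<noteq> 0" "\<forall>x\<in>grid n r. of_int N * u x = of_int (g x)"
      using common_denominator[OF finite_grid, of n r u] by blast
    define c where "c = lift n r g"
    have cc: "c \<in> carrier (ext_tuples n r)" unfolding c_def by (rule lift_carrier)
    have Nu: "fscale (of_int N) u \<in> alt_space n r"
      using u subspace_alt_space fs.subspace_scale by blast
    have coord: "coord_rat n r c = fscale (fact r) (fscale (of_int N) u)"
      unfolding c_def using N(2) by (intro coord_lift[OF Nu]) auto
    \<comment> \<open>Equality of coordinates shows only that \<open>tuple_map ?S c - c\<close> is
      torsion modulo the relations. Multiplying by r! makes it null, so the multiple of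
      \<open>c\<close> represents an element of the kernel.\<close>
    have ceq: "coord_rat n r (tuple_map ?S c) = coord_rat n r c"
      unfolding coord_jordan_block[OF cc] unfolding coord shift_linear using u by (simp only: mem_Collect_eq)
    have "coord n r (tuple_map ?S c) y = coord n r c y" for y
      using fun_cong[OF ceq, of y] by (simp add: coord_rat_def)
    then have "lift n r (coord n r (tuple_map ?S c - c)) = 0" by (simp add: lift_def)
    then have "ext_equiv n r 0 (frag_cmul (fact r) (tuple_map ?S c - c))"
      using lift_coord[OF ext_tuples_closed(2)[OF tuple_map_closed[OF cc S] cc]] by simp
    then have "frag_cmul (fact r) (tuple_map ?S c - c) \<in> ext_null n r"
      using ext_equiv_sym[of n r 0] by (simp add: ext_equiv_def)
    also have "frag_cmul (fact r) (tuple_map ?S c - c) = tuple_map ?S (frag_cmul (fact r) c) - frag_cmul (fact r) c"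
      by (simp only: tuple_map_def frag_extend_cmul frag_cmul_diff_distrib2)
    finally have null: "tuple_map ?S (frag_cmul (fact r) c) - frag_cmul (fact r) c \<in> ext_null n r" .
    have fc: "frag_cmul (fact r) c \<in> carrier (ext_tuples n r)" by (rule ext_tuples_closed(4)[OF cc cc])
    \<comment> \<open>One factor r! comes from \<open>coord_lift\<close>, the other from removing
      the torsion, and \<open>N\<close> from the denominators.\<close>
    have "?\<phi> (ext_class n r (frag_cmul (fact r) c)) = fscale (of_int (fact r * fact r * N)) u"
      unfolding coord_ext_class[OF fc]
    proof
      fix y
      show "coord_rat n r (frag_cmul (fact r) c) y = fscale (of_int (fact r * fact r * N)) u y"
        using fun_cong[OF coord, of y] by (simp add: coord_rat_def)
    qed
    moreover have "ext_class n r (frag_cmul (fact r) c) \<in> carrier ?G"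
      using null fc unfolding kernel_ext_map_minus_id[OF S] by simp
    ultimately show "\<exists>x\<in>carrier ?G. \<exists>N::int. N \<noteq> 0 \<and> ?\<phi> x = fscale (of_int N) u"
      using N(1) by (intro bexI exI[of _ "fact r * fact r * N"] conjI) auto
  qed
qed

lemma anzai_rank_eq_card:
  assumes "n \<ge> 1"
  shows "anzai_rank n = card {I. I \<subseteq> {..<n} \<and> \<Sum>I = card I * (n - 1) div 2}"
proof -
  let ?A = "\<lambda>r. {I. I \<subseteq> {..<n} \<and> card I = r \<and> \<Sum>I = r * (n - 1) div 2}"
  have "anzai_rank n = (\<Sum>r=0..n. card (?A r))"
    unfolding anzai_rank_def abelian_rank_kernel dim_shift_fixed[OF assms] ..
  also have "\<dots> = card (\<Union>r\<in>{0..n}. ?A r)"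
  proof (rule card_UN_disjoint[symmetric])
    have "finite (?A r)" for r by (rule finite_subset[of _ "Pow {..<n}"]) auto
    then show "\<forall>r\<in>{0..n}. finite (?A r)" by blast
    show "\<forall>r\<in>{0..n}. \<forall>s\<in>{0..n}. r \<noteq> s \<longrightarrow> ?A r \<inter> ?A s = {}" by blast
  qed simp
  also have "(\<Union>r\<in>{0..n}. ?A r) = {I. I \<subseteq> {..<n} \<and> \<Sum>I = card I * (n - 1) div 2}"
  proof -
    have "card I \<le> n" if "I \<subseteq> {..<n}" for I using card_mono[OF finite_lessThan that] by simp
    then show ?thesis by (intro equalityI subsetI) auto
  qed
  finally show ?thesis .
qed


subsection \<open>Trigonometric sums\<close>

definition cos_prod :: "nat \<Rightarrow> real \<Rightarrow> real" where
  "cos_prod n t = (\<Prod>j<n. cos (t * (2 * real j - (real n - 1)) / 2))"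

text \<open>Twice the deviation of the sum of \<open>I\<close> from the middle weight. The terms are
  centred, which makes the generating function below real.\<close>

definition balance :: "nat \<Rightarrow> nat set \<Rightarrow> int" where
  "balance n I = (\<Sum>j\<in>I. 2 * int j - (int n - 1))"

lemma sum_balanced: "(\<Sum>j<n. 2 * real j - (real n - 1)) = 0"
proof -
  \<comment> \<open>The centre \<open>c\<close> is decoupled from the number of terms to permit
    induction.\<close>
  have "(\<Sum>j<m. 2 * real j - c) = real m * (real m - 1 - c)" for m c
    by (induction m) (auto simp: algebra_simps)
  then show ?thesis by simp
qed

text \<open>The sum over subsets is the product of the factors 1 + cis (t w), and each is 2 cos (t w
  / 2) times the phase cis (t w / 2). The phases cancel because the numbers \<open>w j\<close> add
  up to 0.\<close>

lemma sum_cis_balance: "(\<Sum>I\<in>Pow {..<n}. cis (t * of_int (balance n I))) = complex_of_real (2 ^ n * cos_prod n t)"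
proof -
  define w where "w j = 2 * real j - (real n - 1)" for j
  have cis_sum: "(\<Prod>j\<in>A. cis (f j)) = cis (\<Sum>j\<in>A. f j)" for A :: "nat set" and f
    by (induction A rule: infinite_finite_induct) (auto simp: cis_mult)
  have half: "cis a + 1 = complex_of_real (2 * cos (a / 2)) * cis (a / 2)" for a
  proof -
    have "cos a + 1 = 2 * cos (a / 2) * cos (a / 2)"
      using cos_double_cos[of "a / 2"] by (simp add: power2_eq_square)
    moreover have "sin a = 2 * cos (a / 2) * sin (a / 2)"
      using sin_double[of "a / 2"] by simp
    ultimately show ?thesis by (simp add: complex_eq_iff)
  qed
  have "(\<Sum>I\<in>Pow {..<n}. cis (t * of_int (balance n I))) = (\<Sum>I\<in>Pow {..<n}. (\<Prod>j\<in>I. cis (t * w j)) * (\<Prod>j\<in>{..<n} - I. 1))"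
    by (intro sum.cong refl) (simp add: cis_sum balance_def w_def sum_distrib_left)
  also have "\<dots> = (\<Prod>j<n. cis (t * w j) + 1)"
    by (rule prod_add[symmetric]) simp
  also have "\<dots> = (\<Prod>j<n. complex_of_real (2 * cos (t * w j / 2))) * cis (\<Sum>j<n. t * w j / 2)"
    by (simp only: half prod.distrib cis_sum)
  also have "(\<Sum>j<n. t * w j / 2) = t / 2 * (\<Sum>j<n. w j)"
    by (simp add: sum_distrib_left)
  also have "\<dots> = 0" by (simp add: w_def sum_balanced)
  also have "(\<Prod>j<n. complex_of_real (2 * cos (t * w j / 2))) = complex_of_real (\<Prod>j<n. 2 * cos (t * w j / 2))"
    by (rule of_real_prod[symmetric])
  also have "(\<Prod>j<n. 2 * cos (t * w j / 2)) = 2 ^ n * cos_prod n t"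
    by (simp add: prod.distrib cos_prod_def w_def)
  finally show ?thesis by simp
qed

text \<open>The second sum detects the balance -1, which the floor admits.\<close>

lemma sum_cos_balance:
  "(\<Sum>I\<in>Pow {..<n}. cos (of_int (balance n I) * t)) = 2 ^ n * cos_prod n t"
  "(\<Sum>I\<in>Pow {..<n}. cos (of_int (balance n I + 1) * t)) = 2 ^ n * (cos t * cos_prod n t)"
proof -
  have "Re (\<Sum>I\<in>Pow {..<n}. cis (t * of_int (balance n I))) = 2 ^ n * cos_prod n t"
    by (simp only: sum_cis_balance Re_complex_of_real)
  then show "(\<Sum>I\<in>Pow {..<n}. cos (of_int (balance n I) * t)) = 2 ^ n * cos_prod n t"
    by (simp add: mult.commute)
  have "cis t * (\<Sum>I\<in>Pow {..<n}. cis (t * of_int (balance n I))) =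
      (\<Sum>I\<in>Pow {..<n}. cis (of_int (balance n I + 1) * t))"
    unfolding sum_distrib_left cis_mult by (intro sum.cong refl) (simp add: algebra_simps)
  then have "(\<Sum>I\<in>Pow {..<n}. cis (of_int (balance n I + 1) * t)) = cis t * complex_of_real (2 ^ n * cos_prod n t)"
    by (simp only: sum_cis_balance)
  then have "Re (\<Sum>I\<in>Pow {..<n}. cis (of_int (balance n I + 1) * t)) = Re (cis t * complex_of_real (2 ^ n * cos_prod n t))"
    by (simp only:)
  then show "(\<Sum>I\<in>Pow {..<n}. cos (of_int (balance n I + 1) * t)) = 2 ^ n * (cos t * cos_prod n t)"
    by (simp only: Re_sum cis.sel Re_complex_of_real times_complex.sel Im_complex_of_real) simp
qed

lemma continuous_cos_prod [continuous_intros]: "continuous_on S (cos_prod n)"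
  unfolding cos_prod_def[abs_def] by (intro continuous_intros) auto

section \<open>Fourier inversion\<close>

lemma integral_cos_Icc:
  fixes a k :: real
  assumes "a \<ge> 0" "sin (k * a) = 0"
  shows "(LBINT t:{-a..a}. cos (k * t)) = (if k = 0 then 2 * a else 0)"
proof (cases "k = 0")
  case True
  then show ?thesis using assms by (simp add: set_lebesgue_integral_def)
next
  case False
  have "(LBINT t:{-a..a}. cos (k * t)) = sin (k * a) / k - sin (k * (-a)) / k"
    unfolding set_lebesgue_integral_def
  proof (rule integral_FTC_atLeastAtMost)
    fix x
    have "((\<lambda>t. sin (k * t) / k) has_field_derivative cos (k * x)) (at x within {- a..a})"
      using False by (auto intro!: derivative_eq_intros)
    then show "((\<lambda>t. sin (k * t) / k) has_vector_derivative cos (k * x)) (at x within {- a..a})"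
      by (simp only: has_real_derivative_iff_has_vector_derivative)
  qed (use assms in \<open>auto intro!: continuous_intros\<close>)
  then show ?thesis using False assms by simp
qed

definition central_subsets :: "nat \<Rightarrow> nat set set" where
  "central_subsets n = {I. I \<subseteq> {..<n} \<and> \<Sum>I = card I * (n - 1) div 2}"

text \<open>Rounding down \<open>c div 2\<close> leaves the remainder 0 or 1, so
  \<open>2 * \<Sum>I - c\<close> is 0 or -1; the parity of \<open>c\<close> decides which.\<close>

lemma central_subsets_balance:
  assumes "n \<ge> 1"
  shows "central_subsets n = {I \<in> Pow {..<n}. balance n I = 0 \<or> balance n I = -1}"
proof -
  have "\<Sum>I = card I * (n - 1) div 2 \<longleftrightarrow> balance n I = 0 \<or> balance n I = -1" if "I \<subseteq> {..<n}" for I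
  proof -
    define c where "c = card I * (n - 1)"
    have "balance n I = 2 * int (\<Sum>I) - int c"
      using assms by (simp add: balance_def c_def sum_subtractf sum_distrib_left of_nat_diff)
    moreover have "\<Sum>I = c div 2 \<longleftrightarrow> 2 * int (\<Sum>I) - int c = 0 \<or> 2 * int (\<Sum>I) - int c = -1"
      by presburger
    ultimately show ?thesis by (simp add: c_def)
  qed
  then show ?thesis by (auto simp: central_subsets_def)
qed

lemma balance_even:
  assumes "odd n"
  shows "even (balance n I)"
  unfolding balance_def using assms by (intro dvd_sum) auto

text \<open>Over a full period the cosine with frequency \<open>balance n I\<close> picks out
  balance 0, and the one with frequency \<open>balance n I + 1\<close> picks out balance -1.
  Together they produce the kernel \<open>1 + cos t\<close>.\<close>

lemma card_central_even:
  assumes "n \<ge> 1"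
  shows "2 ^ n * (LBINT t:{-pi..pi}. (1 + cos t) * cos_prod n t) = 2 * pi * real (card (central_subsets n))"
proof -
  let ?b = "\<lambda>I. real_of_int (balance n I)"
  have int: "(LBINT t:{-pi..pi}. cos (real_of_int k * t)) = (if k = 0 then 2 * pi else 0)" for k
    using integral_cos_Icc[of pi "real_of_int k"] by (simp add: sin_integer_2pi sin_zero_iff_int2 mult.commute)
  have "2 ^ n * (LBINT t:{-pi..pi}. (1 + cos t) * cos_prod n t) = (LBINT t:{-pi..pi}. 2 ^ n * ((1 + cos t) * cos_prod n t))"
    by simp
  also have "\<dots> = (LBINT t:{-pi..pi}. \<Sum>I\<in>Pow {..<n}. cos (?b I * t) + cos (of_int (balance n I + 1) * t))"
    by (simp only: sum.distrib sum_cos_balance) (simp add: algebra_simps)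
  also have "\<dots> = (\<Sum>I\<in>Pow {..<n}. LBINT t:{-pi..pi}. cos (?b I * t) + cos (of_int (balance n I + 1) * t))"
    unfolding set_lebesgue_integral_def sum_distrib_left scaleR_sum_right
    by (intro Bochner_Integration.integral_sum borel_integrable_atLeastAtMost'[unfolded set_integrable_def] continuous_intros)
  also have "\<dots> = (\<Sum>I\<in>Pow {..<n}. if balance n I = 0 \<or> balance n I = -1 then 2 * pi else 0)"
  proof (intro sum.cong refl)
    fix I
    have "(LBINT t:{-pi..pi}. cos (?b I * t) + cos (of_int (balance n I + 1) * t)) =
        (LBINT t:{-pi..pi}. cos (?b I * t)) + (LBINT t:{-pi..pi}. cos (of_int (balance n I + 1) * t))"
      by (intro set_integral_add borel_integrable_atLeastAtMost' continuous_intros)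
    then show "(LBINT t:{-pi..pi}. cos (?b I * t) + cos (of_int (balance n I + 1) * t)) =
        (if balance n I = 0 \<or> balance n I = -1 then 2 * pi else 0)"
      unfolding int by auto
  qed
  also have "\<dots> = 2 * pi * real (card (central_subsets n))"
    unfolding central_subsets_balance[OF assms] by (simp add: sum.If_cases Int_def conj_commute)
  finally show ?thesis .
qed

text \<open>For odd \<open>n\<close> the product of cosines has period \<open>\<pi>\<close> and is not small near \<open>t = \<pi>\<close>; as all balances
  are then even, an interval of length \<open>\<pi>\<close> suffices.\<close>

lemma card_central_odd:
  assumes "odd n"
  shows "2 ^ n * (LBINT t:{-(pi/2)..pi/2}. cos_prod n t) = pi * real (card (central_subsets n))"
proof -
  let ?b = "\<lambda>I. real_of_int (balance n I)"
  have int: "(LBINT t:{-(pi/2)..pi/2}. cos (?b I * t)) = (if balance n I = 0 then pi else 0)" for I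
  proof -
    obtain k where k: "balance n I = 2 * k" using balance_even[OF assms] by (auto elim: evenE)
    have "sin (real_of_int k * pi) = 0" by (simp add: sin_zero_iff_int2)
    then show ?thesis using integral_cos_Icc[of "pi / 2" "?b I"] by (simp add: k)
  qed
  have "2 ^ n * (LBINT t:{-(pi/2)..pi/2}. cos_prod n t) = (LBINT t:{-(pi/2)..pi/2}. 2 ^ n * cos_prod n t)"
    by simp
  also have "\<dots> = (LBINT t:{-(pi/2)..pi/2}. \<Sum>I\<in>Pow {..<n}. cos (?b I * t))"
    by (simp only: sum_cos_balance)
  also have "\<dots> = (\<Sum>I\<in>Pow {..<n}. LBINT t:{-(pi/2)..pi/2}. cos (?b I * t))"
    unfolding set_lebesgue_integral_def scaleR_sum_right
    by (intro Bochner_Integration.integral_sum borel_integrable_atLeastAtMost'[unfolded set_integrable_def] continuous_intros)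
  also have "\<dots> = pi * real (card {I \<in> Pow {..<n}. balance n I = 0})"
    unfolding int by (simp add: sum.If_cases Int_def)
  also have "{I \<in> Pow {..<n}. balance n I = 0} = central_subsets n"
  proof -
    have "balance n I \<noteq> -1" for I using balance_even[OF assms, of I] by auto
    moreover have "n \<ge> 1" using assms by (cases n) auto
    ultimately show ?thesis by (simp add: central_subsets_balance)
  qed
  finally show ?thesis .
qed

section \<open>Bounds for the product of cosines\<close>

lemma sin_lower_bound:
  assumes "0 \<le> x" "x \<le> pi / 2"
  shows "2 * x / pi \<le> sin x"
proof -
  \<comment> \<open>Jordan's inequality: a concave function lies above its chord.\<close>
  have "concave_on {0..pi/2} sin"
    by (rule f''_le0_imp_concave[where f' = cos and f'' = "\<lambda>x. - sin x"])
      (auto intro!: derivative_eq_intros sin_ge_zero)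
  then have "sin ((1 - 2 * x / pi) *\<^sub>R 0 + (2 * x / pi) *\<^sub>R (pi / 2)) \<ge> (1 - 2 * x / pi) * sin 0 + (2 * x / pi) * sin (pi / 2)"
    using assms by (intro concave_onD) (auto simp: field_simps)
  then show ?thesis by simp
qed

text \<open>The Dirichlet kernel. Multiplied by 2 sin t, each cosine becomes a difference of sines,
  and the partial sums telescope.\<close>

lemma sum_cos_closed_form:
  "sin t * (\<Sum>j<n. cos (t * (2 * real j - (real n - 1)))) = sin (real n * t)"
proof -
  have "2 * (sin t * (\<Sum>j<m. cos (t * (2 * real j - (real n - 1))))) = sin (t * (2 * real m - real n)) + sin (t * real n)" for m
  proof (induction m)
    case (Suc m)
    have "2 * (sin t * cos (t * (2 * real m - (real n - 1)))) = sin (t * (2 * real (Suc m) - real n)) - sin (t * (2 * real m - real n))"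
    proof -
      have "t * (2 * real (Suc m) - real n) = t * (2 * real m - (real n - 1)) + t"
        "t * (2 * real m - real n) = t * (2 * real m - (real n - 1)) - t"
        by (simp_all add: algebra_simps)
      then show ?thesis by (simp only: sin_add sin_diff) simp
    qed
    then show ?case using Suc by (simp add: distrib_left)
  qed (simp add: algebra_simps)
  from this[of n] show ?thesis by (simp add: mult.commute)
qed

text \<open>Squares are used because cos^2 = 1 - sin^2 \<le> exp (- sin^2) holds whatever the sign
  of the cosine; this is also the origin of the factor 2 in the hypothesis.\<close>

lemma cos_prod_bound:
  assumes "(\<Sum>j<n. (sin (t * (2 * real j - (real n - 1)) / 2))\<^sup>2) \<ge> 2 * a"
  shows "\<bar>cos_prod n t\<bar> \<le> exp (- a)"
proof -
  let ?x = "\<lambda>j. t * (2 * real j - (real n - 1)) / 2"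
  have "(cos_prod n t)\<^sup>2 = (\<Prod>j<n. (cos (?x j))\<^sup>2)"
    by (simp add: cos_prod_def prod_power_distrib)
  also have "\<dots> \<le> (\<Prod>j<n. exp (- (sin (?x j))\<^sup>2))"
  proof (intro prod_mono conjI)
    fix j
    show "(cos (?x j))\<^sup>2 \<le> exp (- (sin (?x j))\<^sup>2)"
      using exp_ge_add_one_self[of "- (sin (?x j))\<^sup>2"] by (simp only: cos_squared_eq)
  qed simp
  also have "\<dots> = exp (- (\<Sum>j<n. (sin (?x j))\<^sup>2))"
    by (simp add: exp_sum sum_negf[symmetric])
  also have "\<dots> \<le> exp (- (2 * a))" using assms by simp
  also have "\<dots> = (exp (- a))\<^sup>2" by (simp add: power2_eq_square flip: exp_add)
  finally show ?thesis by (simp add: abs_le_square_iff[symmetric])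
qed

text \<open>By sin^2 (b / 2) = (1 - cos b) / 2 the sum of squared sines is at least n / 2 - n / 4 =
  2 (n / 8).\<close>

lemma cos_prod_outer:
  assumes "(\<Sum>j<n. cos (t * (2 * real j - (real n - 1)))) \<le> real n / 2"
  shows "\<bar>cos_prod n t\<bar> \<le> exp (- real n / 8)"
proof -
  have half: "cos b = 1 - 2 * (sin (b / 2))\<^sup>2" for b :: real
    using cos_double_sin[of "b / 2"] by simp
  have "(\<Sum>j<n. (sin (t * (2 * real j - (real n - 1)) / 2))\<^sup>2) =
      (\<Sum>j<n. 1 / 2 - cos (t * (2 * real j - (real n - 1))) / 2)"
  proof (intro sum.cong refl)
    fix j
    show "(sin (t * (2 * real j - (real n - 1)) / 2))\<^sup>2 = 1 / 2 - cos (t * (2 * real j - (real n - 1))) / 2"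
      using half[of "t * (2 * real j - (real n - 1))"] by linarith
  qed
  also have "\<dots> = real n / 2 - (\<Sum>j<n. cos (t * (2 * real j - (real n - 1)))) / 2"
    by (simp add: sum_subtractf sum_divide_distrib)
  finally have "(\<Sum>j<n. (sin (t * (2 * real j - (real n - 1)) / 2))\<^sup>2) \<ge> 2 * (real n / 8)"
    using assms by simp
  then show ?thesis using cos_prod_bound[where a = "real n / 8"] by simp
qed

lemma cos_prod_uminus [simp]: "cos_prod n (- t) = cos_prod n t"
proof -
  have "cos (- t * w / 2) = cos (t * w / 2)" for w
    using cos_minus[of "t * w / 2"] by simp
  then show ?thesis by (simp only: cos_prod_def)
qed

text \<open>In this range sin \<bar>t\<bar> is at least 2 / n, by Jordan's inequality from either
  end of the interval. The closed form then bounds the sum of cosines by n / 2.\<close>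

lemma cos_prod_outer_near:
  assumes "n \<ge> 1" "pi / real n \<le> \<bar>t\<bar>" "\<bar>t\<bar> \<le> pi - pi / real n"
  shows "\<bar>cos_prod n t\<bar> \<le> exp (- real n / 8)"
proof -
  define s where "s = \<bar>t\<bar>"
  have s: "pi / real n \<le> s" "s \<le> pi - pi / real n" using assms by (auto simp: s_def)
  have pn: "0 < pi / real n" using assms(1) by simp
  have low: "2 / real n \<le> sin s"
  proof (cases "s \<le> pi / 2")
    case True
    have "2 / real n = 2 * (pi / real n) / pi" by simp
    also have "\<dots> \<le> 2 * s / pi" using s by (intro divide_right_mono) auto
    also have "\<dots> \<le> sin s" using True s pn by (intro sin_lower_bound) auto
    finally show ?thesis .
  next
    case False
    have "2 / real n = 2 * (pi / real n) / pi" by simp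
    also have "\<dots> \<le> 2 * (pi - s) / pi" using s by (intro divide_right_mono) auto
    also have "\<dots> \<le> sin (pi - s)" using False s pn by (intro sin_lower_bound) auto
    finally show ?thesis by simp
  qed
  let ?D = "\<Sum>j<n. cos (s * (2 * real j - (real n - 1)))"
  have "0 < 2 / real n" using assms(1) by simp
  then have "0 < sin s" using low by linarith
  have "?D \<le> real n / 2"
  proof (rule ccontr)
    assume "\<not> ?D \<le> real n / 2"
    then have "(2 / real n) * (real n / 2) < sin s * ?D"
      using low \<open>0 < sin s\<close> assms(1) by (intro mult_le_less_imp_less) auto
    then have "1 < sin (real n * s)" using sum_cos_closed_form[of s n] assms(1) by simp
    then show False using sin_le_one[of "real n * s"] by linarith
  qed
  then have "\<bar>cos_prod n s\<bar> \<le> exp (- real n / 8)" by (rule cos_prod_outer)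
  then show ?thesis by (auto simp: s_def abs_if split: if_splits)
qed

text \<open>With u = \<pi> - \<bar>t\<bar> and \<open>n\<close> even, sin (n (\<pi> - u)) = - sin (n
  u) is at most 0 while sin u is positive, so the sum of cosines is not positive.\<close>

lemma cos_prod_outer_pi:
  assumes "n \<ge> 1" "even n" "pi - pi / real n \<le> \<bar>t\<bar>" "\<bar>t\<bar> \<le> pi"
  shows "\<bar>cos_prod n t\<bar> \<le> exp (- real n / 8)"
proof -
  define s where "s = \<bar>t\<bar>"
  define u where "u = pi - s"
  have u: "0 \<le> u" "u \<le> pi / real n" using assms by (auto simp: u_def s_def)
  have "\<bar>cos_prod n s\<bar> \<le> exp (- real n / 8)"
  proof (cases "u = 0")
    \<comment> \<open>At \<pi> itself the closed form is void since sin \<pi> = 0; instead the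
      factor for \<open>j = 0\<close> of the product vanishes.\<close>
    case True
    obtain m where m: "n = 2 * m" using assms(2) by (auto elim: evenE)
    have "cos (s * (2 * real 0 - (real n - 1)) / 2) = cos (pi / 2 - real m * pi)"
      using True by (simp add: u_def m algebra_simps diff_divide_distrib)
    also have "\<dots> = sin (real m * pi)" by (simp add: cos_sin_eq[symmetric] sin_cos_eq)
    also have "\<dots> = 0" by simp
    finally have "cos_prod n s = 0"
      unfolding cos_prod_def using assms(1) by (intro prod_zero bexI[of _ 0]) auto
    then show ?thesis by simp
  next
    case False
    let ?D = "\<Sum>j<n. cos (s * (2 * real j - (real n - 1)))"
    have "pi / real n \<le> pi" using assms(1) by (simp add: field_simps)
    have "n \<ge> 2" using assms(1,2) by presburger
    then have "real n \<ge> 2" by simp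
    then have "pi / real n \<le> pi / 2" by (intro divide_left_mono) auto
    then have "u < pi" using u(2) pi_gt_zero by linarith
    then have "0 < sin u" using u(1) False by (intro sin_gt_zero) auto
    then have "0 < sin s" by (simp add: u_def)
    have "real n * u \<le> pi" using u(2) assms(1) by (simp add: field_simps)
    then have "0 \<le> sin (real n * u)" using u(1) by (intro sin_ge_zero) auto
    moreover have "sin (real n * s) = - sin (real n * u)"
    proof -
      have "sin (real n * s) = sin (real n * pi - real n * u)" by (simp add: u_def algebra_simps)
      also have "\<dots> = - (cos (real n * pi) * sin (real n * u))" by (simp add: sin_diff)
      finally show ?thesis using assms(2) by simp
    qed
    ultimately have "sin s * ?D \<le> 0" using sum_cos_closed_form[of s n] by simp
    then have "?D \<le> 0" using \<open>0 < sin s\<close> by (simp add: mult_le_0_iff)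
    then show ?thesis by (intro cos_prod_outer) simp
  qed
  then show ?thesis by (auto simp: s_def abs_if split: if_splits)
qed

lemma sum_squares_balanced: "(\<Sum>j<n. (2 * real j - (real n - 1))\<^sup>2) = real n * ((real n)\<^sup>2 - 1) / 3"
proof -
  have "(\<Sum>j<m. (2 * real j - c)\<^sup>2) = 2 * real m * (real m - 1) * (2 * real m - 1) / 3 - 2 * c * real m * (real m - 1) + real m * c\<^sup>2" for m c
    by (induction m) (auto simp: field_simps power2_eq_square)
  from this[of "real n - 1" n] show ?thesis by (simp add: field_simps power2_eq_square)
qed

text \<open>Here all arguments of the cosines lie within \<pi> / 2 of 0, so Jordan's inequality
  bounds the sines below by linear functions. The resulting Gaussian is wider than the limit but
  serves to dominate the integrand.\<close>

lemma cos_prod_inner: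
  assumes "n \<ge> 1" "\<bar>t\<bar> \<le> pi / real n"
  shows "\<bar>cos_prod n t\<bar> \<le> exp (- (t\<^sup>2 * (real n * ((real n)\<^sup>2 - 1)) / (6 * pi\<^sup>2)))"
proof (rule cos_prod_bound)
  have "2 * (t\<^sup>2 * (real n * ((real n)\<^sup>2 - 1)) / (6 * pi\<^sup>2)) = t\<^sup>2 / pi\<^sup>2 * (\<Sum>j<n. (2 * real j - (real n - 1))\<^sup>2)"
    unfolding sum_squares_balanced by (simp add: mult_ac)
  also have "\<dots> = (\<Sum>j<n. (t * (2 * real j - (real n - 1)) / pi)\<^sup>2)"
    by (simp add: sum_distrib_left power_mult_distrib power_divide)
  also have "\<dots> \<le> (\<Sum>j<n. (sin (t * (2 * real j - (real n - 1)) / 2))\<^sup>2)"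
  proof (intro sum_mono)
    fix j assume j: "j \<in> {..<n}"
    define y where "y = t * (2 * real j - (real n - 1)) / 2"
    have "real j \<le> real n - 1" using j by auto
    then have "\<bar>2 * real j - (real n - 1)\<bar> \<le> real n" by (auto simp: abs_le_iff)
    then have "\<bar>t\<bar> * \<bar>2 * real j - (real n - 1)\<bar> \<le> pi / real n * real n"
      using assms by (intro mult_mono) auto
    then have "\<bar>y\<bar> \<le> pi / 2" using assms(1) by (simp add: y_def abs_mult)
    then have "2 * \<bar>y\<bar> / pi \<le> sin \<bar>y\<bar>" by (intro sin_lower_bound) auto
    then have "(2 * \<bar>y\<bar> / pi)\<^sup>2 \<le> (sin \<bar>y\<bar>)\<^sup>2" by (intro power_mono) auto
    also have "(sin \<bar>y\<bar>)\<^sup>2 = (sin y)\<^sup>2" by (simp add: abs_if)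
    also have "(2 * \<bar>y\<bar> / pi)\<^sup>2 = (t * (2 * real j - (real n - 1)) / pi)\<^sup>2"
      by (simp add: y_def power_divide power_mult_distrib)
    finally show "(t * (2 * real j - (real n - 1)) / pi)\<^sup>2 \<le> (sin (t * (2 * real j - (real n - 1)) / 2))\<^sup>2"
      by (simp add: y_def)
  qed
  finally show "2 * (t\<^sup>2 * (real n * ((real n)\<^sup>2 - 1)) / (6 * pi\<^sup>2)) \<le> (\<Sum>j<n. (sin (t * (2 * real j - (real n - 1)) / 2))\<^sup>2)" .
qed


subsection \<open>Asymptotics of the number of central subsets\<close>

text \<open>The bound \<open>M\<close> is taken over the whole length of the larger interval; for
  \<open>a = 0\<close> the lemma estimates a single integral.\<close>

lemma symmetric_integral_diff_bound:
  fixes f :: "real \<Rightarrow> real"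
  assumes f: "continuous_on UNIV f" and ab: "0 \<le> a" "a \<le> b"
    and M: "\<And>t. a \<le> \<bar>t\<bar> \<Longrightarrow> \<bar>t\<bar> \<le> b \<Longrightarrow> \<bar>f t\<bar> \<le> M"
  shows "\<bar>(LBINT t:{-b..b}. f t) - (LBINT t:{-a..a}. f t)\<bar> \<le> 2 * b * M"
proof -
  have int: "set_integrable lborel {-c..c} f" for c
    using continuous_on_subset[OF f] by (intro borel_integrable_atLeastAtMost') auto
  have "(LBINT t:{-b..b}. f t) - (LBINT t:{-a..a}. f t) =
      (\<integral>t. indicator {-b..b} t *\<^sub>R f t - indicator {-a..a} t *\<^sub>R f t \<partial>lborel)"
    unfolding set_lebesgue_integral_def
    by (rule Bochner_Integration.integral_diff[symmetric]) (use int in \<open>auto simp: set_integrable_def\<close>)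
  also have "\<bar>\<dots>\<bar> \<le> (\<integral>t. M * indicator {-b..b} t \<partial>lborel)"
    unfolding real_norm_def[symmetric]
  proof (rule Bochner_Integration.integral_norm_bound_integral)
    show "integrable lborel (\<lambda>t. indicator {-b..b} t *\<^sub>R f t - indicator {-a..a} t *\<^sub>R f t)"
      using int[of a] int[of b] by (intro Bochner_Integration.integrable_diff) (auto simp: set_integrable_def)
    show "integrable lborel (\<lambda>t. M * indicator {-b..b} t :: real)"
      by (intro integrable_mult_right integrable_real_indicator) (auto simp: emeasure_lborel_Icc_eq)
    have M0: "0 \<le> M" using M[of b] ab by (auto intro: order_trans[OF abs_ge_zero])
    show "norm (indicator {-b..b} t *\<^sub>R f t - indicator {-a..a} t *\<^sub>R f t) \<le> M * indicator {-b..b} t" for t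
      using M[of t] M0 ab by (auto simp: indicator_def)
  qed
  also have "\<dots> = 2 * b * M" using ab by simp
  finally show ?thesis .
qed

definition main_part :: "nat \<Rightarrow> real" where
  "main_part n = (LBINT t:{-(pi / real n)..pi / real n}. cos_prod n t)"

lemma abs_cos_prod_le_1: "\<bar>cos_prod n t\<bar> \<le> 1"
  unfolding cos_prod_def abs_prod by (intro prod_le_1) auto

text \<open>For odd \<open>n\<close> the inversion integral carries 1/\<pi>; for even
  \<open>n\<close> it carries 1/(2 \<pi>) and the kernel \<open>1 + cos t\<close>, which is close to
  2 near 0. Both thus reduce to \<open>main_part n / pi\<close>. The exponential error comes from
  the outer region, the cubic one from replacing the kernel by 2.\<close>

lemma card_central_approx:
  assumes n: "n \<ge> 2"
  shows "\<bar>real (card (central_subsets n)) / 2 ^ n - main_part n / pi\<bar> \<le> 2 * exp (- real n / 8) + pi\<^sup>2 / real n ^ 3"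
proof -
  have "pi / real n \<le> pi / 2"
    by (rule divide_left_mono) (use n in auto)
  then have pn: "0 \<le> pi / real n" "pi / real n \<le> pi / 2" by simp_all
  show ?thesis
  proof (cases "odd n")
    case True
    have "\<bar>(LBINT t:{-(pi/2)..pi/2}. cos_prod n t) - main_part n\<bar> \<le> 2 * (pi / 2) * exp (- real n / 8)"
      unfolding main_part_def using n pn
      by (intro symmetric_integral_diff_bound continuous_cos_prod cos_prod_outer_near) auto
    moreover have "(LBINT t:{-(pi/2)..pi/2}. cos_prod n t) = pi * (real (card (central_subsets n)) / 2 ^ n)"
      using card_central_odd[OF True] by (simp add: field_simps)
    ultimately have "\<bar>pi * (real (card (central_subsets n)) / 2 ^ n - main_part n / pi)\<bar> \<le> pi * exp (- real n / 8)"
      by (simp add: right_diff_distrib)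
    then have "\<bar>real (card (central_subsets n)) / 2 ^ n - main_part n / pi\<bar> \<le> exp (- real n / 8)"
      by (simp add: abs_mult)
    also have "\<dots> \<le> 2 * exp (- real n / 8) + pi\<^sup>2 / real n ^ 3" by (simp add: add_increasing2)
    finally show ?thesis .
  next
    case False
    define I where "I = (LBINT t:{-(pi / real n)..pi / real n}. (1 + cos t) * cos_prod n t)"
    have c: "continuous_on S (\<lambda>t. (1 + cos t) * cos_prod n t)" for S
      by (intro continuous_intros)
    have "\<bar>(LBINT t:{-pi..pi}. (1 + cos t) * cos_prod n t) - I\<bar> \<le> 2 * pi * (2 * exp (- real n / 8))"
      unfolding I_def
    proof (rule symmetric_integral_diff_bound[OF c pn(1)])
      show "pi / real n \<le> pi" using pn pi_gt_zero by linarith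
      fix t assume t: "pi / real n \<le> \<bar>t\<bar>" "\<bar>t\<bar> \<le> pi"
      have "\<bar>cos_prod n t\<bar> \<le> exp (- real n / 8)"
        using cos_prod_outer_near[of n t] cos_prod_outer_pi[of n t] t False n by linarith
      moreover have "\<bar>1 + cos t\<bar> \<le> 2" using cos_le_one[of t] cos_ge_minus_one[of t] by linarith
      ultimately show "\<bar>(1 + cos t) * cos_prod n t\<bar> \<le> 2 * exp (- real n / 8)"
        unfolding abs_mult by (intro mult_mono) auto
    qed
    moreover have "(LBINT t:{-pi..pi}. (1 + cos t) * cos_prod n t) = 2 * pi * (real (card (central_subsets n)) / 2 ^ n)"
      using card_central_even[of n] n by (simp add: field_simps)
    moreover have "\<bar>I - 2 * main_part n\<bar> \<le> 2 * (pi / real n) * (pi / real n)\<^sup>2"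
    proof -
      have "I - 2 * main_part n = (LBINT t:{-(pi / real n)..pi / real n}. (1 + cos t) * cos_prod n t - 2 * cos_prod n t)"
        unfolding I_def main_part_def
        by (subst set_integral_diff(2)) (auto intro!: borel_integrable_atLeastAtMost' continuous_intros)
      also have "\<dots> = (LBINT t:{-(pi / real n)..pi / real n}. (cos t - 1) * cos_prod n t)"
        by (simp add: algebra_simps)
      also have "\<bar>\<dots>\<bar> \<le> 2 * (pi / real n) * (pi / real n)\<^sup>2"
      proof -
        \<comment> \<open>Comparison with the degenerate interval at 0, whose integral is zero,
          bounds the integral itself.\<close>
        have "\<bar>(LBINT t:{-(pi / real n)..pi / real n}. (cos t - 1) * cos_prod n t) - (LBINT t:{-0..0}. (cos t - 1) * cos_prod n t)\<bar>
            \<le> 2 * (pi / real n) * (pi / real n)\<^sup>2"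
        proof (rule symmetric_integral_diff_bound)
          fix t :: real assume t: "\<bar>t\<bar> \<le> pi / real n"
          have "\<bar>cos t - 1\<bar> = 2 * (sin (t / 2))\<^sup>2" using cos_double_sin[of "t / 2"] by simp
          also have "\<dots> \<le> 2 * \<bar>t / 2\<bar>\<^sup>2"
            using power_mono[OF abs_sin_x_le_abs_x[of "t / 2"] abs_ge_zero, of 2] by simp
          also have "\<dots> \<le> \<bar>t\<bar>\<^sup>2" by (simp add: power_divide)
          also have "\<dots> \<le> (pi / real n)\<^sup>2" using t by (intro power_mono) auto
          finally have "\<bar>cos t - 1\<bar> * \<bar>cos_prod n t\<bar> \<le> (pi / real n)\<^sup>2 * 1"
            using abs_cos_prod_le_1 by (intro mult_mono) auto
          then show "\<bar>(cos t - 1) * cos_prod n t\<bar> \<le> (pi / real n)\<^sup>2" by (simp add: abs_mult)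
        qed (use pn in \<open>auto intro!: continuous_intros\<close>)
        moreover have "(LBINT t:{-0..0::real}. (cos t - 1) * cos_prod n t) = 0"
        proof -
          have "(\<lambda>t. indicator {-0..0::real} t *\<^sub>R ((cos t - 1) * cos_prod n t)) = (\<lambda>t. 0)"
            by (auto simp: indicator_def fun_eq_iff)
          then show ?thesis by (simp only: set_lebesgue_integral_def Bochner_Integration.integral_zero)
        qed
        ultimately show ?thesis by simp
      qed
      finally show ?thesis .
    qed
    ultimately have "\<bar>2 * pi * (real (card (central_subsets n)) / 2 ^ n) - 2 * main_part n\<bar> \<le>
        2 * pi * (2 * exp (- real n / 8)) + 2 * (pi / real n) * (pi / real n)\<^sup>2"
      by linarith
    also have "\<dots> = 2 * pi * (2 * exp (- real n / 8) + pi\<^sup>2 / real n ^ 3)"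
      using n by (simp add: field_simps power2_eq_square power3_eq_cube)
    also have "2 * pi * (real (card (central_subsets n)) / 2 ^ n) - 2 * main_part n =
        2 * pi * (real (card (central_subsets n)) / 2 ^ n - main_part n / pi)"
      by (simp add: field_simps)
    finally show ?thesis by (simp add: abs_mult del: times_divide_eq_right)
  qed
qed

section \<open>Convergence to the Gaussian integral\<close>

lemma cos_exp_quartic:
  obtains C \<delta> :: real where "\<delta> > 0" "\<And>x. \<bar>x\<bar> < \<delta> \<Longrightarrow> \<bar>cos x - exp (- x\<^sup>2 / 2)\<bar> \<le> C * x ^ 4"
proof -
  have "(\<lambda>x::real. cos x - exp (- x\<^sup>2 / 2)) \<in> O[at 0](\<lambda>x. x ^ 4)"
    by real_asymp
  then obtain C where "eventually (\<lambda>x::real. norm (cos x - exp (- x\<^sup>2 / 2)) \<le> C * norm (x ^ 4)) (at 0)"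
    by (elim landau_o.bigE)
  then obtain \<delta> where d: "\<delta> > 0" "\<And>x::real. x \<noteq> 0 \<Longrightarrow> \<bar>x\<bar> < \<delta> \<Longrightarrow> \<bar>cos x - exp (- x\<^sup>2 / 2)\<bar> \<le> C * x ^ 4"
    by (auto simp: eventually_at dist_real_def)
  \<comment> \<open>The filter \<open>at 0\<close> omits the point 0, where both sides
    vanish.\<close>
  have "\<bar>cos x - exp (- x\<^sup>2 / 2)\<bar> \<le> C * x ^ 4" if "\<bar>x\<bar> < \<delta>" for x
    using d(2)[of x] that by (cases "x = 0") auto
  then show ?thesis using d(1) that by blast
qed

text \<open>The cosines are compared with Gaussians factor by factor, without logarithms. Each of
  the \<open>n\<close> factors is off by O(n^-2), and as all factors have modulus at most 1, the
  products differ by no more than the sum of these errors.\<close>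

lemma cos_prod_tendsto:
  "(\<lambda>n. cos_prod n (u / (real n * sqrt (real n)))) \<longlonglongrightarrow> exp (- u\<^sup>2 / 24)"
proof -
  obtain C \<delta> :: real where d: "\<delta> > 0" "\<And>x. \<bar>x\<bar> < \<delta> \<Longrightarrow> \<bar>cos x - exp (- x\<^sup>2 / 2)\<bar> \<le> C * x ^ 4"
    using cos_exp_quartic by blast
  \<comment> \<open>Any nonzero point within range shows that \<open>C\<close> is
    nonnegative.\<close>
  have "\<bar>cos (\<delta> / 2) - exp (- (\<delta> / 2)\<^sup>2 / 2)\<bar> \<le> C * (\<delta> / 2) ^ 4" using d(1) by (intro d(2)) auto
  then have "0 \<le> C * (\<delta> / 2) ^ 4" by (rule order_trans[OF abs_ge_zero])
  then have C: "0 \<le> C" using d(1) by (simp add: zero_le_mult_iff)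
  define x where "x n j = u / (real n * sqrt (real n)) * (2 * real j - (real n - 1)) / 2" for n j
  have xb: "\<bar>x n j\<bar> \<le> \<bar>u\<bar> / (2 * sqrt (real n))" if "j < n" for n j
  proof -
    have "real j \<le> real n - 1" using that by auto
    then have "\<bar>2 * real j - (real n - 1)\<bar> \<le> real n" by (auto simp: abs_le_iff)
    moreover have "\<bar>x n j\<bar> = \<bar>u\<bar> / (real n * sqrt (real n)) * \<bar>2 * real j - (real n - 1)\<bar> / 2"
      by (simp add: x_def abs_mult)
    ultimately have "\<bar>x n j\<bar> \<le> \<bar>u\<bar> / (real n * sqrt (real n)) * real n / 2"
      by (simp only:) (intro divide_right_mono mult_mono, auto)
    then show ?thesis using that by (simp add: field_simps)
  qed
  \<comment> \<open>The exponents add up exactly, by \<open>sum_squares_balanced\<close>; the 24 is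
    8 from the halved squares times 3 from that sum.\<close>
  have gauss: "(\<Prod>j<n. exp (- (x n j)\<^sup>2 / 2)) = exp (- u\<^sup>2 / 24 * (1 - 1 / (real n)\<^sup>2))" if n: "n \<ge> 1" for n
  proof -
    have "(\<Sum>j<n. - (x n j)\<^sup>2 / 2) = (\<Sum>j<n. - (u\<^sup>2 / (8 * real n ^ 3)) * (2 * real j - (real n - 1))\<^sup>2)"
      using n by (intro sum.cong refl) (simp add: x_def power_mult_distrib power_divide power2_eq_square[of "real n"] power3_eq_cube)
    also have "\<dots> = - (u\<^sup>2 / (8 * real n ^ 3)) * (real n * ((real n)\<^sup>2 - 1) / 3)"
      by (simp only: sum_distrib_left[symmetric] sum_squares_balanced)
    also have "\<dots> = - u\<^sup>2 / 24 * (1 - 1 / (real n)\<^sup>2)"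
      using n by (simp add: field_simps power2_eq_square power3_eq_cube)
    finally show ?thesis by (simp add: exp_sum[symmetric])
  qed
  have "eventually (\<lambda>n. \<bar>u\<bar> / (2 * sqrt (real n)) < \<delta>) sequentially"
  proof (rule order_tendstoD(2)[OF _ d(1)])
    show "(\<lambda>n. \<bar>u\<bar> / (2 * sqrt (real n))) \<longlonglongrightarrow> 0" by real_asymp
  qed
  then have "eventually (\<lambda>n. norm (cos_prod n (u / (real n * sqrt (real n))) - exp (- u\<^sup>2 / 24 * (1 - 1 / (real n)\<^sup>2))) \<le> C * u ^ 4 / 16 / real n) sequentially"
    using eventually_ge_at_top[of 1]
  proof eventually_elim
    case (elim n)
    have "norm (cos_prod n (u / (real n * sqrt (real n))) - exp (- u\<^sup>2 / 24 * (1 - 1 / (real n)\<^sup>2))) =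
        norm ((\<Prod>j<n. cos (x n j)) - (\<Prod>j<n. exp (- (x n j)\<^sup>2 / 2)))"
      using elim(2) by (simp only: gauss) (simp only: cos_prod_def x_def)
    also have "\<dots> \<le> (\<Sum>j<n. norm (cos (x n j) - exp (- (x n j)\<^sup>2 / 2)))"
      by (rule norm_prod_diff) auto
    also have "\<dots> \<le> (\<Sum>j<n. C * (u ^ 4 / (16 * (real n)\<^sup>2)))"
    proof (rule sum_mono)
      fix j assume "j \<in> {..<n}"
      then have j: "\<bar>x n j\<bar> \<le> \<bar>u\<bar> / (2 * sqrt (real n))" using xb by simp
      then have "norm (cos (x n j) - exp (- (x n j)\<^sup>2 / 2)) \<le> C * x n j ^ 4"
        using d(2)[OF le_less_trans[OF j elim(1)]] by (simp only: real_norm_def)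
      also have "x n j ^ 4 = \<bar>x n j\<bar> ^ 4" by simp
      also have "\<dots> \<le> (\<bar>u\<bar> / (2 * sqrt (real n))) ^ 4" using j by (intro power_mono) auto
      also have "\<dots> = u ^ 4 / (16 * (real n)\<^sup>2)"
        using power_mult[of "sqrt (real n)" 2 2] by (simp add: power_divide power_mult_distrib)
      finally show "norm (cos (x n j) - exp (- (x n j)\<^sup>2 / 2)) \<le> C * (u ^ 4 / (16 * (real n)\<^sup>2))"
        using C by (simp add: mult_left_mono)
    qed
    also have "\<dots> = C * u ^ 4 / 16 / real n"
      using elim(2) by (simp add: power2_eq_square)
    finally show ?case .
  qed
  moreover have "(\<lambda>n. C * u ^ 4 / 16 / real n) \<longlonglongrightarrow> 0" by real_asymp
  ultimately have "(\<lambda>n. cos_prod n (u / (real n * sqrt (real n))) - exp (- u\<^sup>2 / 24 * (1 - 1 / (real n)\<^sup>2))) \<longlonglongrightarrow> 0"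
    by (rule Lim_null_comparison)
  moreover have "(\<lambda>n. exp (- u\<^sup>2 / 24 * (1 - 1 / (real n)\<^sup>2))) \<longlonglongrightarrow> exp (- u\<^sup>2 / 24 * (1 - 0))"
    by (intro tendsto_intros) real_asymp
  ultimately have "(\<lambda>n. (cos_prod n (u / (real n * sqrt (real n))) - exp (- u\<^sup>2 / 24 * (1 - 1 / (real n)\<^sup>2))) + exp (- u\<^sup>2 / 24 * (1 - 1 / (real n)\<^sup>2))) \<longlonglongrightarrow> 0 + exp (- u\<^sup>2 / 24 * (1 - 0))"
    by (rule tendsto_add)
  then show ?thesis by simp
qed

lemma gaussian_integral:
  assumes "a > 0"
  shows "integrable lborel (\<lambda>u::real. exp (- u\<^sup>2 / a))" "(\<integral>u. exp (- u\<^sup>2 / a) \<partial>lborel) = sqrt (a * pi)"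
proof -
  \<comment> \<open>The standard deviation for which the normal density has the exponent - u^2 /
    a.\<close>
  define \<sigma> where "\<sigma> = sqrt (a / 2)"
  have s: "\<sigma> > 0" "2 * \<sigma>\<^sup>2 = a" using assms by (auto simp: \<sigma>_def)
  have eq: "exp (- u\<^sup>2 / a) = sqrt (a * pi) * normal_density 0 \<sigma> u" for u
  proof -
    have "2 * pi * \<sigma>\<^sup>2 = a * pi" using s(2) by (simp flip: s(2))
    then show ?thesis unfolding normal_density_def s(2) using assms by (simp only:) simp
  qed
  show "integrable lborel (\<lambda>u. exp (- u\<^sup>2 / a))"
    unfolding eq by (intro integrable_mult_right integrable_normal_density s(1))
  show "(\<integral>u. exp (- u\<^sup>2 / a) \<partial>lborel) = sqrt (a * pi)"
    unfolding eq using integral_normal_density[OF s(1), of 0] by simp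
qed

lemma main_part_tendsto: "(\<lambda>n. real n * sqrt (real n) * main_part n) \<longlonglongrightarrow> sqrt (24 * pi)"
\<comment> \<open>The dominating function works from \<open>n = 2\<close> on: for
  \<open>n = 1\<close> the factor n^2 - 1 in the Gaussian bound is zero.\<close>
proof (rule LIMSEQ_offset[where k = 2])
  define s where "s n u = indicator {-(pi / real n)..pi / real n} (u / (real n * sqrt (real n))) *
      cos_prod n (u / (real n * sqrt (real n)))" for n and u :: real
  have eq: "real n * sqrt (real n) * main_part n = (\<integral>u. s n u \<partial>lborel)" if n: "n \<ge> 1" for n
  proof -
    define c where "c = 1 / (real n * sqrt (real n))"
    have c: "c > 0" "real n * sqrt (real n) = 1 / c" using n by (auto simp: c_def)
    have "main_part n = \<bar>c\<bar> *\<^sub>R (\<integral>u. indicator {-(pi / real n)..pi / real n} (0 + c * u) *\<^sub>R cos_prod n (0 + c * u) \<partial>lborel)"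
      unfolding main_part_def set_lebesgue_integral_def using c(1) by (intro lborel_integral_real_affine) simp
    also have "(\<lambda>u. indicator {-(pi / real n)..pi / real n} (0 + c * u) *\<^sub>R cos_prod n (0 + c * u)) = s n"
      by (auto simp: s_def c_def fun_eq_iff)
    finally show ?thesis using c by simp
  qed
  have "(\<lambda>n. \<integral>u. s (n + 2) u \<partial>lborel) \<longlonglongrightarrow> (\<integral>u. exp (- u\<^sup>2 / 24) \<partial>lborel)"
  proof (rule integral_dominated_convergence[where w = "\<lambda>u. exp (- u\<^sup>2 / (8 * pi\<^sup>2))"])
    show "integrable lborel (\<lambda>u::real. exp (- u\<^sup>2 / (8 * pi\<^sup>2)))" by (intro gaussian_integral) simp
    show "(\<lambda>u::real. exp (- u\<^sup>2 / 24)) \<in> borel_measurable lborel" by measurable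
    have [measurable]: "cos_prod n \<in> borel_measurable borel" for n
      by (intro borel_measurable_continuous_onI continuous_cos_prod)
    show "s (n + 2) \<in> borel_measurable lborel" for n
      unfolding s_def by measurable
    show "AE u in lborel. norm (s (n + 2) u) \<le> exp (- u\<^sup>2 / (8 * pi\<^sup>2))" for n
    proof (rule AE_I2)
      fix u :: real
      define N where "N = n + 2"
      define t where "t = u / (real N * sqrt (real N))"
      have N: "real N \<ge> 2" by (simp add: N_def)
      show "norm (s (n + 2) u) \<le> exp (- u\<^sup>2 / (8 * pi\<^sup>2))"
      proof (cases "\<bar>t\<bar> \<le> pi / real N")
        case True
        have "norm (s N u) \<le> \<bar>cos_prod N t\<bar>"
          by (simp add: s_def t_def indicator_def)
        also have "\<dots> \<le> exp (- (t\<^sup>2 * (real N * ((real N)\<^sup>2 - 1)) / (6 * pi\<^sup>2)))"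
          using True N by (intro cos_prod_inner) auto
        also have "t\<^sup>2 * (real N * ((real N)\<^sup>2 - 1)) / (6 * pi\<^sup>2) = u\<^sup>2 / (6 * pi\<^sup>2) * (1 - 1 / (real N)\<^sup>2)"
          using N by (simp add: t_def power_divide power_mult_distrib field_simps power2_eq_square[of "real N"])
        also have "exp (- (u\<^sup>2 / (6 * pi\<^sup>2) * (1 - 1 / (real N)\<^sup>2))) \<le> exp (- u\<^sup>2 / (8 * pi\<^sup>2))"
        \<comment> \<open>From \<open>N \<ge> 2\<close> the factor 1 - 1 / N^2 is at least 3/4,
          which turns the 6 into the 8 of the dominating function.\<close>
        proof -
          have "2\<^sup>2 \<le> (real N)\<^sup>2" using N by (intro power_mono) auto
          then have "1 / (real N)\<^sup>2 \<le> 1 / 2\<^sup>2" by (intro divide_left_mono) (use N in auto)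
          then have "u\<^sup>2 / (6 * pi\<^sup>2) * (3 / 4) \<le> u\<^sup>2 / (6 * pi\<^sup>2) * (1 - 1 / (real N)\<^sup>2)"
            by (intro mult_left_mono) auto
          then show ?thesis by (simp add: field_simps)
        qed
        finally show ?thesis by (simp add: N_def)
      next
        case False
        then have "s N u = 0" by (auto simp: s_def t_def indicator_def)
        then show ?thesis by (simp add: N_def)
      qed
    qed
    show "AE u in lborel. (\<lambda>n. s (n + 2) u) \<longlonglongrightarrow> exp (- u\<^sup>2 / 24)"
    proof (rule AE_I2)
      fix u :: real
      have "(\<lambda>n. \<bar>u\<bar> / sqrt (real n)) \<longlonglongrightarrow> 0" by real_asymp
      \<comment> \<open>The rescaled interval has half-width \<pi> sqrt n, so it contains any fixed
        \<open>u\<close> eventually and the indicator becomes 1.\<close>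
      then have "eventually (\<lambda>n. \<bar>u\<bar> / sqrt (real n) < pi) sequentially"
        by (rule order_tendstoD(2)) simp
      then have "eventually (\<lambda>n. cos_prod n (u / (real n * sqrt (real n))) = s n u) sequentially"
        using eventually_ge_at_top[of 1]
      proof eventually_elim
        case (elim n)
        have "\<bar>u / (real n * sqrt (real n))\<bar> = (\<bar>u\<bar> / sqrt (real n)) / real n" by (simp add: abs_mult)
        also have "\<dots> \<le> pi / real n" using elim by (intro divide_right_mono) auto
        finally have "u / (real n * sqrt (real n)) \<in> {-(pi / real n)..pi / real n}"
          using abs_le_D1 abs_le_D2 minus_le_iff by (metis atLeastAtMost_iff)
        then show ?case by (simp add: s_def)
      qed
      then have "(\<lambda>n. s n u) \<longlonglongrightarrow> exp (- u\<^sup>2 / 24)"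
        by (rule Lim_transform_eventually[OF cos_prod_tendsto])
      then show "(\<lambda>n. s (n + 2) u) \<longlonglongrightarrow> exp (- u\<^sup>2 / 24)"
        by (rule LIMSEQ_ignore_initial_segment)
    qed
  qed
  then show "(\<lambda>n. real (n + 2) * sqrt (real (n + 2)) * main_part (n + 2)) \<longlonglongrightarrow> sqrt (24 * pi)"
    by (simp only: eq gaussian_integral)
qed

lemma card_central_tendsto:
  "(\<lambda>n. real n * sqrt (real n) * (real (card (central_subsets n)) / 2 ^ n)) \<longlonglongrightarrow> sqrt (24 / pi)"
proof -
  let ?a = "\<lambda>n. real (card (central_subsets n)) / 2 ^ n"
  let ?e = "\<lambda>n. real n * sqrt (real n) * (2 * exp (- real n / 8) + pi\<^sup>2 / real n ^ 3)"
  have "eventually (\<lambda>n. norm (real n * sqrt (real n) * (?a n - main_part n / pi)) \<le> ?e n) sequentially"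
    using eventually_ge_at_top[of 2]
  proof eventually_elim
    case (elim n)
    have "norm (real n * sqrt (real n) * (?a n - main_part n / pi)) = real n * sqrt (real n) * \<bar>?a n - main_part n / pi\<bar>"
      by (simp add: abs_mult)
    also have "\<dots> \<le> ?e n" using card_central_approx[OF elim] by (intro mult_left_mono) auto
    finally show ?case .
  qed
  \<comment> \<open>After scaling by n^(3/2) the cubic error is still of order n^(-3/2).\<close>
  moreover have "?e \<longlonglongrightarrow> 0" by real_asymp
  ultimately have "(\<lambda>n. real n * sqrt (real n) * (?a n - main_part n / pi)) \<longlonglongrightarrow> 0"
    by (rule Lim_null_comparison)
  moreover have "(\<lambda>n. real n * sqrt (real n) * main_part n / pi) \<longlonglongrightarrow> sqrt (24 * pi) / pi"
    by (intro tendsto_intros main_part_tendsto) auto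
  ultimately have "(\<lambda>n. real n * sqrt (real n) * (?a n - main_part n / pi) + real n * sqrt (real n) * main_part n / pi) \<longlonglongrightarrow> 0 + sqrt (24 * pi) / pi"
    by (rule tendsto_add)
  moreover have "sqrt (24 * pi) / pi = sqrt (24 / pi)"
    by (simp add: real_sqrt_mult real_sqrt_divide field_simps)
  ultimately show ?thesis by (simp add: right_diff_distrib)
qed

lemma central_asymptotics:
  fixes a :: "nat \<Rightarrow> nat"
  assumes a: "\<And>n. n \<ge> 1 \<Longrightarrow> a n = card (central_subsets n)"
  shows "(\<lambda>n. real (a n)) \<sim>[at_top] (\<lambda>n. sqrt (24 / pi) * 2 ^ n * real n powr (- 3 / 2))"
    and "(\<lambda>n. real (a (Suc n)) / real (a n)) \<longlonglongrightarrow> 2"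
proof -
  let ?L = "sqrt (24 / pi)"
  let ?h = "\<lambda>n. real n * sqrt (real n) * (real (a n) / 2 ^ n)"
  have L: "?L \<noteq> 0" by simp
  have h: "?h \<longlonglongrightarrow> ?L"
  proof (rule Lim_transform_eventually[OF card_central_tendsto])
    show "eventually (\<lambda>n. real n * sqrt (real n) * (real (card (central_subsets n)) / 2 ^ n) = ?h n) sequentially"
      using eventually_ge_at_top[of 1] by eventually_elim (simp add: a)
  qed
  show "(\<lambda>n. real (a n)) \<sim>[at_top] (\<lambda>n. ?L * 2 ^ n * real n powr (- 3 / 2))"
  proof (rule asymp_equivI')
    have "(\<lambda>n. ?h n / ?L) \<longlonglongrightarrow> ?L / ?L" by (intro tendsto_divide h tendsto_const L)
    then have "(\<lambda>n. ?h n / ?L) \<longlonglongrightarrow> 1" using L by simp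
    then show "(\<lambda>n. real (a n) / (?L * 2 ^ n * real n powr (- 3 / 2))) \<longlonglongrightarrow> 1"
    proof (rule Lim_transform_eventually)
      show "eventually (\<lambda>n. ?h n / ?L = real (a n) / (?L * 2 ^ n * real n powr (- 3 / 2))) sequentially"
        using eventually_ge_at_top[of 1]
      proof eventually_elim
        case (elim n)
        have "real n powr (3 / 2) = real n powr (1 + 1 / 2)" by simp
        also have "\<dots> = real n * sqrt (real n)"
          using elim by (simp only: powr_add) (simp add: powr_half_sqrt)
        finally have "real n powr (- 3 / 2) = 1 / (real n * sqrt (real n))"
          using powr_minus_divide[of "real n" "3 / 2"] by simp
        then show ?case using L by (simp add: mult_ac)
      qed
    qed
  qed
  \<comment> \<open>The limit of \<open>?h\<close> is nonzero, so consecutive quotients tend to 1;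
    the factor 2 comes from the powers of 2.\<close>
  have "(\<lambda>n. 2 * (?h (Suc n) / ?h n) * (real n * sqrt (real n) / (real (Suc n) * sqrt (real (Suc n))))) \<longlonglongrightarrow> 2 * (?L / ?L) * 1"
    by (intro tendsto_mult tendsto_divide tendsto_const h LIMSEQ_Suc[OF h] L) real_asymp
  then have "(\<lambda>n. 2 * (?h (Suc n) / ?h n) * (real n * sqrt (real n) / (real (Suc n) * sqrt (real (Suc n))))) \<longlonglongrightarrow> 2"
    using L by simp
  then show "(\<lambda>n. real (a (Suc n)) / real (a n)) \<longlonglongrightarrow> 2"
  proof (rule Lim_transform_eventually)
    \<comment> \<open>For \<open>x = 0\<close> both sides are 0 by the convention for division, so
      positivity of \<open>a n\<close> need not be shown.\<close>
    have cancel: "2 * ((q * (y / (2 * p))) / (s * (x / p))) * (s / q) = y / x" if "q \<noteq> 0" "s \<noteq> 0" "p \<noteq> 0" for p q s x y :: real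
      using that by (cases "x = 0") (simp_all add: field_simps)
    show "eventually (\<lambda>n. 2 * (?h (Suc n) / ?h n) * (real n * sqrt (real n) / (real (Suc n) * sqrt (real (Suc n)))) = real (a (Suc n)) / real (a n)) sequentially"
      using eventually_ge_at_top[of 1]
    proof eventually_elim
      case (elim n)
      show ?case unfolding power_Suc
        using elim by (intro cancel) auto
    qed
  qed
qed

theorem corollary6p9:
  shows "((\<lambda>n. real (anzai_rank n)) \<sim>[at_top]
            (\<lambda>n. sqrt (24 / pi) * 2 ^ n * real n powr (- 3 / 2))) \<and>
         (\<lambda>n. real (anzai_rank (Suc n)) / real (anzai_rank n)) \<longlonglongrightarrow> 2"
  using central_asymptotics[of anzai_rank] anzai_rank_eq_card by (simp add: central_subsets_def)

end
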